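(* Let $F$ be a random variable in $\mathbb{R}^N$ with law $\mu_F$ such that $\mu_F\succeq\mathrm{Leb}_N$ and $\mathbb{E}(F)=0$. Let $r\ge2$ be an integer with $\mathbb{E}(|F|^{r+1})<\infty$. Let $F_k$, $k\ge 1$, be independent copies of $F$, let $C(F)$ be the covariance matrix of $F$, let $A(F)$ be the inverse of $C(F)^{1/2}$, let $\mu_n$ denote the law of $S_n=\frac1{\sqrt n}\sum_{k=1}^nA(F)F_k$, and let $\Gamma$ be the standard Gaussian law on $\mathbb{R}^N$. Assume that all moments up to order $r$ of $A(F)F$ agree with the moments of a standard Gaussian random variable in $\mathbb{R}^N$. Then there is a constant $C>0$, which depends on $r$, $N$, $\underline\lambda(F)$ and $\overline\lambda(F)$, such that for every $n\ge1$ $$d_{TV}(\mu_n,\Gamma)\le C\,\bigl(1+\mathbb{E}(|F|^{r+1})\bigr)^{\max([r/3],1)}\times\frac1{n^{(r-1)/2}} .$$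
   Context: $\mu_F\succeq\mathrm{Leb}_N$ means: there exist $\varepsilon_0>0$ and a non-empty open set $D_0\subset\mathbb{R}^N$ such that $\mu_F(A)\ge\varepsilon_0\,\mathrm{Leb}_N(A\cap D_0)$ for every Borel set $A$, where $\mathrm{Leb}_N$ is the Lebesgue measure. Under this assumption and square integrability, $C(F)$ is invertible; $\underline\lambda(F)$ and $\overline\lambda(F)$ denote the smallest and the largest eigenvalue of $C(F)^{-1}$. "Moments up to order $r$ agree" means: writing $X=A(F)F$ and $G$ for a standard Gaussian random variable in $\mathbb{R}^N$, $\mathbb{E}(\prod_{j=1}^{m}X^{\alpha_j})=\mathbb{E}(\prod_{j=1}^{m}G^{\alpha_j})$ for all $m\le r$ and all $(\alpha_1,\dots,\alpha_m)\in\{1,\dots,N\}^m$. $[\cdot]$ is the integer part. The total variation distance is $d_{TV}(\mu,\nu)=\sup\{|\int f\,d\mu-\int f\,d\nu| : f \text{ measurable},\ \|f\|_\infty\le1\}$.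
   Formalization: C may also depend on the witnesses ε_0, D_0 of μ_F ⪰ Leb_N (with only r, N and the eigenvalues it fails: mix a two-point law with a tiny uniform part); C is uniform over F on sample spaces of one type, hence over all, as only the law of F matters. *)

theory Defs
  imports "HOL-Probability.Probability"
begin

text \<open>
  The relation \<open>\<mu> \<succeq> Leb\<close> with its two witnesses exposed: \<open>\<mu> \<succeq> Leb\<close> holds iff
  \<open>dominates_leb \<mu> \<epsilon> D\<close> holds for some \<open>\<epsilon>\<close> and \<open>D\<close>. The witnesses are parameters because
  constants in total variation estimates depend on them: a law
  \<open>(1 - \<delta>) discrete + \<delta> uniform\<close> satisfies the relation for every \<open>\<delta> > 0\<close>, with
  \<open>\<epsilon>\<close> of order \<open>\<delta>\<close>, whereas a normalized sum of \<open>1/\<delta>\<close> copies keeps an atomic part of mass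
  about \<open>1/e\<close>, whatever the covariance and the moments are.
\<close>

definition dominates_leb :: "(real^'n) measure \<Rightarrow> real \<Rightarrow> (real^'n) set \<Rightarrow> bool" where
  "dominates_leb \<mu> \<epsilon> D \<longleftrightarrow>
     \<epsilon> > 0 \<and> open D \<and> D \<noteq> {} \<and>
     (\<forall>A\<in>sets borel. ennreal \<epsilon> * emeasure lborel (A \<inter> D) \<le> emeasure \<mu> A)"

definition cov_matrix :: "'a measure \<Rightarrow> ('a \<Rightarrow> real^'n) \<Rightarrow> real^'n^'n" where
  "cov_matrix M F = (\<chi> i j. \<integral>\<omega>. (F \<omega> $ i - (\<integral>\<omega>'. F \<omega>' $ i \<partial>M)) *
                                (F \<omega> $ j - (\<integral>\<omega>'. F \<omega>' $ j \<partial>M)) \<partial>M)"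

definition pos_semidef :: "real^'n^'n \<Rightarrow> bool" where
  "pos_semidef B \<longleftrightarrow> transpose B = B \<and> (\<forall>x. 0 \<le> x \<bullet> (B *v x))"

text \<open>A positive semidefinite matrix has exactly one positive semidefinite square root.\<close>

definition matrix_sqrt :: "real^'n^'n \<Rightarrow> real^'n^'n" where
  "matrix_sqrt S = (THE B. pos_semidef B \<and> B ** B = S)"

definition eigvals :: "real^'n^'n \<Rightarrow> real set" where
  "eigvals B = {l. \<exists>v. v \<noteq> 0 \<and> B *v v = l *\<^sub>R v}"

definition lambda_min :: "'a measure \<Rightarrow> ('a \<Rightarrow> real^'n) \<Rightarrow> real" where
  "lambda_min M F = Min (eigvals (matrix_inv (cov_matrix M F)))"

definition lambda_max :: "'a measure \<Rightarrow> ('a \<Rightarrow> real^'n) \<Rightarrow> real" where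
  "lambda_max M F = Max (eigvals (matrix_inv (cov_matrix M F)))"

definition normalizer :: "'a measure \<Rightarrow> ('a \<Rightarrow> real^'n) \<Rightarrow> real^'n^'n" where
  "normalizer M F = matrix_inv (matrix_sqrt (cov_matrix M F))"

definition std_gaussian :: "(real^'n) measure" where
  "std_gaussian = density lborel (\<lambda>x. ennreal (\<Prod>i\<in>UNIV. std_normal_density (x $ i)))"

definition gaussian_moments_upto :: "nat \<Rightarrow> 'a measure \<Rightarrow> ('a \<Rightarrow> real^'n) \<Rightarrow> bool" where
  "gaussian_moments_upto r M X \<longleftrightarrow>
     (\<forall>m\<le>r. \<forall>\<alpha> :: nat \<Rightarrow> 'n.
        (\<integral>\<omega>. (\<Prod>j=1..m. X \<omega> $ \<alpha> j) \<partial>M) = (\<integral>x. (\<Prod>j=1..m. x $ \<alpha> j) \<partial>std_gaussian))"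

text \<open>Test functions are bounded by 1, so for probability laws the distance ranges over \<open>[0, 2]\<close>.\<close>

definition tv_dist :: "(real^'n) measure \<Rightarrow> (real^'n) measure \<Rightarrow> real" where
  "tv_dist \<mu> \<nu> =
     (SUP f\<in>{f \<in> borel_measurable borel. \<forall>x. \<bar>f x\<bar> \<le> (1::real)}.
        \<bar>(\<integral>x. f x \<partial>\<mu>) - (\<integral>x. f x \<partial>\<nu>)\<bar>)"

definition iid_copies :: "'a measure \<Rightarrow> ('a \<Rightarrow> real^'n) \<Rightarrow> (nat \<Rightarrow> 'a \<Rightarrow> real^'n) \<Rightarrow> bool" where
  "iid_copies M F Fs \<longleftrightarrow>
     prob_space.indep_vars M (\<lambda>_. borel) Fs {1..} \<and>
     (\<forall>k\<ge>1. distr M borel (Fs k) = distr M borel F)"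

definition clt_law ::
  "'a measure \<Rightarrow> ('a \<Rightarrow> real^'n) \<Rightarrow> (nat \<Rightarrow> 'a \<Rightarrow> real^'n) \<Rightarrow> nat \<Rightarrow> (real^'n) measure" where
  "clt_law M F Fs n =
     distr M borel (\<lambda>\<omega>. (1 / sqrt (real n)) *\<^sub>R (\<Sum>k=1..n. normalizer M F *v Fs k \<omega>))"

end

theory Submission
  imports Defs
begin

text \<open>
  Let \<open>X = A F\<close> be the whitened variable, \<open>\<mu>\<close> its law, \<open>\<gamma>\<close> the standard Gaussian law and
  \<open>q = r + 1\<close>. Up to the dilation by \<open>1 / sqrt n\<close>, the two laws to compare are the
  convolution powers \<open>\<mu>\<^sup>n\<close> and \<open>\<gamma>\<^sup>n\<close>, and Lindeberg's telescoping sum is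
  \<open>\<mu>\<^sup>n - \<gamma>\<^sup>n = \<Sum>i<n. (\<mu> - \<gamma>) \<mu>\<^sup>i \<gamma>\<^sup>n\<^sup>-\<^sup>1\<^sup>-\<^sup>i\<close>. On a function \<open>g\<close> whose directional derivatives of order \<open>q\<close>
  are at most \<open>K |v|\<^sup>q\<close>, the factor \<open>\<mu> - \<gamma>\<close> is small: the Taylor polynomials of degree \<open>r\<close> have
  equal integrals because the moments agree, and the remainders contribute
  \<open>K (E|X|\<^sup>q + E|G|\<^sup>q) / q!\<close> (\<open>lindeberg_step\<close>). A test function is only bounded, but the other
  \<open>n - 1\<close> factors smooth it: one of the two laws occurs at least \<open>(n - 1) / 2\<close> times among
  them, and averaging over \<open>m\<close> copies makes \<open>K\<close> of order \<open>m powr (-q/2)\<close>, up to a part of the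
  average that is negligible in the supremum norm. Each of the \<open>n\<close> terms is thus of order \<open>n powr (-q/2)\<close>, and the sum of order \<open>n powr (-(r-1)/2)\<close>, with the moment of
  order \<open>q\<close> to the first power (\<open>lindeberg_bound\<close>).

  The smoothing comes from the lower bound on the law by a multiple of Lebesgue measure on an
  open set, which gives \<open>\<mu> \<ge> p \<kappa>\<close> for a probability measure \<open>\<kappa>\<close> with a compactly supported
  \<open>C\<^sup>1\<close> density of finite Fisher information. Integration by parts against \<open>\<kappa>\<close> replaces a
  derivative of the test function by multiplication with the score of \<open>\<kappa>\<close>, and iterating this
  over \<open>m\<close> copies shows that the average over \<open>\<kappa>\<^sup>m\<close> has derivative of order \<open>1 / sqrt m\<close>
  (\<open>energy_inequality\<close>). By the binomial theorem, \<open>\<mu>\<^sup>m\<close> is a mixture of terms that contain \<open>k\<close>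
  copies of \<open>\<kappa>\<close>, where \<open>k\<close> is binomial with parameters \<open>m\<close> and \<open>p\<close>. The terms with \<open>k\<close> of order
  \<open>m\<close> bear \<open>q\<close> derivatives, each of them on its own block of about \<open>k / q\<close> copies; the others
  have exponentially small total mass (\<open>smooth_powers_cf\<close>).

  All of this takes place on trigonometric polynomials. There convolution with a law and
  differentiation both multiply the coefficients, by the characteristic function and by
  \<open>\<i> (\<xi> \<bullet> v)\<close>, so that they commute and identities between them are identities between complex
  numbers; what is estimated is the norm of such multipliers with respect to the supremum norm.
  Trigonometric polynomials suffice for the total variation distance
  (\<open>tv_dist_le_trig_test\<close>): on a large ball they separate two disjoint compact sets almost as
  sharply as an indicator function does, while being bounded by almost 1 everywhere.

  Finally, equality of the second moments says \<open>A C A\<^sup>T = 1\<close>, that is \<open>C\<^sup>-\<^sup>1 = A\<^sup>T A\<close>. Hence the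
  extreme eigenvalues of \<open>C\<^sup>-\<^sup>1\<close> bound \<open>|A x|\<^sup>2 / |x|\<^sup>2\<close> from both sides
  (\<open>whitening_matrix_bounds\<close>), which is how they enter the constant: the upper one compares the
  moments of \<open>X\<close> with those of \<open>F\<close>, and the lower one transports the smoothing from \<open>F\<close> to \<open>X\<close>.
\<close>

section \<open>Trigonometric polynomials and Fourier multipliers\<close>

text \<open>
  Real trigonometric polynomials, as lists of coefficients and frequencies: a frequency may occur
  several times, so that sums and products are plain list operations.
\<close>

definition trig :: "(complex \<times> 'a::euclidean_space) list \<Rightarrow> 'a \<Rightarrow> real" where
  "trig L x = (\<Sum>(c, \<xi>)\<leftarrow>L. Re (c * cis (\<xi> \<bullet> x)))"

definition apply_mult ::
  "('a \<Rightarrow> complex) \<Rightarrow> (complex \<times> 'a::euclidean_space) list \<Rightarrow> (complex \<times> 'a) list" where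
  "apply_mult \<phi> L = map (\<lambda>(c, \<xi>). (c * \<phi> \<xi>, \<xi>)) L"

text \<open>
  The operator norm of a multiplier on real trigonometric polynomials with the supremum norm is at
  most \<open>K\<close>. Real functions are enough, because the multipliers in question are Fourier transforms
  of real signed measures or of their derivatives, and therefore preserve them.
\<close>

definition mult_bound :: "('a::euclidean_space \<Rightarrow> complex) \<Rightarrow> real \<Rightarrow> bool" where
  "mult_bound \<phi> K \<longleftrightarrow>
     (\<forall>L B. (\<forall>x. \<bar>trig L x\<bar> \<le> B) \<longrightarrow> (\<forall>x. \<bar>trig (apply_mult \<phi> L) x\<bar> \<le> K * B))"

definition deriv_mult :: "'a::euclidean_space \<Rightarrow> 'a \<Rightarrow> complex" where
  "deriv_mult v \<xi> = \<i> * complex_of_real (\<xi> \<bullet> v)"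

definition cf :: "'a::euclidean_space measure \<Rightarrow> 'a \<Rightarrow> complex" where
  "cf \<mu> \<xi> = (\<integral>y. cis (\<xi> \<bullet> y) \<partial>\<mu>)"

lemma trig_Nil [simp]: "trig [] x = 0"
  by (simp add: trig_def)

lemma trig_Cons: "trig ((c, \<xi>) # L) x = Re (c * cis (\<xi> \<bullet> x)) + trig L x"
  by (simp add: trig_def)

lemma trig_append: "trig (L @ L') x = trig L x + trig L' x"
  by (simp add: trig_def)

lemma apply_mult_Nil [simp]: "apply_mult \<phi> [] = []"
  by (simp add: apply_mult_def)

lemma apply_mult_Cons: "apply_mult \<phi> ((c, \<xi>) # L) = (c * \<phi> \<xi>, \<xi>) # apply_mult \<phi> L"
  by (simp add: apply_mult_def)

lemma apply_mult_mult: "apply_mult \<phi> (apply_mult \<psi> L) = apply_mult (\<lambda>\<xi>. \<phi> \<xi> * \<psi> \<xi>) L"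
  by (auto simp: apply_mult_def)

lemma trig_apply_mult_add:
  "trig (apply_mult (\<lambda>\<xi>. \<phi> \<xi> + \<psi> \<xi>) L) x = trig (apply_mult \<phi> L) x + trig (apply_mult \<psi> L) x"
  by (induction L) (auto simp: apply_mult_Cons trig_Cons algebra_simps)

lemma trig_apply_mult_diff:
  "trig (apply_mult (\<lambda>\<xi>. \<phi> \<xi> - \<psi> \<xi>) L) x = trig (apply_mult \<phi> L) x - trig (apply_mult \<psi> L) x"
  by (induction L) (auto simp: apply_mult_Cons trig_Cons algebra_simps)

lemma trig_apply_mult_scale:
  "trig (apply_mult (\<lambda>\<xi>. complex_of_real a * \<phi> \<xi>) L) x = a * trig (apply_mult \<phi> L) x"
  by (induction L) (auto simp: apply_mult_Cons trig_Cons algebra_simps)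

lemma apply_mult_1 [simp]: "apply_mult (\<lambda>\<xi>. 1) L = L"
  by (induction L) (auto simp: apply_mult_Cons)

lemma continuous_trig: "continuous_on UNIV (trig L)"
proof -
  have "continuous_on UNIV (\<lambda>x. trig L x)"
    by (induction L) (auto simp: trig_Cons intro!: continuous_intros)
  then show ?thesis by simp
qed

lemma measurable_trig [measurable]: "trig L \<in> borel_measurable borel"
  using continuous_trig by (rule borel_measurable_continuous_onI)

lemma bounded_trig: "\<exists>B. \<forall>x. \<bar>trig L x\<bar> \<le> B"
proof (induction L)
  case Nil
  show ?case by (auto intro: exI[of _ 0])
next
  case (Cons a L)
  then obtain B where B: "\<And>x. \<bar>trig L x\<bar> \<le> B" by blast
  obtain c \<xi> where a: "a = (c, \<xi>)" by fastforce
  have "\<bar>trig (a # L) x\<bar> \<le> cmod c + B" for x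
  proof -
    have "\<bar>Re (c * cis (\<xi> \<bullet> x))\<bar> \<le> cmod c"
      using abs_Re_le_cmod[of "c * cis (\<xi> \<bullet> x)"] by (simp add: norm_mult)
    with B[of x] show ?thesis by (simp add: a trig_Cons)
  qed
  then show ?case by blast
qed

lemma measurable_cis_inner [measurable]: "(\<lambda>y. cis (\<xi> \<bullet> y)) \<in> borel_measurable borel"
  for \<xi> :: "'a::euclidean_space"
  by (intro borel_measurable_continuous_onI continuous_intros)

lemma integrable_trig:
  assumes "finite_measure \<kappa>" "sets \<kappa> = sets borel"
  shows "integrable \<kappa> (\<lambda>y. trig L (x + y))"
proof -
  interpret finite_measure \<kappa> by fact
  note assms(2)[measurable_cong]
  obtain B where "\<And>x. \<bar>trig L x\<bar> \<le> B" using bounded_trig by blast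
  then show ?thesis
    by (intro integrable_const_bound[of _ B]) auto
qed

lemma integrable_weight_cis:
  fixes w :: "'a::euclidean_space \<Rightarrow> real"
  assumes "sets \<kappa> = sets borel" "integrable \<kappa> w"
  shows "integrable \<kappa> (\<lambda>y. complex_of_real (w y) * cis (\<xi> \<bullet> y))"
proof -
  note assms(1)[measurable_cong]
  have [measurable]: "w \<in> borel_measurable \<kappa>" using assms(2) by auto
  show ?thesis
    by (rule Bochner_Integration.integrable_bound[OF assms(2)]) (auto simp: norm_mult)
qed

text \<open>
  A multiplier that is the Fourier transform of the signed measure \<open>w \<kappa>\<close> acts as averaging over
  translations, by exchanging a finite sum with an integral. The case \<open>w = 1\<close> is convolution with
  \<open>\<kappa>\<close>; the case of a score \<open>w\<close> expresses a derivative without differentiating.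
\<close>

lemma trig_apply_mult_weight:
  fixes w :: "'a::euclidean_space \<Rightarrow> real"
  assumes "sets \<kappa> = sets borel" "integrable \<kappa> w"
  shows "trig (apply_mult (\<lambda>\<xi>. \<integral>y. complex_of_real (w y) * cis (\<xi> \<bullet> y) \<partial>\<kappa>) L) x
           = (\<integral>y. w y * trig L (x + y) \<partial>\<kappa>)" (is "?A L")
    and "integrable \<kappa> (\<lambda>y. w y * trig L (x + y))" (is "?I L")
proof -
  have "?A L \<and> ?I L"
  proof (induction L)
    case (Cons a L)
    obtain c \<xi> where a: "a = (c, \<xi>)" by fastforce
    define g where "g y = c * cis (\<xi> \<bullet> x) * (complex_of_real (w y) * cis (\<xi> \<bullet> y))" for y
    have ig: "integrable \<kappa> g"
      unfolding g_def by (intro integrable_mult_right integrable_weight_cis assms)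
    have g: "w y * Re (c * cis (\<xi> \<bullet> (x + y))) = Re (g y)" for y
    proof -
      have "g y = complex_of_real (w y) * (c * cis (\<xi> \<bullet> (x + y)))"
        by (simp add: g_def inner_add_right cis_mult[symmetric] ac_simps)
      then show ?thesis by simp
    qed
    have "Re (c * (\<integral>y. complex_of_real (w y) * cis (\<xi> \<bullet> y) \<partial>\<kappa>) * cis (\<xi> \<bullet> x)) = Re (\<integral>y. g y \<partial>\<kappa>)"
      unfolding g_def integral_mult_right_zero by (simp only: ac_simps)
    also have "\<dots> = (\<integral>y. Re (g y) \<partial>\<kappa>)"
      using ig by simp
    finally have eq: "Re (c * (\<integral>y. complex_of_real (w y) * cis (\<xi> \<bullet> y) \<partial>\<kappa>) * cis (\<xi> \<bullet> x)) = (\<integral>y. Re (g y) \<partial>\<kappa>)" .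
    show ?case
      unfolding a trig_Cons apply_mult_Cons distrib_left g eq
      using Cons ig by simp
  qed simp
  then show "?A L" "?I L" by auto
qed

lemma trig_apply_mult_cf:
  assumes "finite_measure \<mu>" "sets \<mu> = sets borel"
  shows "trig (apply_mult (cf \<mu>) L) x = (\<integral>y. trig L (x + y) \<partial>\<mu>)"
proof -
  interpret finite_measure \<mu> by fact
  show ?thesis
    using trig_apply_mult_weight(1)[OF assms(2), of "\<lambda>_. 1" L x] by (simp add: cf_def[abs_def])
qed

lemma trig_has_derivative_along:
  "((\<lambda>t. trig L (x + t *\<^sub>R v)) has_real_derivative trig (apply_mult (deriv_mult v) L) (x + t *\<^sub>R v)) (at t)"
proof (induction L)
  case (Cons a L)
  obtain c \<xi> where a: "a = (c, \<xi>)" by fastforce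
  have "((\<lambda>t. Re (c * cis (\<xi> \<bullet> (x + t *\<^sub>R v)))) has_real_derivative
      Re (c * deriv_mult v \<xi> * cis (\<xi> \<bullet> (x + t *\<^sub>R v)))) (at t)"
    by (auto simp: deriv_mult_def inner_add_right intro!: derivative_eq_intros)
  from DERIV_add[OF this Cons] show ?case
    by (simp add: a trig_Cons apply_mult_Cons)
qed simp

lemma trig_atom_mult:
  "Re (c * cis a) * Re (d * cis b)
     = Re (c * d / 2 * cis (a + b)) + Re (c * cnj d / 2 * cis (a - b))"
  by (simp add: cos_add sin_add cos_diff sin_diff field_simps)

text \<open>
  A product of two exponentials is an exponential; taking real parts adds the one with the
  difference of the frequencies.
\<close>

lemma trig_mult_ex: "\<exists>L''. \<forall>x. trig L x * trig L' x = trig L'' x"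
proof (induction L)
  case Nil
  show ?case by (auto intro: exI[of _ "[]"])
next
  case (Cons a L)
  obtain c \<xi> where a: "a = (c, \<xi>)" by fastforce
  obtain M where M: "\<And>x. trig L x * trig L' x = trig M x" using Cons by blast
  have "\<exists>N. \<forall>x. Re (c * cis (\<xi> \<bullet> x)) * trig L' x = trig N x"
  proof (induction L')
    case Nil
    show ?case by (auto intro: exI[of _ "[]"])
  next
    case (Cons b L')
    obtain d \<eta> where b: "b = (d, \<eta>)" by fastforce
    obtain N where N: "\<And>x. Re (c * cis (\<xi> \<bullet> x)) * trig L' x = trig N x" using Cons by blast
    have "Re (c * cis (\<xi> \<bullet> x)) * trig (b # L') x
        = trig ((c * d / 2, \<xi> + \<eta>) # (c * cnj d / 2, \<xi> - \<eta>) # N) x" for x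
      unfolding b trig_Cons distrib_left N trig_atom_mult inner_add_left inner_diff_left
      by simp
    then show ?case by blast
  qed
  then obtain N where N: "\<And>x. Re (c * cis (\<xi> \<bullet> x)) * trig L' x = trig N x" by blast
  have "trig (a # L) x * trig L' x = trig (N @ M) x" for x
    unfolding a trig_Cons distrib_right N M trig_append ..
  then show ?case by blast
qed

lemma mult_boundD: "mult_bound \<phi> K \<Longrightarrow> (\<And>x. \<bar>trig L x\<bar> \<le> B) \<Longrightarrow> \<bar>trig (apply_mult \<phi> L) x\<bar> \<le> K * B"
  by (auto simp: mult_bound_def)

lemma mult_boundI:
  "(\<And>L B x. (\<And>x. \<bar>trig L x\<bar> \<le> B) \<Longrightarrow> \<bar>trig (apply_mult \<phi> L) x\<bar> \<le> K * B) \<Longrightarrow> mult_bound \<phi> K"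
  by (auto simp: mult_bound_def)

lemma mult_bound_mono:
  fixes \<phi> :: "'a::euclidean_space \<Rightarrow> complex"
  shows "mult_bound \<phi> K \<Longrightarrow> K \<le> K' \<Longrightarrow> mult_bound \<phi> K'"
proof (rule mult_boundI)
  fix L :: "(complex \<times> 'a) list" and B and x :: 'a
  assume *: "mult_bound \<phi> K" "K \<le> K'" "\<And>x. \<bar>trig L x\<bar> \<le> B"
  from *(3)[of 0] have "0 \<le> B" by linarith
  with mult_boundD[OF *(1,3), of x] *(2) show "\<bar>trig (apply_mult \<phi> L) x\<bar> \<le> K' * B"
    by (meson mult_right_mono order_trans)
qed

lemma mult_bound_mult:
  fixes \<phi> \<psi> :: "'a::euclidean_space \<Rightarrow> complex"
  assumes "mult_bound \<phi> K" "mult_bound \<psi> K'"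
  shows "mult_bound (\<lambda>\<xi>. \<phi> \<xi> * \<psi> \<xi>) (K * K')"
proof (rule mult_boundI)
  fix L :: "(complex \<times> 'a) list" and B and x :: 'a
  assume *: "\<And>x. \<bar>trig L x\<bar> \<le> B"
  show "\<bar>trig (apply_mult (\<lambda>\<xi>. \<phi> \<xi> * \<psi> \<xi>) L) x\<bar> \<le> K * K' * B"
    using mult_boundD[OF assms(1) mult_boundD[OF assms(2) *]]
    by (simp add: apply_mult_mult mult.assoc)
qed

lemma mult_bound_add:
  fixes \<phi> \<psi> :: "'a::euclidean_space \<Rightarrow> complex"
  assumes "mult_bound \<phi> K" "mult_bound \<psi> K'"
  shows "mult_bound (\<lambda>\<xi>. \<phi> \<xi> + \<psi> \<xi>) (K + K')"
proof (rule mult_boundI)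
  fix L :: "(complex \<times> 'a) list" and B and x :: 'a
  assume *: "\<And>x. \<bar>trig L x\<bar> \<le> B"
  show "\<bar>trig (apply_mult (\<lambda>\<xi>. \<phi> \<xi> + \<psi> \<xi>) L) x\<bar> \<le> (K + K') * B"
    using mult_boundD[OF assms(1) *, of x] mult_boundD[OF assms(2) *, of x]
    by (simp add: trig_apply_mult_add distrib_right)
qed

lemma mult_bound_scale:
  fixes \<phi> :: "'a::euclidean_space \<Rightarrow> complex"
  assumes "mult_bound \<phi> K"
  shows "mult_bound (\<lambda>\<xi>. complex_of_real a * \<phi> \<xi>) (\<bar>a\<bar> * K)"
proof (rule mult_boundI)
  fix L :: "(complex \<times> 'a) list" and B and x :: 'a
  assume *: "\<And>x. \<bar>trig L x\<bar> \<le> B"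
  show "\<bar>trig (apply_mult (\<lambda>\<xi>. complex_of_real a * \<phi> \<xi>) L) x\<bar> \<le> \<bar>a\<bar> * K * B"
    using mult_left_mono[OF mult_boundD[OF assms *, of x], of "\<bar>a\<bar>"]
    by (simp add: trig_apply_mult_scale abs_mult mult.assoc)
qed

lemma mult_bound_0: "mult_bound (\<lambda>_. 0) 0"
  using trig_apply_mult_scale[of 0] by (auto simp: mult_bound_def)

lemma mult_bound_1: "mult_bound (\<lambda>_. 1) 1"
  by (auto simp: mult_bound_def)

lemma mult_bound_sum:
  assumes "\<And>k. k \<in> S \<Longrightarrow> mult_bound (\<phi> k) (K k)"
  shows "mult_bound (\<lambda>\<xi>. \<Sum>k\<in>S. \<phi> k \<xi>) (\<Sum>k\<in>S. K k)"
  using assms by (induction S rule: infinite_finite_induct) (auto intro!: mult_bound_0 mult_bound_add)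

lemma mult_bound_power:
  "mult_bound \<phi> K \<Longrightarrow> mult_bound (\<lambda>\<xi>. \<phi> \<xi> ^ n) (K ^ n)"
  by (induction n) (auto intro!: mult_bound_1 mult_bound_mult)

lemma mult_bound_nonneg:
  assumes "mult_bound (\<phi> :: 'a::euclidean_space \<Rightarrow> complex) K"
  shows "0 \<le> K"
proof -
  have "\<bar>trig (apply_mult \<phi> [(1, 0)]) (0::'a)\<bar> \<le> K * 1"
    by (rule mult_boundD[OF assms]) (simp add: trig_Cons)
  then show ?thesis by linarith
qed

lemma mult_bound_cf:
  fixes \<mu> :: "'a::euclidean_space measure"
  assumes "prob_space \<mu>" "sets \<mu> = sets borel"
  shows "mult_bound (cf \<mu>) 1"
proof (rule mult_boundI)
  interpret prob_space \<mu> by fact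
  fix L :: "(complex \<times> 'a) list" and B and x :: 'a
  assume B: "\<And>x. \<bar>trig L x\<bar> \<le> B"
  have "\<bar>\<integral>y. trig L (x + y) \<partial>\<mu>\<bar> \<le> (\<integral>y. \<bar>trig L (x + y)\<bar> \<partial>\<mu>)"
    by (rule integral_abs_bound)
  also have "\<dots> \<le> (\<integral>y. B \<partial>\<mu>)"
    by (intro integral_mono integrable_abs integrable_trig assms finite_measure_axioms) (auto simp: B)
  also have "\<dots> = B" by (simp add: prob_space)
  finally show "\<bar>trig (apply_mult (cf \<mu>) L) x\<bar> \<le> 1 * B"
    by (simp add: trig_apply_mult_cf assms finite_measure_axioms)
qed

text \<open>
  A linear change of the space variable: \<open>\<phi> \<circ> S\<close> acts on \<open>f\<close> as \<open>\<phi>\<close> acts on \<open>f \<circ> T\<close>, where \<open>S\<close> is the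
  adjoint of \<open>T\<close>. Surjectivity of \<open>T\<close> recovers every point from the values of \<open>f \<circ> T\<close>.
\<close>

lemma mult_bound_comp_linear:
  fixes \<phi> :: "'a::euclidean_space \<Rightarrow> complex" and T S :: "'a \<Rightarrow> 'a"
  assumes "mult_bound \<phi> K" and adj: "\<And>\<xi> y. \<xi> \<bullet> T y = S \<xi> \<bullet> y" and "surj T"
  shows "mult_bound (\<lambda>\<xi>. \<phi> (S \<xi>)) K"
proof (rule mult_boundI)
  fix L :: "(complex \<times> 'a) list" and B and x :: 'a
  assume B: "\<And>x. \<bar>trig L x\<bar> \<le> B"
  define L' where "L' = map (\<lambda>(c, \<xi>). (c, S \<xi>)) L"
  have L': "trig L' y = trig L (T y)" for y
    unfolding L'_def by (induction L) (auto simp: trig_Cons adj)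
  obtain y where y: "x = T y" using \<open>surj T\<close> by (metis surjD)
  have "trig (apply_mult (\<lambda>\<xi>. \<phi> (S \<xi>)) L) x = trig (apply_mult \<phi> L') y"
    unfolding L'_def by (induction L) (auto simp: trig_Cons apply_mult_Cons adj y)
  also have "\<bar>\<dots>\<bar> \<le> K * B"
    by (rule mult_boundD[OF assms(1)]) (simp add: L' B)
  finally show "\<bar>trig (apply_mult (\<lambda>\<xi>. \<phi> (S \<xi>)) L) x\<bar> \<le> K * B" .
qed

section \<open>Averaging over copies of a law with a score\<close>

text \<open>
  For \<open>\<kappa>\<close> with density \<open>p\<close>, the function \<open>s\<close> is \<open>- \<partial>\<^sub>v p / p\<close> and \<open>J\<close> bounds the Fisher information. The last
  condition is integration by parts, tested against exponentials.
\<close>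

definition has_score :: "'a::euclidean_space measure \<Rightarrow> real \<Rightarrow> bool" where
  "has_score \<kappa> J \<longleftrightarrow> 0 < J \<and>
     (\<forall>v. \<exists>s\<in>borel_measurable borel.
        integrable \<kappa> (\<lambda>y. (s y)\<^sup>2) \<and> (\<integral>y. (s y)\<^sup>2 \<partial>\<kappa>) \<le> J * (norm v)\<^sup>2 \<and>
        (\<forall>\<xi>. deriv_mult v \<xi> * cf \<kappa> \<xi> = (\<integral>y. complex_of_real (s y) * cis (\<xi> \<bullet> y) \<partial>\<kappa>)))"

lemma (in prob_space) square_integral_le:
  fixes u :: "'a \<Rightarrow> real"
  assumes "integrable M u" "integrable M (\<lambda>y. (u y)\<^sup>2)"
  shows "(\<integral>y. u y \<partial>M)\<^sup>2 \<le> (\<integral>y. (u y)\<^sup>2 \<partial>M)"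
proof -
  have "0 \<le> variance u" by (rule variance_positive)
  then show ?thesis using variance_eq[OF assms] by simp
qed

text \<open>
  Cauchy-Schwarz for \<open>s\<close> and \<open>u\<close> minus its mean, which is allowed because \<open>s\<close> has mean zero. Keeping
  the variance of \<open>u\<close> instead of its second moment is what makes the energy inequality telescope.
\<close>

lemma (in prob_space) centered_covariance_le:
  fixes s u :: "'a \<Rightarrow> real"
  assumes s: "integrable M s" "integrable M (\<lambda>y. (s y)\<^sup>2)" "(\<integral>y. s y \<partial>M) = 0" "(\<integral>y. (s y)\<^sup>2 \<partial>M) \<le> J"
    and u: "integrable M u" "integrable M (\<lambda>y. (u y)\<^sup>2)"
    and su: "integrable M (\<lambda>y. s y * u y)" and "0 < J"
  shows "(\<integral>y. s y * u y \<partial>M)\<^sup>2 \<le> J * ((\<integral>y. (u y)\<^sup>2 \<partial>M) - (\<integral>y. u y \<partial>M)\<^sup>2)"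
proof -
  define a where "a = (\<integral>y. s y * u y \<partial>M)"
  define m where "m = (\<integral>y. u y \<partial>M)"
  define t where "t = a / J"
  have eq: "(u y - m - t * s y)\<^sup>2
      = (u y)\<^sup>2 - 2 * m * u y + m\<^sup>2 - 2 * t * (s y * u y) + 2 * m * t * s y + t\<^sup>2 * (s y)\<^sup>2" for y
    by (simp add: power2_eq_square algebra_simps)
  have "0 \<le> (\<integral>y. (u y - m - t * s y)\<^sup>2 \<partial>M)" by simp
  also have "\<dots> = (\<integral>y. (u y)\<^sup>2 \<partial>M) - 2 * m * m + m\<^sup>2 - 2 * t * a + 2 * m * t * 0
      + t\<^sup>2 * (\<integral>y. (s y)\<^sup>2 \<partial>M)"
    unfolding eq using s u su
    by (simp add: a_def m_def prob_space)
  also have "\<dots> \<le> (\<integral>y. (u y)\<^sup>2 \<partial>M) - m\<^sup>2 - 2 * t * a + t\<^sup>2 * J"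
    using mult_left_mono[OF s(4), of "t\<^sup>2"] by (simp add: power2_eq_square)
  also have "\<dots> = (\<integral>y. (u y)\<^sup>2 \<partial>M) - m\<^sup>2 - a\<^sup>2 / J"
    using \<open>0 < J\<close> by (simp add: t_def power2_eq_square field_simps)
  finally have "a\<^sup>2 / J \<le> (\<integral>y. (u y)\<^sup>2 \<partial>M) - m\<^sup>2" by simp
  then show ?thesis
    using \<open>0 < J\<close> by (simp add: a_def m_def field_simps)
qed

lemma integrable_trig_power2:
  assumes "finite_measure \<kappa>" "sets \<kappa> = sets borel"
  shows "integrable \<kappa> (\<lambda>y. (trig L (x + y))\<^sup>2)"
proof -
  interpret finite_measure \<kappa> by fact
  note assms(2)[measurable_cong]
  obtain B where B: "\<And>x. \<bar>trig L x\<bar> \<le> B" using bounded_trig by blast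
  then have "(trig L x)\<^sup>2 \<le> B\<^sup>2" for x by (metis abs_ge_zero power2_abs power_mono)
  then show ?thesis by (intro integrable_const_bound[of _ "B\<^sup>2"]) auto
qed

text \<open>
  With \<open>P\<close> the convolution with \<open>\<kappa>\<close> and \<open>f = trig L\<close>, this reads
  \<open>m (\<partial>\<^sub>v P\<^sup>m f)\<^sup>2 + J (P\<^sup>m f)\<^sup>2 \<le> J B\<^sup>2\<close>. Applying \<open>P\<close> to the inequality for \<open>m\<close> lets the first term only decrease
  to \<open>m (\<partial>\<^sub>v P\<^sup>m\<^sup>+\<^sup>1 f)\<^sup>2\<close> (Jensen), while the second one exceeds \<open>J (P\<^sup>m\<^sup>+\<^sup>1 f)\<^sup>2\<close> by \<open>J\<close> times a variance,
  which bounds one more copy of \<open>(\<partial>\<^sub>v P\<^sup>m\<^sup>+\<^sup>1 f)\<^sup>2\<close> since \<open>\<partial>\<^sub>v P g\<close> is the covariance of \<open>g\<close> with the score.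
  The gain of a factor \<open>1 / sqrt m\<close> in the derivative is thus obtained one copy at a time.
\<close>

lemma energy_inequality:
  fixes \<kappa> :: "'a::euclidean_space measure"
  assumes "prob_space \<kappa>" and sets: "sets \<kappa> = sets borel"
    and s: "s \<in> borel_measurable borel" "integrable \<kappa> (\<lambda>y. (s y)\<^sup>2)" "(\<integral>y. (s y)\<^sup>2 \<partial>\<kappa>) \<le> J"
    and score: "\<And>\<xi>. deriv_mult v \<xi> * cf \<kappa> \<xi> = (\<integral>y. complex_of_real (s y) * cis (\<xi> \<bullet> y) \<partial>\<kappa>)"
    and "0 < J" and B: "\<And>x. \<bar>trig L x\<bar> \<le> B"
  shows "real m * (trig (apply_mult (\<lambda>\<xi>. deriv_mult v \<xi> * cf \<kappa> \<xi> ^ m) L) x)\<^sup>2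
           + J * (trig (apply_mult (\<lambda>\<xi>. cf \<kappa> \<xi> ^ m) L) x)\<^sup>2 \<le> J * B\<^sup>2"
proof (induction m arbitrary: x)
  case 0
  have "(trig L x)\<^sup>2 \<le> B\<^sup>2" using B[of x] by (metis abs_ge_zero power2_abs power_mono)
  with \<open>0 < J\<close> show ?case by simp
next
  case (Suc m)
  interpret prob_space \<kappa> by fact
  note sets[measurable_cong]
  have fin: "finite_measure \<kappa>" by unfold_locales
  note s(1)[measurable]
  have "s \<in> borel_measurable \<kappa>" by measurable
  then have s1: "integrable \<kappa> s"
    by (rule square_integrable_imp_integrable) (rule s(2))
  have "complex_of_real (\<integral>y. s y \<partial>\<kappa>) = deriv_mult v 0 * cf \<kappa> 0"
    unfolding score by simp
  \<comment> \<open>The score has mean zero: this is its defining identity at frequency 0.\<close>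
  then have s0: "(\<integral>y. s y \<partial>\<kappa>) = 0" by (simp add: deriv_mult_def)
  define G where "G = apply_mult (\<lambda>\<xi>. cf \<kappa> \<xi> ^ m) L"
  define D where "D = apply_mult (\<lambda>\<xi>. deriv_mult v \<xi> * cf \<kappa> \<xi> ^ m) L"
  define a where "a = trig (apply_mult (\<lambda>\<xi>. deriv_mult v \<xi> * cf \<kappa> \<xi> ^ Suc m) L) x"
  note iG = integrable_trig[OF fin sets, of G x] integrable_trig_power2[OF fin sets, of G x]
  note iD = integrable_trig[OF fin sets, of D x] integrable_trig_power2[OF fin sets, of D x]
  have Pg: "trig (apply_mult (\<lambda>\<xi>. cf \<kappa> \<xi> ^ Suc m) L) x = (\<integral>y. trig G (x + y) \<partial>\<kappa>)"
    unfolding trig_apply_mult_cf[OF fin sets, symmetric] G_def apply_mult_mult by simp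
  have a1: "a = (\<integral>y. trig D (x + y) \<partial>\<kappa>)"
    unfolding trig_apply_mult_cf[OF fin sets, symmetric] D_def apply_mult_mult a_def
    by (simp add: ac_simps)
  have a2: "a = (\<integral>y. s y * trig G (x + y) \<partial>\<kappa>)"
    unfolding trig_apply_mult_weight(1)[OF sets s1, symmetric] score[symmetric]
      G_def apply_mult_mult a_def by (simp add: ac_simps)
  have "a\<^sup>2 \<le> (\<integral>y. (trig D (x + y))\<^sup>2 \<partial>\<kappa>)"
    unfolding a1 by (rule square_integral_le) (use iD in auto)
  then have "real m * a\<^sup>2 \<le> real m * (\<integral>y. (trig D (x + y))\<^sup>2 \<partial>\<kappa>)"
    by (rule mult_left_mono) simp
  moreover have "a\<^sup>2 \<le> J * ((\<integral>y. (trig G (x + y))\<^sup>2 \<partial>\<kappa>) - (\<integral>y. trig G (x + y) \<partial>\<kappa>)\<^sup>2)"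
    unfolding a2 by (rule centered_covariance_le[OF s1 s(2) s0 s(3) iG
          trig_apply_mult_weight(2)[OF sets s1] \<open>0 < J\<close>])
  moreover have "real m * (\<integral>y. (trig D (x + y))\<^sup>2 \<partial>\<kappa>) + J * (\<integral>y. (trig G (x + y))\<^sup>2 \<partial>\<kappa>) \<le> J * B\<^sup>2"
  proof -
    have "real m * (\<integral>y. (trig D (x + y))\<^sup>2 \<partial>\<kappa>) + J * (\<integral>y. (trig G (x + y))\<^sup>2 \<partial>\<kappa>)
       = (\<integral>y. real m * (trig D (x + y))\<^sup>2 + J * (trig G (x + y))\<^sup>2 \<partial>\<kappa>)"
      using iD iG by simp
    also have "\<dots> \<le> (\<integral>y. J * B\<^sup>2 \<partial>\<kappa>)"
      using iD iG Suc.IH by (intro integral_mono) (auto simp: D_def G_def)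
    finally show ?thesis by (simp add: prob_space)
  qed
  ultimately show ?case
    unfolding Pg a_def[symmetric] by (simp add: algebra_simps)
qed

lemma abs_le_of_square_le: "x\<^sup>2 \<le> c\<^sup>2 \<Longrightarrow> 0 \<le> c \<Longrightarrow> \<bar>x\<bar> \<le> c" for x c :: real
  by (metis abs_le_square_iff abs_of_nonneg)

lemma mult_bound_score_power:
  fixes \<kappa> :: "'a::euclidean_space measure"
  assumes "prob_space \<kappa>" "sets \<kappa> = sets borel" "has_score \<kappa> J" "1 \<le> b"
  shows "mult_bound (\<lambda>\<xi>. deriv_mult v \<xi> * cf \<kappa> \<xi> ^ b) (sqrt (J / real b) * norm v)"
proof (cases "v = 0")
  case True
  then show ?thesis by (simp add: deriv_mult_def mult_bound_0)
next
  case False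
  from assms(3) have J: "0 < J" by (simp add: has_score_def)
  obtain s where s: "s \<in> borel_measurable borel" "integrable \<kappa> (\<lambda>y. (s y)\<^sup>2)"
      "(\<integral>y. (s y)\<^sup>2 \<partial>\<kappa>) \<le> J * (norm v)\<^sup>2"
      "\<And>\<xi>. deriv_mult v \<xi> * cf \<kappa> \<xi> = (\<integral>y. complex_of_real (s y) * cis (\<xi> \<bullet> y) \<partial>\<kappa>)"
    using assms(3)[unfolded has_score_def, THEN conjunct2, THEN spec, of v] by blast
  from False J have Jv: "0 < J * (norm v)\<^sup>2" by simp
  show ?thesis
  proof (rule mult_boundI)
    fix L :: "(complex \<times> 'a) list" and B and x :: 'a
    assume B: "\<And>x. \<bar>trig L x\<bar> \<le> B"
    from B[of 0] have "0 \<le> B" by linarith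
    let ?t = "trig (apply_mult (\<lambda>\<xi>. deriv_mult v \<xi> * cf \<kappa> \<xi> ^ b) L) x"
    have "0 \<le> J * (norm v)\<^sup>2 * (trig (apply_mult (\<lambda>\<xi>. cf \<kappa> \<xi> ^ b) L) x)\<^sup>2"
      using Jv by simp
    with energy_inequality[OF assms(1,2) s Jv B, of b x]
    have "real b * ?t\<^sup>2 \<le> J * (norm v)\<^sup>2 * B\<^sup>2" by linarith
    then have "?t\<^sup>2 \<le> J / real b * (norm v)\<^sup>2 * B\<^sup>2"
      using \<open>1 \<le> b\<close> by (simp add: field_simps)
    also have "\<dots> = (sqrt (J / real b) * norm v * B)\<^sup>2"
      using J by (simp add: power_mult_distrib)
    finally show "\<bar>?t\<bar> \<le> sqrt (J / real b) * norm v * B"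
      using J \<open>0 \<le> B\<close> by (intro abs_le_of_square_le) auto
  qed
qed

section \<open>Convolution powers of a law with a smooth component\<close>

text \<open>
  Every power of \<open>\<phi>\<close> splits into a part \<open>a\<close> that bears \<open>q\<close> derivatives in any direction and a small
  part \<open>b\<close>. Both sizes scale like \<open>m powr (-q/2)\<close>, the accuracy at which they are used.
\<close>

definition smooth_powers :: "('a::euclidean_space \<Rightarrow> complex) \<Rightarrow> nat \<Rightarrow> real \<Rightarrow> bool" where
  "smooth_powers \<phi> q K \<longleftrightarrow>
     (\<forall>m\<ge>1. \<exists>a b. (\<forall>\<xi>. \<phi> \<xi> ^ m = a \<xi> + b \<xi>) \<and>
        mult_bound b (K / sqrt (real m) ^ q) \<and>
        (\<forall>v. mult_bound (\<lambda>\<xi>. deriv_mult v \<xi> ^ q * a \<xi>) (K * norm v ^ q / sqrt (real m) ^ q)))"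

lemma smooth_powers_mono:
  assumes "smooth_powers \<phi> q K" "K \<le> K'"
  shows "smooth_powers \<phi> q K'"
  unfolding smooth_powers_def
proof (intro allI impI)
  fix m :: nat assume "1 \<le> m"
  then obtain a b where ab: "\<And>\<xi>. \<phi> \<xi> ^ m = a \<xi> + b \<xi>" "mult_bound b (K / sqrt (real m) ^ q)"
    "\<And>v. mult_bound (\<lambda>\<xi>. deriv_mult v \<xi> ^ q * a \<xi>) (K * norm v ^ q / sqrt (real m) ^ q)"
    using assms(1)[unfolded smooth_powers_def, rule_format, of m] by blast
  have "mult_bound b (K' / sqrt (real m) ^ q)"
    by (rule mult_bound_mono[OF ab(2)]) (use assms(2) in \<open>auto intro: divide_right_mono\<close>)
  moreover have "mult_bound (\<lambda>\<xi>. deriv_mult v \<xi> ^ q * a \<xi>) (K' * norm v ^ q / sqrt (real m) ^ q)" for v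
    by (rule mult_bound_mono[OF ab(3)]) (use assms(2) in \<open>auto intro!: divide_right_mono mult_right_mono\<close>)
  ultimately show "\<exists>a b. (\<forall>\<xi>. \<phi> \<xi> ^ m = a \<xi> + b \<xi>) \<and> mult_bound b (K' / sqrt (real m) ^ q) \<and>
       (\<forall>v. mult_bound (\<lambda>\<xi>. deriv_mult v \<xi> ^ q * a \<xi>) (K' * norm v ^ q / sqrt (real m) ^ q))"
    using ab(1) by blast
qed

text \<open>
  An inequality between measures on sets gives the inequality between integrals of nonnegative
  functions.
\<close>

lemma integral_le_dominating:
  fixes h :: "'a::euclidean_space \<Rightarrow> real"
  assumes "finite_measure \<kappa>" "finite_measure \<mu>" and sets: "sets \<kappa> = sets borel" "sets \<mu> = sets borel"
    and dom: "\<And>A. A \<in> sets borel \<Longrightarrow> ennreal p * emeasure \<kappa> A \<le> emeasure \<mu> A"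
    and "0 \<le> p"
    and h: "h \<in> borel_measurable borel" "\<And>x. 0 \<le> h x" "\<And>x. h x \<le> B"
  shows "p * (\<integral>x. h x \<partial>\<kappa>) \<le> (\<integral>x. h x \<partial>\<mu>)"
proof -
  interpret K: finite_measure \<kappa> by fact
  interpret M: finite_measure \<mu> by fact
  note sets[measurable_cong] h(1)[measurable]
  have iK: "integrable \<kappa> h" by (rule K.integrable_const_bound[of _ B]) (auto simp: h)
  have iM: "integrable \<mu> h" by (rule M.integrable_const_bound[of _ B]) (auto simp: h)
  have le: "scale_measure (ennreal p) \<kappa> \<le> \<mu>"
  proof -
    have "emeasure (scale_measure (ennreal p) \<kappa>) A \<le> emeasure \<mu> A" for A
    proof (cases "A \<in> sets borel")
      case True
      with dom show ?thesis by simp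
    next
      case False
      then have "A \<notin> sets \<kappa>" by (simp add: sets)
      then show ?thesis by (simp add: emeasure_notin_sets)
    qed
    moreover have "sets (scale_measure (ennreal p) \<kappa>) = sets \<mu>" by (simp add: sets)
    moreover from this have "space (scale_measure (ennreal p) \<kappa>) = space \<mu>" by (rule sets_eq_imp_space_eq)
    ultimately show ?thesis by (auto simp: le_measure_iff le_fun_def)
  qed
  have "ennreal (p * (\<integral>x. h x \<partial>\<kappa>)) = ennreal p * (\<integral>\<^sup>+x. ennreal (h x) \<partial>\<kappa>)"
    using iK h \<open>0 \<le> p\<close> by (simp add: nn_integral_eq_integral ennreal_mult)
  also have "\<dots> = (\<integral>\<^sup>+x. ennreal (h x) \<partial>scale_measure (ennreal p) \<kappa>)"
    by (subst nn_integral_scale_measure) auto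
  also have "\<dots> \<le> (\<integral>\<^sup>+x. ennreal (h x) \<partial>\<mu>)"
    by (rule nn_integral_mono_measure) (auto simp: sets le)
  also have "\<dots> = ennreal (\<integral>x. h x \<partial>\<mu>)"
    using iM h by (simp add: nn_integral_eq_integral)
  finally show ?thesis
    using h by (simp add: ennreal_le_iff)
qed

text \<open>
  The difference \<open>\<mu> - p \<kappa>\<close> is a nonnegative measure of mass \<open>1 - p\<close>. This is used in the form that
  the functions \<open>B - f\<close> and \<open>B + f\<close>, nonnegative for \<open>|f| \<le> B\<close>, have integrals against \<open>\<mu>\<close> at least
  as large as those against \<open>p \<kappa>\<close>.
\<close>

lemma mult_bound_remainder:
  fixes \<kappa> \<mu> :: "'a::euclidean_space measure"
  assumes "prob_space \<kappa>" "prob_space \<mu>" and sets: "sets \<kappa> = sets borel" "sets \<mu> = sets borel"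
    and dom: "\<And>A. A \<in> sets borel \<Longrightarrow> ennreal p * emeasure \<kappa> A \<le> emeasure \<mu> A" and "0 \<le> p"
  shows "mult_bound (\<lambda>\<xi>. cf \<mu> \<xi> - complex_of_real p * cf \<kappa> \<xi>) (1 - p)"
proof (rule mult_boundI)
  interpret K: prob_space \<kappa> by fact
  interpret M: prob_space \<mu> by fact
  have fin: "finite_measure \<kappa>" "finite_measure \<mu>" by unfold_locales
  fix L :: "(complex \<times> 'a) list" and B and x :: 'a
  assume B: "\<And>x. \<bar>trig L x\<bar> \<le> B"
  note int = integrable_trig[OF fin(1) sets(1), of L x] integrable_trig[OF fin(2) sets(2), of L x]
  have bd: "trig L z \<le> B" "B - trig L z \<le> 2 * B" "0 \<le> B + trig L z" "B + trig L z \<le> 2 * B" for z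
    using B[of z] by (auto simp: abs_le_iff)
  have 1: "p * (\<integral>y. B - trig L (x + y) \<partial>\<kappa>) \<le> (\<integral>y. B - trig L (x + y) \<partial>\<mu>)"
    and 2: "p * (\<integral>y. B + trig L (x + y) \<partial>\<kappa>) \<le> (\<integral>y. B + trig L (x + y) \<partial>\<mu>)"
    by (rule integral_le_dominating[OF fin sets dom \<open>0 \<le> p\<close>, where B="2 * B"]; (simp add: bd)?; measurable)+
  have "trig (apply_mult (\<lambda>\<xi>. cf \<mu> \<xi> - complex_of_real p * cf \<kappa> \<xi>) L) x
     = (\<integral>y. trig L (x + y) \<partial>\<mu>) - p * (\<integral>y. trig L (x + y) \<partial>\<kappa>)"
    by (simp add: trig_apply_mult_diff trig_apply_mult_scale trig_apply_mult_cf fin sets)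
  moreover have "\<dots> \<le> (1 - p) * B"
    using 1 int by (simp add: K.prob_space M.prob_space algebra_simps)
  moreover have "- (1 - p) * B \<le> (\<integral>y. trig L (x + y) \<partial>\<mu>) - p * (\<integral>y. trig L (x + y) \<partial>\<kappa>)"
    using 2 int by (simp add: K.prob_space M.prob_space algebra_simps)
  ultimately show "\<bar>trig (apply_mult (\<lambda>\<xi>. cf \<mu> \<xi> - complex_of_real p * cf \<kappa> \<xi>) L) x\<bar> \<le> (1 - p) * B"
    by (simp add: abs_le_iff algebra_simps)
qed

text \<open>
  Chernoff's bound for the binomial distribution. With \<open>\<sigma>\<close> its moment generating function at \<open>-1\<close> for
  a single trial, the choice \<open>\<alpha> = - ln \<sigma> / 2\<close> makes the product \<open>exp (\<alpha> m) \<sigma>\<^sup>m\<close> equal to \<open>exp (- \<alpha> m)\<close>.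
\<close>

lemma binomial_tail:
  fixes p :: real
  assumes "0 < p" "p \<le> 1"
  obtains \<alpha> where "0 < \<alpha>"
    "\<And>m. (\<Sum>k\<in>{k. k \<le> m \<and> real k < \<alpha> * real m}. real (m choose k) * p ^ k * (1 - p) ^ (m - k))
           \<le> exp (- \<alpha> * real m)"
proof -
  define \<sigma> where "\<sigma> = p * exp (-1) + (1 - p)"
  have "p * exp (-1) < p * 1" using assms by (intro mult_strict_left_mono) auto
  then have \<sigma>: "0 < \<sigma>" "\<sigma> < 1" using assms by (auto simp: \<sigma>_def intro: add_pos_nonneg)
  define \<alpha> where "\<alpha> = - ln \<sigma> / 2"
  have \<alpha>: "0 < \<alpha>" "exp (- 2 * \<alpha>) = \<sigma>" using \<sigma> by (auto simp: \<alpha>_def)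
  have "(\<Sum>k\<in>{k. k \<le> m \<and> real k < \<alpha> * real m}. real (m choose k) * p ^ k * (1 - p) ^ (m - k))
           \<le> exp (- \<alpha> * real m)" for m
  proof -
    have "(\<Sum>k\<in>{k. k \<le> m \<and> real k < \<alpha> * real m}. real (m choose k) * p ^ k * (1 - p) ^ (m - k))
      \<le> (\<Sum>k\<in>{k. k \<le> m \<and> real k < \<alpha> * real m}.
            exp (\<alpha> * real m) * (real (m choose k) * (p * exp (-1)) ^ k * (1 - p) ^ (m - k)))"
    proof (rule sum_mono)
      fix k assume "k \<in> {k. k \<le> m \<and> real k < \<alpha> * real m}"
      then have "1 \<le> exp (\<alpha> * real m - real k)" by simp
      also have "\<dots> = exp (\<alpha> * real m) * exp (-1) ^ k"
        by (simp add: exp_diff exp_minus exp_of_nat_mult[symmetric] divide_inverse power_inverse)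
      finally have "(real (m choose k) * p ^ k * (1 - p) ^ (m - k)) * 1
        \<le> (real (m choose k) * p ^ k * (1 - p) ^ (m - k)) * (exp (\<alpha> * real m) * exp (-1) ^ k)"
        using assms by (intro mult_left_mono) auto
      then show "real (m choose k) * p ^ k * (1 - p) ^ (m - k)
        \<le> exp (\<alpha> * real m) * (real (m choose k) * (p * exp (-1)) ^ k * (1 - p) ^ (m - k))"
        by (simp add: power_mult_distrib ac_simps)
    qed
    also have "\<dots> \<le> (\<Sum>k\<le>m. exp (\<alpha> * real m) * (real (m choose k) * (p * exp (-1)) ^ k * (1 - p) ^ (m - k)))"
      using assms by (intro sum_mono2) auto
    also have "\<dots> = exp (\<alpha> * real m) * \<sigma> ^ m"
      by (simp add: \<sigma>_def binomial_ring sum_distrib_left)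
    also have "\<dots> = exp (- \<alpha> * real m)"
      unfolding \<alpha>(2)[symmetric] by (simp add: exp_of_nat_mult[symmetric] exp_add[symmetric])
    finally show ?thesis .
  qed
  with \<alpha>(1) that show ?thesis by blast
qed

lemma exp_minus_le_power:
  fixes \<alpha> :: real
  assumes "0 < \<alpha>" "1 \<le> m" "1 \<le> q"
  shows "exp (- \<alpha> * real m) \<le> (real q / \<alpha>) ^ q / sqrt (real m) ^ q"
proof -
  have "(\<alpha> * real m / real q) ^ q \<le> (1 + \<alpha> * real m / real q) ^ q"
    using assms by (intro power_mono) auto
  also have "\<dots> \<le> exp (\<alpha> * real m)"
    using assms by (intro exp_ge_one_plus_x_over_n_power_n) (auto intro: order_trans[of _ 0])
  finally have 1: "(\<alpha> * real m / real q) ^ q \<le> exp (\<alpha> * real m)" .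
  have "exp (- \<alpha> * real m) = 1 / exp (\<alpha> * real m)" by (simp add: exp_minus field_simps)
  also have "\<dots> \<le> 1 / (\<alpha> * real m / real q) ^ q"
    using 1 assms by (intro divide_left_mono) auto
  also have "\<dots> = (real q / \<alpha>) ^ q / real m ^ q"
    using assms by (simp add: power_divide power_mult_distrib)
  also have "\<dots> \<le> (real q / \<alpha>) ^ q / sqrt (real m) ^ q"
  proof (rule divide_left_mono)
    have "sqrt (real m) \<le> real m"
      using assms by (intro real_le_lsqrt) (auto simp: power2_eq_square)
    then show "sqrt (real m) ^ q \<le> real m ^ q" by (intro power_mono) auto
  qed (use assms in auto)
  finally show ?thesis .
qed

text \<open>
  The \<open>q\<close> derivatives are distributed over \<open>q\<close> blocks of \<open>k div q\<close> factors each, and every block pays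
  for one of them.
\<close>

lemma mult_bound_many_smooth_factors:
  fixes \<kappa> :: "'a::euclidean_space measure"
  assumes \<kappa>: "prob_space \<kappa>" "sets \<kappa> = sets borel" "has_score \<kappa> J"
    and \<psi>: "mult_bound \<psi> c" and q: "1 \<le> q" "q \<le> k" and \<alpha>: "0 < \<alpha>" "\<alpha> * real m \<le> real k" and "1 \<le> m"
  shows "mult_bound (\<lambda>\<xi>. deriv_mult v \<xi> ^ q * (cf \<kappa> \<xi> ^ k * \<psi> \<xi>))
           ((sqrt (2 * real q * J / \<alpha>) * norm v / sqrt (real m)) ^ q * c)"
proof -
  from \<kappa>(3) have J: "0 < J" by (simp add: has_score_def)
  define b where "b = k div q"
  have b: "1 \<le> b" "q * b \<le> k" using q by (auto simp: b_def div_greater_zero_iff Suc_le_eq)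
  \<comment> \<open>Rounding costs at most a factor 2, because every block is nonempty.\<close>
  have "k < q * (b + 1)" unfolding b_def using q
    by (metis Suc_eq_plus1 dividend_less_times_div mult_Suc_right add.commute less_le_trans zero_less_one)
  also have "\<dots> \<le> q * (2 * b)" using b by (intro mult_left_mono) auto
  finally have "real k < real q * (2 * real b)"
    by (metis of_nat_less_iff of_nat_mult of_nat_numeral)
  with \<alpha> have "\<alpha> * real m \<le> 2 * real q * real b" by linarith
  then have "J / real b \<le> 2 * real q * J / \<alpha> / real m"
    using \<alpha> b \<open>1 \<le> m\<close> J by (simp add: field_simps)
  then have "sqrt (J / real b) \<le> sqrt (2 * real q * J / \<alpha>) / sqrt (real m)"
    by (subst real_sqrt_divide[symmetric]) (rule real_sqrt_le_mono)
  then have le: "sqrt (J / real b) * norm v \<le> sqrt (2 * real q * J / \<alpha>) * norm v / sqrt (real m)"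
    using mult_right_mono[of _ _ "norm v"] by fastforce
  have "mult_bound (\<lambda>\<xi>. (deriv_mult v \<xi> * cf \<kappa> \<xi> ^ b) ^ q * (cf \<kappa> \<xi> ^ (k - q * b) * \<psi> \<xi>))
     ((sqrt (J / real b) * norm v) ^ q * (1 ^ (k - q * b) * c))"
    by (intro mult_bound_mult mult_bound_power mult_bound_score_power mult_bound_cf \<kappa> \<psi> b)
  moreover have "(deriv_mult v \<xi> * cf \<kappa> \<xi> ^ b) ^ q * (cf \<kappa> \<xi> ^ (k - q * b) * \<psi> \<xi>)
     = deriv_mult v \<xi> ^ q * (cf \<kappa> \<xi> ^ k * \<psi> \<xi>)" for \<xi>
  proof -
    have "cf \<kappa> \<xi> ^ k = cf \<kappa> \<xi> ^ (b * q) * cf \<kappa> \<xi> ^ (k - q * b)"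
      using b by (simp add: power_add[symmetric] mult.commute)
    then show ?thesis by (simp add: power_mult_distrib power_mult)
  qed
  ultimately have *: "mult_bound (\<lambda>\<xi>. deriv_mult v \<xi> ^ q * (cf \<kappa> \<xi> ^ k * \<psi> \<xi>))
     ((sqrt (J / real b) * norm v) ^ q * c)"
    by simp
  show ?thesis
    by (rule mult_bound_mono[OF *])
      (use le J mult_bound_nonneg[OF \<psi>] in \<open>auto intro!: mult_right_mono power_mono\<close>)
qed

text \<open>
  Expand \<open>(p \<kappa> + \<rho>)\<^sup>m\<close>, with \<open>\<rho>\<close> the remainder \<open>\<mu> - p \<kappa>\<close>. The terms with at least \<open>\<alpha> m\<close> factors \<open>\<kappa>\<close> form the
  smooth part, the others are controlled by the binomial tail. The constant depends on \<open>\<kappa>\<close>, \<open>p\<close> and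
  \<open>q\<close> only, not on \<open>\<mu>\<close>.
\<close>

lemma smooth_powers_cf:
  fixes \<kappa> :: "'a::euclidean_space measure"
  assumes \<kappa>: "prob_space \<kappa>" "sets \<kappa> = sets borel" "has_score \<kappa> J"
    and p: "0 < p" "p \<le> 1" and q: "1 \<le> q"
  shows "\<exists>K>0. \<forall>\<mu>. prob_space \<mu> \<longrightarrow> sets \<mu> = sets borel \<longrightarrow>
           (\<forall>A\<in>sets borel. ennreal p * emeasure \<kappa> A \<le> emeasure \<mu> A) \<longrightarrow>
           smooth_powers (cf \<mu>) q K"
proof -
  from \<kappa>(3) have J: "0 < J" by (simp add: has_score_def)
  obtain \<alpha> where \<alpha>: "0 < \<alpha>" and tail:
    "\<And>m. (\<Sum>k\<in>{k. k \<le> m \<and> real k < \<alpha> * real m}. real (m choose k) * p ^ k * (1 - p) ^ (m - k))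
           \<le> exp (- \<alpha> * real m)"
    using binomial_tail[OF p] by blast
  define K1 where "K1 = sqrt (2 * real q * J / \<alpha>) ^ q"
  define K2 where "K2 = (real q / \<alpha>) ^ q"
  define K3 where "K3 = sqrt (real q / \<alpha>) ^ q"
  define K where "K = K1 + K2 + K3"
  have K123: "0 < K1" "0 < K2" "0 < K3" using J \<alpha> q by (auto simp: K1_def K2_def K3_def)
  then have K: "0 < K" by (simp add: K_def)
  have "smooth_powers (cf \<mu>) q K"
    if \<mu>: "prob_space \<mu>" "sets \<mu> = sets borel"
      and dom: "\<forall>A\<in>sets borel. ennreal p * emeasure \<kappa> A \<le> emeasure \<mu> A" for \<mu> :: "'a measure"
    unfolding smooth_powers_def
  proof (intro allI impI)
    fix m :: nat assume m: "1 \<le> m"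
    show "\<exists>a b. (\<forall>\<xi>. cf \<mu> \<xi> ^ m = a \<xi> + b \<xi>) \<and> mult_bound b (K / sqrt (real m) ^ q) \<and>
       (\<forall>v. mult_bound (\<lambda>\<xi>. deriv_mult v \<xi> ^ q * a \<xi>) (K * norm v ^ q / sqrt (real m) ^ q))"
    \<comment> \<open>For small \<open>m\<close> there may be fewer than \<open>q\<close> smooth factors; then everything counts as rough, and the
      constant \<open>K3\<close> makes the bound trivial.\<close>
    proof (cases "\<alpha> * real m < real q")
      case True
      have "sqrt (real m) \<le> sqrt (real q / \<alpha>)" using True \<alpha> by (simp add: field_simps)
      then have "sqrt (real m) ^ q \<le> K3" unfolding K3_def by (intro power_mono) auto
      also have "K3 \<le> K" using K123 by (simp add: K_def)
      finally have "1 \<le> K / sqrt (real m) ^ q" using m by (simp add: field_simps)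
      moreover have "mult_bound (\<lambda>\<xi>. cf \<mu> \<xi> ^ m) 1"
        using mult_bound_power[OF mult_bound_cf[OF \<mu>], of m] by simp
      ultimately have "mult_bound (\<lambda>\<xi>. cf \<mu> \<xi> ^ m) (K / sqrt (real m) ^ q)"
        by (rule mult_bound_mono[rotated])
      moreover have "mult_bound (\<lambda>\<xi>. deriv_mult v \<xi> ^ q * 0) (K * norm v ^ q / sqrt (real m) ^ q)" for v :: 'a
        using K by (simp add: mult_bound_mono[OF mult_bound_0])
      ultimately show ?thesis
        by (intro exI[of _ "\<lambda>_. 0"] exI[of _ "\<lambda>\<xi>. cf \<mu> \<xi> ^ m"]) auto
    next
      case False
      define \<rho> where "\<rho> \<xi> = cf \<mu> \<xi> - complex_of_real p * cf \<kappa> \<xi>" for \<xi>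
      have \<rho>: "mult_bound \<rho> (1 - p)"
        unfolding \<rho>_def using dom p by (intro mult_bound_remainder \<kappa> \<mu>) auto
      define w where "w k = real (m choose k) * p ^ k" for k
      have w: "0 \<le> w k" for k using p by (simp add: w_def)
      define S where "S = {k. k \<le> m \<and> real k < \<alpha> * real m}"
      define R where "R = {k. k \<le> m \<and> \<not> real k < \<alpha> * real m}"
      have fin: "finite S" "finite R" and un: "S \<inter> R = {}" "S \<union> R = {..m}" by (auto simp: S_def R_def)
      define g where "g k \<xi> = complex_of_real (w k) * (cf \<kappa> \<xi> ^ k * \<rho> \<xi> ^ (m - k))" for k \<xi>
      define a where "a \<xi> = (\<Sum>k\<in>R. g k \<xi>)" for \<xi>
      define b where "b \<xi> = (\<Sum>k\<in>S. g k \<xi>)" for \<xi>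
      have "cf \<mu> \<xi> ^ m = a \<xi> + b \<xi>" for \<xi>
      proof -
        have "cf \<mu> \<xi> ^ m = (complex_of_real p * cf \<kappa> \<xi> + \<rho> \<xi>) ^ m" by (simp add: \<rho>_def)
        also have "\<dots> = (\<Sum>k\<le>m. g k \<xi>)"
          unfolding binomial_ring by (simp add: g_def w_def power_mult_distrib ac_simps)
        also have "\<dots> = b \<xi> + a \<xi>"
          unfolding a_def b_def un(2)[symmetric] by (rule sum.union_disjoint[OF fin un(1)])
        finally show ?thesis by simp
      qed
      moreover have "mult_bound b (K / sqrt (real m) ^ q)"
      proof -
        have "mult_bound b (\<Sum>k\<in>S. \<bar>w k\<bar> * (1 ^ k * (1 - p) ^ (m - k)))"
          unfolding b_def g_def
          by (intro mult_bound_sum mult_bound_scale mult_bound_mult mult_bound_power mult_bound_cf \<kappa> \<rho>)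
        moreover have "(\<Sum>k\<in>S. \<bar>w k\<bar> * (1 ^ k * (1 - p) ^ (m - k))) \<le> exp (- \<alpha> * real m)"
          using tail[of m] p by (simp add: S_def w_def)
        moreover have "exp (- \<alpha> * real m) \<le> K2 / sqrt (real m) ^ q"
          unfolding K2_def by (rule exp_minus_le_power[OF \<alpha> m q])
        moreover have "K2 / sqrt (real m) ^ q \<le> K / sqrt (real m) ^ q"
          using K123 by (intro divide_right_mono) (auto simp: K_def)
        ultimately show ?thesis by (meson mult_bound_mono order_trans)
      qed
      moreover have "mult_bound (\<lambda>\<xi>. deriv_mult v \<xi> ^ q * a \<xi>) (K * norm v ^ q / sqrt (real m) ^ q)" for v
      proof -
        define c where "c = K1 * norm v ^ q / sqrt (real m) ^ q"
        have c: "c = (sqrt (2 * real q * J / \<alpha>) * norm v / sqrt (real m)) ^ q"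
          by (simp add: c_def K1_def power_divide power_mult_distrib)
        have "0 \<le> c" using K123 by (simp add: c_def)
        have "mult_bound (\<lambda>\<xi>. \<Sum>k\<in>R. complex_of_real (w k) * (deriv_mult v \<xi> ^ q * (cf \<kappa> \<xi> ^ k * \<rho> \<xi> ^ (m - k))))
           (\<Sum>k\<in>R. \<bar>w k\<bar> * (c * (1 - p) ^ (m - k)))"
        proof (intro mult_bound_sum mult_bound_scale)
          fix k assume "k \<in> R"
          then have "\<alpha> * real m \<le> real k" "q \<le> k" using False by (auto simp: R_def)
          then show "mult_bound (\<lambda>\<xi>. deriv_mult v \<xi> ^ q * (cf \<kappa> \<xi> ^ k * \<rho> \<xi> ^ (m - k))) (c * (1 - p) ^ (m - k))"
            unfolding c by (intro mult_bound_many_smooth_factors \<kappa> mult_bound_power \<rho> q \<alpha> m)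
        qed
        moreover have "(\<lambda>\<xi>. \<Sum>k\<in>R. complex_of_real (w k) * (deriv_mult v \<xi> ^ q * (cf \<kappa> \<xi> ^ k * \<rho> \<xi> ^ (m - k))))
            = (\<lambda>\<xi>. deriv_mult v \<xi> ^ q * a \<xi>)"
          by (simp add: a_def g_def sum_distrib_left ac_simps)
        moreover have "(\<Sum>k\<in>R. \<bar>w k\<bar> * (c * (1 - p) ^ (m - k))) \<le> K * norm v ^ q / sqrt (real m) ^ q"
        proof -
          have "(\<Sum>k\<in>R. \<bar>w k\<bar> * (c * (1 - p) ^ (m - k))) \<le> (\<Sum>k\<le>m. \<bar>w k\<bar> * (c * (1 - p) ^ (m - k)))"
            using \<open>0 \<le> c\<close> p by (intro sum_mono2) (auto simp: R_def)
          also have "\<dots> = c * (p + (1 - p)) ^ m"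
            unfolding binomial_ring using w by (simp add: sum_distrib_left w_def ac_simps)
          also have "\<dots> = c" by simp
          also have "c \<le> K * norm v ^ q / sqrt (real m) ^ q"
            unfolding c_def using K123 by (intro divide_right_mono mult_right_mono) (auto simp: K_def)
          finally show ?thesis .
        qed
        ultimately show ?thesis by (simp add: mult_bound_mono)
      qed
      ultimately show ?thesis by blast
    qed
  qed
  with K show ?thesis by blast
qed

text \<open>
  The law of \<open>T X\<close> inherits the smoothing of the law of \<open>X\<close>: a derivative in direction \<open>v\<close> after \<open>T\<close>
  is a derivative in direction \<open>T' v\<close> before it.
\<close>

lemma smooth_powers_comp_linear:
  fixes \<phi> :: "'a::euclidean_space \<Rightarrow> complex" and T S T' :: "'a \<Rightarrow> 'a"
  assumes "smooth_powers \<phi> q K" and adj: "\<And>\<xi> y. \<xi> \<bullet> T y = S \<xi> \<bullet> y"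
    and inv: "\<And>y. T (T' y) = y" and T': "\<And>v. norm (T' v) \<le> c * norm v"
    and "0 \<le> K" "0 \<le> c"
  shows "smooth_powers (\<lambda>\<xi>. \<phi> (S \<xi>)) q (K * max 1 (c ^ q))"
  unfolding smooth_powers_def
proof (intro allI impI)
  fix m :: nat assume "1 \<le> m"
  then obtain a b where ab: "\<And>\<xi>. \<phi> \<xi> ^ m = a \<xi> + b \<xi>" "mult_bound b (K / sqrt (real m) ^ q)"
    "\<And>v. mult_bound (\<lambda>\<xi>. deriv_mult v \<xi> ^ q * a \<xi>) (K * norm v ^ q / sqrt (real m) ^ q)"
    using assms(1)[unfolded smooth_powers_def, rule_format, of m] by blast
  have "surj T" using inv by (metis surjI)
  note comp = mult_bound_comp_linear[OF _ adj \<open>surj T\<close>]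
  have "mult_bound (\<lambda>\<xi>. b (S \<xi>)) (K * max 1 (c ^ q) / sqrt (real m) ^ q)"
    using \<open>0 \<le> K\<close> by (intro mult_bound_mono[OF comp[OF ab(2)]] divide_right_mono)
      (auto intro: mult_left_mono[of 1 _ K, simplified])
  moreover have "mult_bound (\<lambda>\<xi>. deriv_mult v \<xi> ^ q * a (S \<xi>)) (K * max 1 (c ^ q) * norm v ^ q / sqrt (real m) ^ q)" for v
  proof -
    have "deriv_mult v \<xi> = deriv_mult (T' v) (S \<xi>)" for \<xi>
      by (simp add: deriv_mult_def adj[symmetric] inv)
    then have *: "mult_bound (\<lambda>\<xi>. deriv_mult v \<xi> ^ q * a (S \<xi>)) (K * norm (T' v) ^ q / sqrt (real m) ^ q)"
      using comp[OF ab(3)[of "T' v"]] by simp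
    have "norm (T' v) ^ q \<le> (c * norm v) ^ q" by (intro power_mono T') auto
    also have "\<dots> \<le> max 1 (c ^ q) * norm v ^ q"
      by (simp add: power_mult_distrib mult_right_mono)
    finally have "K * norm (T' v) ^ q \<le> K * (max 1 (c ^ q) * norm v ^ q)"
      using \<open>0 \<le> K\<close> by (rule mult_left_mono)
    then show ?thesis
      by (intro mult_bound_mono[OF *] divide_right_mono) (auto simp: mult.assoc)
  qed
  ultimately show "\<exists>a b. (\<forall>\<xi>. \<phi> (S \<xi>) ^ m = a \<xi> + b \<xi>) \<and>
     mult_bound b (K * max 1 (c ^ q) / sqrt (real m) ^ q) \<and>
     (\<forall>v. mult_bound (\<lambda>\<xi>. deriv_mult v \<xi> ^ q * a \<xi>) (K * max 1 (c ^ q) * norm v ^ q / sqrt (real m) ^ q))"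
    using ab(1) by (intro exI[of _ "\<lambda>\<xi>. a (S \<xi>)"] exI[of _ "\<lambda>\<xi>. b (S \<xi>)"]) auto
qed

section \<open>A compactly supported density with a score\<close>

lemma integrable_lborel_bounded_support:
  fixes f :: "'a::euclidean_space \<Rightarrow> 'b::{banach, second_countable_topology}"
  assumes [measurable]: "f \<in> borel_measurable borel" and le: "\<And>y. norm (f y) \<le> c * indicator (cball x0 R) y"
  shows "integrable lborel f"
proof (rule Bochner_Integration.integrable_bound)
  show "integrable lborel (\<lambda>y. c * indicator (cball x0 R) y :: real)"
    by (intro integrable_mult_right integrable_real_indicator emeasure_bounded_finite) auto
  show "AE x in lborel. norm (f x) \<le> norm (c * indicator (cball x0 R) x)"
    using le by (auto intro: order_trans[OF _ abs_ge_self])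
qed simp

text \<open>
  Squaring the positive part makes it continuously differentiable across 0, which is why the bump
  below is a square.
\<close>

lemma DERIV_max_square: "((\<lambda>z::real. (max 0 z)\<^sup>2) has_real_derivative 2 * max 0 z) (at z)"
proof -
  consider "z > 0" | "z < 0" | "z = 0" by linarith
  then show ?thesis
  proof cases
    case 1
    have "((\<lambda>z::real. z\<^sup>2) has_real_derivative 2 * max 0 z) (at z)"
      using 1 by (auto intro!: derivative_eq_intros)
    then show ?thesis
      by (rule has_field_derivative_transform_within_open[where S="{0<..}"]) (use 1 in auto)
  next
    case 2
    have "((\<lambda>z::real. 0) has_real_derivative 2 * max 0 z) (at z)"
      using 2 by (auto intro!: derivative_eq_intros)
    then show ?thesis
      by (rule has_field_derivative_transform_within_open[where S="{..<0}"]) (use 2 in auto)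
  next
    case 3
    have "((\<lambda>y::real. (max 0 y)\<^sup>2 / y) \<longlongrightarrow> 0) (at 0)"
    proof (rule Lim_null_comparison)
      show "\<forall>\<^sub>F y in at 0. norm ((max 0 y)\<^sup>2 / y) \<le> \<bar>y\<bar>"
        by (rule always_eventually) (auto simp: max_def power2_eq_square)
      show "(abs \<longlongrightarrow> 0) (at (0::real))"
        using tendsto_rabs[OF tendsto_ident_at[of "0::real" UNIV]] by simp
    qed
    then show ?thesis by (simp add: has_field_derivative_iff 3)
  qed
qed

definition bump :: "'a::euclidean_space \<Rightarrow> real \<Rightarrow> 'a \<Rightarrow> real" where
  "bump x0 \<rho> y = (max 0 (\<rho>\<^sup>2 - (norm (y - x0))\<^sup>2))\<^sup>2"

text \<open>
  Minus the derivative of the bump in direction \<open>v\<close>.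
\<close>

definition bump_slope :: "'a::euclidean_space \<Rightarrow> real \<Rightarrow> 'a \<Rightarrow> 'a \<Rightarrow> real" where
  "bump_slope x0 \<rho> v y = 4 * ((y - x0) \<bullet> v) * max 0 (\<rho>\<^sup>2 - (norm (y - x0))\<^sup>2)"

lemma continuous_bump: "continuous_on UNIV (bump x0 \<rho>)"
proof -
  have "continuous_on UNIV (\<lambda>y. bump x0 \<rho> y)"
    unfolding bump_def by (intro continuous_intros)
  then show ?thesis by simp
qed

lemma measurable_bump [measurable]: "bump x0 \<rho> \<in> borel_measurable borel"
  using continuous_bump by (rule borel_measurable_continuous_onI)

lemma measurable_bump_slope [measurable]: "bump_slope x0 \<rho> v \<in> borel_measurable borel"
proof -
  have "continuous_on UNIV (\<lambda>y. bump_slope x0 \<rho> v y)"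
    unfolding bump_slope_def by (intro continuous_intros)
  then show ?thesis by (intro borel_measurable_continuous_onI) simp
qed

lemma bump_nonneg: "0 \<le> bump x0 \<rho> y"
  by (simp add: bump_def)

lemma bump_outside: "0 \<le> \<rho> \<Longrightarrow> y \<notin> cball x0 \<rho> \<Longrightarrow> bump x0 \<rho> y = 0"
  by (simp add: bump_def dist_norm norm_minus_commute max_def)

lemma bump_le: "bump x0 \<rho> y \<le> \<rho> ^ 4"
proof -
  have "(max 0 (\<rho>\<^sup>2 - (norm (y - x0))\<^sup>2))\<^sup>2 \<le> (\<rho>\<^sup>2)\<^sup>2"
    by (intro power_mono) auto
  then show ?thesis by (simp add: bump_def flip: power_mult)
qed

lemma bump_le_indicator: "0 \<le> \<rho> \<Longrightarrow> bump x0 \<rho> y \<le> \<rho> ^ 4 * indicator (cball x0 \<rho>) y"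
  using bump_le[of x0 \<rho> y] bump_outside[of \<rho> y x0] by (auto simp: indicator_def)

lemma integrable_bump: "0 \<le> \<rho> \<Longrightarrow> integrable lborel (bump x0 \<rho>)"
  by (rule integrable_lborel_bounded_support[of _ "\<rho> ^ 4" x0 \<rho>])
    (simp_all add: bump_nonneg bump_le_indicator)

lemma integral_bump_pos:
  assumes "0 < \<rho>"
  shows "0 < (\<integral>y. bump x0 \<rho> y \<partial>lborel)"
proof -
  let ?c = "((\<rho>\<^sup>2 * 3 / 4)\<^sup>2)"
  have "0 < ?c * measure lborel (ball x0 (\<rho> / 2))"
    using assms by (simp add: content_ball_pos)
  also have "\<dots> = (\<integral>y. ?c * indicator (ball x0 (\<rho> / 2)) y \<partial>lborel)"
    by simp
  also have "\<dots> \<le> (\<integral>y. bump x0 \<rho> y \<partial>lborel)"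
  proof (rule integral_mono)
    show "integrable lborel (\<lambda>y. ?c * indicator (ball x0 (\<rho> / 2)) y :: real)"
      by (intro integrable_mult_right integrable_real_indicator emeasure_bounded_finite) auto
    show "integrable lborel (bump x0 \<rho>)" using assms by (simp add: integrable_bump)
    fix y
    show "?c * indicator (ball x0 (\<rho> / 2)) y \<le> bump x0 \<rho> y"
    proof (cases "y \<in> ball x0 (\<rho> / 2)")
      case True
      then have "norm (y - x0) \<le> \<rho> / 2" by (simp add: dist_norm norm_minus_commute)
      then have "(norm (y - x0))\<^sup>2 \<le> (\<rho> / 2)\<^sup>2" by (intro power_mono) auto
      then have "\<rho>\<^sup>2 * 3 / 4 \<le> \<rho>\<^sup>2 - (norm (y - x0))\<^sup>2" by (simp add: power2_eq_square)
      then have "\<rho>\<^sup>2 * 3 / 4 \<le> max 0 (\<rho>\<^sup>2 - (norm (y - x0))\<^sup>2)" by linarith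
      then have "?c \<le> bump x0 \<rho> y" unfolding bump_def by (intro power_mono) auto
      with True show ?thesis by simp
    qed (simp add: bump_nonneg)
  qed
  finally show ?thesis .
qed

lemma norm_shift_square:
  fixes y x0 v :: "'a::euclidean_space"
  shows "(norm (y - t *\<^sub>R v - x0))\<^sup>2 = (norm (y - x0))\<^sup>2 - 2 * t * ((y - x0) \<bullet> v) + t\<^sup>2 * (norm v)\<^sup>2"
proof -
  have eq: "y - t *\<^sub>R v - x0 = (y - x0) - t *\<^sub>R v" by simp
  show ?thesis
    unfolding eq power2_norm_eq_inner inner_diff_left[of "y - x0"] inner_diff_right[of _ "y - x0"]
    by (simp add: inner_commute power2_eq_square)
qed

lemma bump_translate_DERIV:
  "((\<lambda>t. bump x0 \<rho> (y - t *\<^sub>R v)) has_real_derivative bump_slope x0 \<rho> v y) (at 0)"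
proof -
  let ?u = "\<lambda>t. \<rho>\<^sup>2 - ((norm (y - x0))\<^sup>2 - 2 * t * ((y - x0) \<bullet> v) + t\<^sup>2 * (norm v)\<^sup>2)"
  have "(?u has_real_derivative 2 * ((y - x0) \<bullet> v)) (at 0)"
    by (auto intro!: derivative_eq_intros)
  from DERIV_chain2[OF DERIV_max_square this]
  show ?thesis
    by (simp add: bump_def bump_slope_def norm_shift_square ac_simps)
qed

lemma bump_translate_Lipschitz:
  assumes "0 \<le> \<rho>" "0 < t" "t \<le> 1"
  shows "\<bar>(bump x0 \<rho> (y - t *\<^sub>R v) - bump x0 \<rho> y) / t\<bar>
     \<le> 2 * \<rho>\<^sup>2 * (2 * (\<rho> + norm v) * norm v + (norm v)\<^sup>2) * indicator (cball x0 (\<rho> + norm v)) y"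
proof (cases "y \<in> cball x0 (\<rho> + norm v)")
  case True
  then have y: "norm (y - x0) \<le> \<rho> + norm v" by (simp add: dist_norm norm_minus_commute)
  define a where "a = \<rho>\<^sup>2 - (norm (y - t *\<^sub>R v - x0))\<^sup>2"
  define b where "b = \<rho>\<^sup>2 - (norm (y - x0))\<^sup>2"
  have "\<bar>a - b\<bar> = \<bar>t * (2 * ((y - x0) \<bullet> v) - t * (norm v)\<^sup>2)\<bar>"
    unfolding a_def b_def norm_shift_square by (simp add: power2_eq_square algebra_simps)
  also have "\<dots> = t * \<bar>2 * ((y - x0) \<bullet> v) - t * (norm v)\<^sup>2\<bar>"
    using assms by (simp add: abs_mult)
  also have "\<dots> \<le> t * (2 * (\<rho> + norm v) * norm v + (norm v)\<^sup>2)"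
  proof (rule mult_left_mono)
    have "\<bar>(y - x0) \<bullet> v\<bar> \<le> norm (y - x0) * norm v" by (rule Cauchy_Schwarz_ineq2)
    also have "\<dots> \<le> (\<rho> + norm v) * norm v" using y by (rule mult_right_mono) simp
    finally have 1: "\<bar>(y - x0) \<bullet> v\<bar> \<le> (\<rho> + norm v) * norm v" .
    have "t * (norm v)\<^sup>2 \<le> 1 * (norm v)\<^sup>2" using assms by (intro mult_right_mono) auto
    moreover have "0 \<le> t * (norm v)\<^sup>2" using assms by simp
    ultimately show "\<bar>2 * ((y - x0) \<bullet> v) - t * (norm v)\<^sup>2\<bar> \<le> 2 * (\<rho> + norm v) * norm v + (norm v)\<^sup>2"
      using 1 unfolding abs_le_iff by (simp only: mult.assoc) linarith
  qed (use assms in auto)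
  finally have ab: "\<bar>a - b\<bar> \<le> t * (2 * (\<rho> + norm v) * norm v + (norm v)\<^sup>2)" .
  have "\<bar>(max 0 a)\<^sup>2 - (max 0 b)\<^sup>2\<bar> = \<bar>max 0 a - max 0 b\<bar> * (max 0 a + max 0 b)"
    by (simp add: power2_eq_square square_diff_square_factored abs_mult mult.commute)
  also have "\<dots> \<le> \<bar>a - b\<bar> * (\<rho>\<^sup>2 + \<rho>\<^sup>2)"
    by (intro mult_mono add_mono) (auto simp: a_def b_def)
  also have "\<dots> \<le> t * (2 * (\<rho> + norm v) * norm v + (norm v)\<^sup>2) * (\<rho>\<^sup>2 + \<rho>\<^sup>2)"
    using ab by (rule mult_right_mono) simp
  finally have "\<bar>bump x0 \<rho> (y - t *\<^sub>R v) - bump x0 \<rho> y\<bar>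
     \<le> t * (2 * (\<rho> + norm v) * norm v + (norm v)\<^sup>2) * (\<rho>\<^sup>2 + \<rho>\<^sup>2)"
    by (simp add: bump_def a_def b_def)
  then show ?thesis
    using True assms by (simp add: field_simps)
next
  case False
  then have y: "\<rho> + norm v < norm (y - x0)" by (simp add: dist_norm norm_minus_commute)
  have "norm (y - x0) \<le> norm (y - t *\<^sub>R v - x0) + norm (t *\<^sub>R v)"
    using norm_triangle_ineq[of "y - t *\<^sub>R v - x0" "t *\<^sub>R v"] by simp
  moreover have "norm (t *\<^sub>R v) \<le> 1 * norm v"
    using assms by (simp add: mult_right_le_one_le mult_left_le_one_le)
  ultimately have "\<rho> < norm (y - t *\<^sub>R v - x0)" using y by simp
  then have "bump x0 \<rho> (y - t *\<^sub>R v) = 0"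
    using assms by (intro bump_outside) (auto simp: dist_norm norm_minus_commute)
  moreover have "\<rho> < norm (y - x0)" using y norm_ge_zero[of v] by linarith
  then have "bump x0 \<rho> y = 0"
    using assms by (intro bump_outside) (auto simp: dist_norm norm_minus_commute)
  ultimately show ?thesis using assms by (simp add: mult_nonneg_nonneg)
qed

text \<open>
  Translation invariance of Lebesgue measure gives
  \<open>\<integral> bump (y - t v) cis (\<xi> \<bullet> y) = cis (t \<xi> \<bullet> v) \<integral> bump y cis (\<xi> \<bullet> y)\<close>, and the claim is the derivative of both
  sides at \<open>t = 0\<close>. It is taken along the sequence \<open>t = 1 / (n + 1)\<close>, with dominated convergence on the left.
\<close>

lemma bump_integration_by_parts:
  assumes "0 \<le> \<rho>"
  shows "deriv_mult v \<xi> * (\<integral>y. complex_of_real (bump x0 \<rho> y) * cis (\<xi> \<bullet> y) \<partial>lborel)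
           = (\<integral>y. complex_of_real (bump_slope x0 \<rho> v y) * cis (\<xi> \<bullet> y) \<partial>lborel)"
proof -
  define I where "I = (\<integral>y. complex_of_real (bump x0 \<rho> y) * cis (\<xi> \<bullet> y) \<partial>lborel)"
  define t where "t n = 1 / real (Suc n)" for n
  have t: "0 < t n" "t n \<le> 1" for n by (auto simp: t_def)
  have t0: "t \<longlonglongrightarrow> 0" unfolding t_def by (rule LIMSEQ_Suc[OF lim_1_over_n])
  have tat: "filterlim t (at 0) sequentially"
    using t t0 by (auto simp: filterlim_at less_imp_neq[symmetric] intro!: always_eventually)
  have i1: "integrable lborel (\<lambda>y. complex_of_real (bump x0 \<rho> (y - w)) * cis (\<xi> \<bullet> y))" for w
  proof (rule integrable_lborel_bounded_support[of _ "\<rho> ^ 4" "x0 + w" \<rho>])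
    fix y
    have "norm (complex_of_real (bump x0 \<rho> (y - w)) * cis (\<xi> \<bullet> y)) = bump x0 \<rho> (y - w)"
      by (simp add: norm_mult bump_nonneg)
    also have "\<dots> \<le> \<rho> ^ 4 * indicator (cball x0 \<rho>) (y - w)"
      using assms by (rule bump_le_indicator)
    also have "indicator (cball x0 \<rho>) (y - w) = (indicator (cball (x0 + w) \<rho>) y :: real)"
      by (auto simp: indicator_def dist_norm algebra_simps)
    finally show "norm (complex_of_real (bump x0 \<rho> (y - w)) * cis (\<xi> \<bullet> y)) \<le> \<rho> ^ 4 * indicator (cball (x0 + w) \<rho>) y" .
  qed simp
  have shift: "(\<integral>y. complex_of_real (bump x0 \<rho> (y - w)) * cis (\<xi> \<bullet> y) \<partial>lborel) = cis (\<xi> \<bullet> w) * I" for w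
  proof -
    have "(\<integral>y. complex_of_real (bump x0 \<rho> (y - w)) * cis (\<xi> \<bullet> y) \<partial>lborel)
      = (\<integral>y. complex_of_real (bump x0 \<rho> (y - w)) * cis (\<xi> \<bullet> y) \<partial>distr lborel borel ((+) w))"
      by (simp add: lborel_distr_plus)
    also have "\<dots> = (\<integral>y. complex_of_real (bump x0 \<rho> (w + y - w)) * cis (\<xi> \<bullet> (w + y)) \<partial>lborel)"
      by (rule integral_distr) auto
    also have "\<dots> = (\<integral>y. cis (\<xi> \<bullet> w) * (complex_of_real (bump x0 \<rho> y) * cis (\<xi> \<bullet> y)) \<partial>lborel)"
      by (simp add: inner_add_right cis_mult[symmetric] ac_simps)
    finally show ?thesis by (simp add: I_def)
  qed
  let ?h = "\<lambda>n y. complex_of_real ((bump x0 \<rho> (y - t n *\<^sub>R v) - bump x0 \<rho> y) / t n) * cis (\<xi> \<bullet> y)"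
  let ?W = "2 * \<rho>\<^sup>2 * (2 * (\<rho> + norm v) * norm v + (norm v)\<^sup>2)"
  have lim1: "(\<lambda>n. \<integral>y. ?h n y \<partial>lborel) \<longlonglongrightarrow> (\<integral>y. complex_of_real (bump_slope x0 \<rho> v y) * cis (\<xi> \<bullet> y) \<partial>lborel)"
  proof (rule integral_dominated_convergence)
    show "integrable lborel (\<lambda>y. ?W * indicator (cball x0 (\<rho> + norm v)) y :: real)"
      by (intro integrable_mult_right integrable_real_indicator emeasure_bounded_finite) auto
    show "AE y in lborel. (\<lambda>n. ?h n y) \<longlonglongrightarrow> complex_of_real (bump_slope x0 \<rho> v y) * cis (\<xi> \<bullet> y)"
    proof (rule AE_I2)
      fix y
      have "((\<lambda>s. (bump x0 \<rho> (y - s *\<^sub>R v) - bump x0 \<rho> y) / s) \<longlongrightarrow> bump_slope x0 \<rho> v y) (at 0)"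
        using bump_translate_DERIV[of x0 \<rho> y v] by (simp add: has_field_derivative_iff)
      from filterlim_compose[OF this tat]
      show "(\<lambda>n. ?h n y) \<longlonglongrightarrow> complex_of_real (bump_slope x0 \<rho> v y) * cis (\<xi> \<bullet> y)"
        by (intro tendsto_intros)
    qed
    show "AE y in lborel. norm (?h n y) \<le> ?W * indicator (cball x0 (\<rho> + norm v)) y" for n
    proof (rule AE_I2)
      fix y
      have "norm (?h n y) = \<bar>(bump x0 \<rho> (y - t n *\<^sub>R v) - bump x0 \<rho> y) / t n\<bar>"
        by (simp only: norm_mult norm_of_real norm_cis mult_1_right)
      also have "\<dots> \<le> ?W * indicator (cball x0 (\<rho> + norm v)) y"
        by (rule bump_translate_Lipschitz[OF assms t])
      finally show "norm (?h n y) \<le> ?W * indicator (cball x0 (\<rho> + norm v)) y" .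
    qed
  qed measurable
  have "(\<integral>y. ?h n y \<partial>lborel) = (cis (t n * (\<xi> \<bullet> v)) - 1) / complex_of_real (t n) * I" for n
  proof -
    have "?h n y = (complex_of_real (bump x0 \<rho> (y - t n *\<^sub>R v)) * cis (\<xi> \<bullet> y)
        - complex_of_real (bump x0 \<rho> (y - 0)) * cis (\<xi> \<bullet> y)) / complex_of_real (t n)" for y
      by (simp add: field_simps diff_divide_distrib)
    then have "(\<integral>y. ?h n y \<partial>lborel) = (cis (\<xi> \<bullet> (t n *\<^sub>R v)) * I - cis (\<xi> \<bullet> 0) * I) / complex_of_real (t n)"
      by (simp only: integral_divide_zero Bochner_Integration.integral_diff[OF i1 i1] shift)
    then show ?thesis by (simp add: field_simps)
  qed
  moreover have "(\<lambda>n. (cis (t n * (\<xi> \<bullet> v)) - 1) / complex_of_real (t n)) \<longlonglongrightarrow> deriv_mult v \<xi>"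
  proof -
    have "((\<lambda>z. exp (z * deriv_mult v \<xi>)) has_field_derivative deriv_mult v \<xi>) (at 0)"
      by (auto intro!: derivative_eq_intros)
    then have lim: "((\<lambda>z. (exp (z * deriv_mult v \<xi>) - 1) / z) \<longlongrightarrow> deriv_mult v \<xi>) (at 0)"
      by (simp add: has_field_derivative_iff)
    have "filterlim (\<lambda>n. complex_of_real (t n)) (at 0) sequentially"
      using t tendsto_of_real[OF t0, where 'a=complex]
      by (auto simp: filterlim_at less_imp_neq[symmetric] intro!: always_eventually)
    from filterlim_compose[OF lim this] show ?thesis
      by (simp add: deriv_mult_def cis_conv_exp ac_simps)
  qed
  ultimately have "(\<lambda>n. \<integral>y. ?h n y \<partial>lborel) \<longlonglongrightarrow> deriv_mult v \<xi> * I"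
    by (simp only: tendsto_mult_right)
  with lim1 show ?thesis unfolding I_def by (rule LIMSEQ_unique[symmetric])
qed

text \<open>
  Finiteness of the Fisher information: for a density \<open>u\<^sup>2\<close> the quotient \<open>(\<partial>\<^sub>v u\<^sup>2)\<^sup>2 / u\<^sup>2 = 4 (\<partial>\<^sub>v u)\<^sup>2\<close> stays bounded up to
  the boundary of the support.
\<close>

lemma bump_slope_square_le:
  assumes "0 \<le> \<rho>"
  shows "bump x0 \<rho> y = 0 \<Longrightarrow> bump_slope x0 \<rho> v y = 0"
    and "(bump_slope x0 \<rho> v y / bump x0 \<rho> y)\<^sup>2 * bump x0 \<rho> y
           \<le> 16 * \<rho>\<^sup>2 * (norm v)\<^sup>2 * indicator (cball x0 \<rho>) y"
proof -
  define u where "u = \<rho>\<^sup>2 - (norm (y - x0))\<^sup>2"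
  show *: "bump_slope x0 \<rho> v y = 0" if "bump x0 \<rho> y = 0"
    using that by (auto simp: bump_def bump_slope_def)
  show "(bump_slope x0 \<rho> v y / bump x0 \<rho> y)\<^sup>2 * bump x0 \<rho> y
           \<le> 16 * \<rho>\<^sup>2 * (norm v)\<^sup>2 * indicator (cball x0 \<rho>) y"
  proof (cases "bump x0 \<rho> y = 0")
    case False
    then have u: "0 < u" by (auto simp: bump_def u_def max_def split: if_splits)
    then have y: "norm (y - x0) < \<rho>" using assms unfolding u_def by (simp add: power_less_imp_less_base)
    have "(bump_slope x0 \<rho> v y / bump x0 \<rho> y)\<^sup>2 * bump x0 \<rho> y = (4 * ((y - x0) \<bullet> v))\<^sup>2"
      using u by (simp add: bump_def bump_slope_def flip: u_def) (simp add: power2_eq_square)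
    also have "\<dots> \<le> (4 * (\<rho> * norm v))\<^sup>2"
    proof (rule abs_le_square_iff[THEN iffD1])
      have "\<bar>(y - x0) \<bullet> v\<bar> \<le> norm (y - x0) * norm v" by (rule Cauchy_Schwarz_ineq2)
      also have "\<dots> \<le> \<rho> * norm v" using y by (intro mult_right_mono) auto
      finally show "\<bar>4 * ((y - x0) \<bullet> v)\<bar> \<le> \<bar>4 * (\<rho> * norm v)\<bar>" using assms by (simp add: abs_mult)
    qed
    also have "\<dots> = 16 * \<rho>\<^sup>2 * (norm v)\<^sup>2" by (simp add: power_mult_distrib)
    finally show ?thesis using y by (simp add: dist_norm norm_minus_commute)
  qed simp
qed

definition bump_measure :: "'a::euclidean_space \<Rightarrow> real \<Rightarrow> 'a measure" where
  "bump_measure x0 \<rho>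
     = density lborel (\<lambda>y. ennreal (bump x0 \<rho> y / (\<integral>z. bump x0 \<rho> z \<partial>lborel)))"

lemma sets_bump_measure [simp]: "sets (bump_measure x0 \<rho>) = sets borel"
  by (simp add: bump_measure_def)

lemma prob_space_bump_measure:
  assumes "0 < \<rho>"
  shows "prob_space (bump_measure x0 \<rho>)"
proof (rule prob_spaceI)
  define Z where "Z = (\<integral>z. bump x0 \<rho> z \<partial>lborel)"
  have Z: "0 < Z" unfolding Z_def using assms by (rule integral_bump_pos)
  have "emeasure (bump_measure x0 \<rho>) (space (bump_measure x0 \<rho>))
      = (\<integral>\<^sup>+y. ennreal (bump x0 \<rho> y / Z) \<partial>lborel)"
    by (simp add: bump_measure_def emeasure_density Z_def)
  also have "\<dots> = ennreal (\<integral>y. bump x0 \<rho> y / Z \<partial>lborel)"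
    using Z assms by (intro nn_integral_eq_integral) (auto simp: integrable_bump bump_nonneg)
  also have "\<dots> = 1" using Z by (simp add: Z_def)
  finally show "emeasure (bump_measure x0 \<rho>) (space (bump_measure x0 \<rho>)) = 1" .
qed

lemma has_score_bump_measure:
  fixes x0 :: "'a::euclidean_space"
  assumes "0 < \<rho>"
  shows "\<exists>J. has_score (bump_measure x0 \<rho>) J"
proof -
  define Z where "Z = (\<integral>z. bump x0 \<rho> z \<partial>lborel)"
  define V where "V = measure lborel (cball x0 \<rho>)"
  have Z: "0 < Z" unfolding Z_def using assms by (rule integral_bump_pos)
  have V: "0 < V" unfolding V_def using assms by (rule content_cball_pos)
  have dens: "integrable (bump_measure x0 \<rho>) f \<longleftrightarrow> integrable lborel (\<lambda>y. (bump x0 \<rho> y / Z) *\<^sub>R f y)"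
    "(\<integral>y. f y \<partial>bump_measure x0 \<rho>) = (\<integral>y. (bump x0 \<rho> y / Z) *\<^sub>R f y \<partial>lborel)"
    if [measurable]: "f \<in> borel_measurable borel" for f :: "'a \<Rightarrow> 'b::{banach, second_countable_topology}"
    unfolding bump_measure_def Z_def[symmetric]
    using Z by (auto simp: bump_nonneg integrable_density integral_density)
  define J where "J = 16 * \<rho>\<^sup>2 * V / Z"
  have "has_score (bump_measure x0 \<rho>) J"
    unfolding has_score_def
  proof (intro conjI allI)
    show "0 < J" using Z V assms by (simp add: J_def)
    fix v :: 'a
    define s where "s y = bump_slope x0 \<rho> v y / bump x0 \<rho> y" for y
    have [measurable]: "s \<in> borel_measurable borel" unfolding s_def by measurable
    let ?W = "16 * \<rho>\<^sup>2 * (norm v)\<^sup>2 / Z"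
    have le: "(bump x0 \<rho> y / Z) *\<^sub>R (s y)\<^sup>2 \<le> ?W * indicator (cball x0 \<rho>) y" for y
      using divide_right_mono[OF bump_slope_square_le(2)[of \<rho> x0 v y], of Z] assms Z
      by (simp add: s_def mult.commute)
    have iW: "integrable lborel (\<lambda>y. ?W * indicator (cball x0 \<rho>) y :: real)"
      by (intro integrable_mult_right integrable_real_indicator emeasure_bounded_finite) auto
    have int: "integrable lborel (\<lambda>y. (bump x0 \<rho> y / Z) *\<^sub>R (s y)\<^sup>2)"
      using le Z by (intro integrable_lborel_bounded_support[of _ ?W x0 \<rho>]) (auto simp: bump_nonneg)
    have "(\<integral>y. (bump x0 \<rho> y / Z) *\<^sub>R (s y)\<^sup>2 \<partial>lborel) \<le> (\<integral>y. ?W * indicator (cball x0 \<rho>) y \<partial>lborel)"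
      by (intro integral_mono int iW le)
    also have "\<dots> = J * (norm v)\<^sup>2" by (simp add: J_def V_def)
    finally have "(\<integral>y. (bump x0 \<rho> y / Z) *\<^sub>R (s y)\<^sup>2 \<partial>lborel) \<le> J * (norm v)\<^sup>2" .
    moreover have "deriv_mult v \<xi> * cf (bump_measure x0 \<rho>) \<xi>
        = (\<integral>y. complex_of_real (s y) * cis (\<xi> \<bullet> y) \<partial>bump_measure x0 \<rho>)" for \<xi>
    proof -
      have "deriv_mult v \<xi> * cf (bump_measure x0 \<rho>) \<xi>
          = deriv_mult v \<xi> * (\<integral>y. complex_of_real (bump x0 \<rho> y) * cis (\<xi> \<bullet> y) \<partial>lborel) / complex_of_real Z"
        by (simp add: cf_def dens scaleR_conv_of_real)
      also have "\<dots> = (\<integral>y. complex_of_real (bump_slope x0 \<rho> v y) * cis (\<xi> \<bullet> y) \<partial>lborel) / complex_of_real Z"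
        using assms by (simp add: bump_integration_by_parts)
      also have "\<dots> = (\<integral>y. (bump x0 \<rho> y / Z) *\<^sub>R (complex_of_real (s y) * cis (\<xi> \<bullet> y)) \<partial>lborel)"
      proof -
        have "bump x0 \<rho> y * s y = bump_slope x0 \<rho> v y" for y
          using assms bump_slope_square_le(1)[of \<rho> x0 y v] by (auto simp: s_def)
        then have "(bump x0 \<rho> y / Z) *\<^sub>R (complex_of_real (s y) * cis (\<xi> \<bullet> y))
            = complex_of_real (bump_slope x0 \<rho> v y) * cis (\<xi> \<bullet> y) / complex_of_real Z" for y
          by (simp add: scaleR_conv_of_real flip: of_real_mult)
        then show ?thesis by simp
      qed
      also have "\<dots> = (\<integral>y. complex_of_real (s y) * cis (\<xi> \<bullet> y) \<partial>bump_measure x0 \<rho>)"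
        by (subst dens) auto
      finally show ?thesis .
    qed
    ultimately show "\<exists>s\<in>borel_measurable borel.
        integrable (bump_measure x0 \<rho>) (\<lambda>y. (s y)\<^sup>2) \<and>
        (\<integral>y. (s y)\<^sup>2 \<partial>bump_measure x0 \<rho>) \<le> J * (norm v)\<^sup>2 \<and>
        (\<forall>\<xi>. deriv_mult v \<xi> * cf (bump_measure x0 \<rho>) \<xi>
           = (\<integral>y. complex_of_real (s y) * cis (\<xi> \<bullet> y) \<partial>bump_measure x0 \<rho>))"
      using int by (intro bexI[of _ s]) (auto simp: dens)
  qed
  then show ?thesis by blast
qed

text \<open>
  The bump is at most \<open>\<rho>\<^sup>4\<close> and vanishes outside the ball, which determines the constant.
\<close>

lemma bump_measure_le_lborel:
  fixes x0 :: "'a::euclidean_space"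
  assumes "0 < \<rho>" "0 < \<epsilon>" "cball x0 \<rho> \<subseteq> D" "open D" and A: "A \<in> sets borel"
  shows "ennreal (\<epsilon> * (\<integral>z. bump x0 \<rho> z \<partial>lborel) / \<rho> ^ 4) * emeasure (bump_measure x0 \<rho>) A
           \<le> ennreal \<epsilon> * emeasure lborel (A \<inter> D)"
proof -
  note A[measurable]
  have [measurable]: "D \<in> sets borel" using assms by auto
  define Z where "Z = (\<integral>z. bump x0 \<rho> z \<partial>lborel)"
  have Z: "0 < Z" unfolding Z_def using assms(1) by (rule integral_bump_pos)
  have "ennreal (\<epsilon> * Z / \<rho> ^ 4) * emeasure (bump_measure x0 \<rho>) A
      = (\<integral>\<^sup>+y. ennreal (\<epsilon> * Z / \<rho> ^ 4) * (ennreal (bump x0 \<rho> y / Z) * indicator A y) \<partial>lborel)"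
    by (simp add: bump_measure_def emeasure_density nn_integral_cmult Z_def)
  also have "\<dots> \<le> (\<integral>\<^sup>+y. ennreal \<epsilon> * indicator (A \<inter> D) y \<partial>lborel)"
  proof (rule nn_integral_mono)
    fix y
    have le: "\<epsilon> * Z / \<rho> ^ 4 * (bump x0 \<rho> y / Z) \<le> \<epsilon> * indicator (cball x0 \<rho>) y"
      using mult_left_mono[OF bump_le_indicator[of \<rho> x0 y], of \<epsilon>] Z assms(1,2) by (simp add: field_simps)
    have "ennreal (\<epsilon> * Z / \<rho> ^ 4) * ennreal (bump x0 \<rho> y / Z) = ennreal (\<epsilon> * Z / \<rho> ^ 4 * (bump x0 \<rho> y / Z))"
      using Z assms(1,2) by (intro ennreal_mult[symmetric]) (auto simp: bump_nonneg)
    also have "\<dots> \<le> ennreal (\<epsilon> * indicator (cball x0 \<rho>) y)" using le by (rule ennreal_leI)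
    also have "\<dots> \<le> ennreal \<epsilon> * indicator D y"
      using assms(2,3) by (auto simp: indicator_def)
    finally have "ennreal (\<epsilon> * Z / \<rho> ^ 4) * ennreal (bump x0 \<rho> y / Z) \<le> ennreal \<epsilon> * indicator D y" .
    then show "ennreal (\<epsilon> * Z / \<rho> ^ 4) * (ennreal (bump x0 \<rho> y / Z) * indicator A y) \<le> ennreal \<epsilon> * indicator (A \<inter> D) y"
      by (auto simp: indicator_def)
  qed
  also have "\<dots> = ennreal \<epsilon> * emeasure lborel (A \<inter> D)"
    by (simp add: nn_integral_cmult)
  finally show ?thesis unfolding Z_def .
qed

text \<open>
  The bump lives on a ball inside \<open>D\<close>, so that \<open>K\<close> is common to all laws with the same witnesses
  \<open>\<epsilon>\<close> and \<open>D\<close>. The minimum with 1 ensures that \<open>p\<close> is a probability even when there is no such law.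
\<close>

lemma smooth_powers_dominates_leb:
  fixes D :: "(real^'n) set"
  assumes "0 < \<epsilon>" "open D" "D \<noteq> {}" "1 \<le> q"
  shows "\<exists>K>0. \<forall>\<mu>. prob_space \<mu> \<longrightarrow> sets \<mu> = sets borel \<longrightarrow> dominates_leb \<mu> \<epsilon> D \<longrightarrow>
           smooth_powers (cf \<mu>) q K"
proof -
  from assms obtain x0 where "x0 \<in> D" by blast
  then obtain \<rho> where \<rho>: "0 < \<rho>" "cball x0 \<rho> \<subseteq> D"
    using \<open>open D\<close> open_contains_cball by blast
  define p where "p = min 1 (\<epsilon> * (\<integral>z. bump x0 \<rho> z \<partial>lborel) / \<rho> ^ 4)"
  have p: "0 < p" "p \<le> 1" using assms \<rho> integral_bump_pos[of \<rho> x0] by (auto simp: p_def)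
  obtain J where J: "has_score (bump_measure x0 \<rho>) J" using has_score_bump_measure \<rho> by blast
  obtain K where K: "0 < K" and smooth: "\<And>\<mu>. prob_space \<mu> \<Longrightarrow> sets \<mu> = sets borel \<Longrightarrow>
           (\<forall>A\<in>sets borel. ennreal p * emeasure (bump_measure x0 \<rho>) A \<le> emeasure \<mu> A) \<Longrightarrow>
           smooth_powers (cf \<mu>) q K"
    using smooth_powers_cf[OF prob_space_bump_measure[OF \<rho>(1)] sets_bump_measure J p \<open>1 \<le> q\<close>] by blast
  have "ennreal p * emeasure (bump_measure x0 \<rho>) A \<le> emeasure \<mu> A"
    if dom: "dominates_leb \<mu> \<epsilon> D" and A: "A \<in> sets borel" for \<mu> A
  proof -
    have "ennreal p * emeasure (bump_measure x0 \<rho>) A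
        \<le> ennreal (\<epsilon> * (\<integral>z. bump x0 \<rho> z \<partial>lborel) / \<rho> ^ 4) * emeasure (bump_measure x0 \<rho>) A"
      by (intro mult_right_mono ennreal_leI) (auto simp: p_def)
    also have "\<dots> \<le> ennreal \<epsilon> * emeasure lborel (A \<inter> D)"
      by (rule bump_measure_le_lborel[OF \<rho>(1) assms(1) \<rho>(2) assms(2) A])
    also have "\<dots> \<le> emeasure \<mu> A" using dom A by (auto simp: dominates_leb_def)
    finally show ?thesis .
  qed
  with K smooth show ?thesis by blast
qed

section \<open>Replacing one summand at a time\<close>

lemma power_le_one_plus_power:
  fixes a :: real
  assumes "0 \<le> a" "j \<le> q"
  shows "a ^ j \<le> 1 + a ^ q"
proof (cases "a \<le> 1")
  case True
  then have "a ^ j \<le> 1" using assms by (simp add: power_le_one)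
  then show ?thesis using assms by (simp add: add_increasing2)
next
  case False
  then have "a ^ j \<le> a ^ q" using assms by (intro power_increasing) auto
  then show ?thesis by simp
qed

lemma (in finite_measure) integrable_inner_power:
  fixes Y :: "'a \<Rightarrow> 'b::euclidean_space"
  assumes [measurable]: "Y \<in> borel_measurable M"
    and int: "integrable M (\<lambda>y. norm (Y y) ^ q)" and "j \<le> q"
  shows "integrable M (\<lambda>y. (\<xi> \<bullet> Y y) ^ j)"
proof (rule Bochner_Integration.integrable_bound)
  show "integrable M (\<lambda>y. norm \<xi> ^ j * (1 + norm (Y y) ^ q))"
    using int by (intro integrable_mult_right Bochner_Integration.integrable_add) auto
  have "\<bar>(\<xi> \<bullet> z) ^ j\<bar> \<le> norm \<xi> ^ j * (1 + norm z ^ q)" for z :: 'b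
  proof -
    have "\<bar>(\<xi> \<bullet> z) ^ j\<bar> \<le> (norm \<xi> * norm z) ^ j"
      unfolding power_abs by (intro power_mono Cauchy_Schwarz_ineq2) auto
    also have "\<dots> = norm \<xi> ^ j * norm z ^ j" by (rule power_mult_distrib)
    also have "\<dots> \<le> norm \<xi> ^ j * (1 + norm z ^ q)"
      using \<open>j \<le> q\<close> by (intro mult_left_mono power_le_one_plus_power) auto
    finally show ?thesis .
  qed
  then show "AE y in M. norm ((\<xi> \<bullet> Y y) ^ j) \<le> norm (norm \<xi> ^ j * (1 + norm (Y y) ^ q))"
    by (auto intro: order_trans[OF _ abs_ge_self])
qed simp

text \<open>
  The derivative of order \<open>j\<close> in direction \<open>v\<close> is a homogeneous polynomial of degree \<open>j\<close> in \<open>v\<close>, so its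
  integral over \<open>v\<close> is determined by the moments of order \<open>j\<close>.
\<close>

lemma integral_trig_deriv_power:
  fixes \<mu> :: "'a::euclidean_space measure"
  assumes "finite_measure \<mu>" and sets: "sets \<mu> = sets borel"
    and int: "integrable \<mu> (\<lambda>y. norm y ^ q)" and "j \<le> q"
  shows "integrable \<mu> (\<lambda>v. trig (apply_mult (\<lambda>\<xi>. deriv_mult v \<xi> ^ j) L) x)" (is "?I L")
    and "(\<integral>v. trig (apply_mult (\<lambda>\<xi>. deriv_mult v \<xi> ^ j) L) x \<partial>\<mu>)
           = trig (apply_mult (\<lambda>\<xi>. \<i> ^ j * complex_of_real (\<integral>v. (\<xi> \<bullet> v) ^ j \<partial>\<mu>)) L) x" (is "?E L")
proof -
  interpret finite_measure \<mu> by fact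
  note sets[measurable_cong]
  have "?I L \<and> ?E L"
  proof (induction L)
    case (Cons a L)
    obtain c \<xi> where a: "a = (c, \<xi>)" by fastforce
    have i: "integrable \<mu> (\<lambda>v. (\<xi> \<bullet> v) ^ j)"
      by (rule integrable_inner_power[OF _ int \<open>j \<le> q\<close>]) simp
    have eq: "Re (c * (\<i> ^ j * complex_of_real r) * cis (\<xi> \<bullet> x)) = Re (c * \<i> ^ j * cis (\<xi> \<bullet> x)) * r" for r
    proof -
      have "c * (\<i> ^ j * complex_of_real r) * cis (\<xi> \<bullet> x) = c * \<i> ^ j * cis (\<xi> \<bullet> x) * complex_of_real r"
        by (simp only: ac_simps)
      moreover have "Re (z * complex_of_real r) = Re z * r" for z by simp
      ultimately show ?thesis by (simp only:)
    qed
    have "deriv_mult v \<xi> ^ j = \<i> ^ j * complex_of_real ((\<xi> \<bullet> v) ^ j)" for v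
      by (simp add: deriv_mult_def power_mult_distrib)
    then have d: "Re (c * deriv_mult v \<xi> ^ j * cis (\<xi> \<bullet> x)) = Re (c * \<i> ^ j * cis (\<xi> \<bullet> x)) * (\<xi> \<bullet> v) ^ j" for v
      by (simp only: eq)
    show ?case
      unfolding a apply_mult_Cons trig_Cons d eq
      using Cons i by simp
  qed simp
  then show "?I L" "?E L" by auto
qed

lemma trig_Taylor:
  "\<bar>trig L (x + v) - (\<Sum>j<q. trig (apply_mult (\<lambda>\<xi>. deriv_mult v \<xi> ^ j) L) x / fact j)\<bar> \<le> C / fact q"
  if C: "\<And>z. \<bar>trig (apply_mult (\<lambda>\<xi>. deriv_mult v \<xi> ^ q) L) z\<bar> \<le> C"
proof -
  define d where "d j t = trig (apply_mult (\<lambda>\<xi>. deriv_mult v \<xi> ^ j) L) (x + t *\<^sub>R v)" for j and t :: real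
  have "\<forall>j t. DERIV (d j) t :> d (Suc j) t"
    unfolding d_def using trig_has_derivative_along[of "apply_mult _ L" x v]
    by (simp add: apply_mult_mult)
  then obtain t where t: "d 0 1 = (\<Sum>j<q. d j 0 / fact j * 1 ^ j) + d q t / fact q * 1 ^ q"
    using Maclaurin_all_le[of d "d 0" 1 q] by blast
  have "trig L (x + v) - (\<Sum>j<q. trig (apply_mult (\<lambda>\<xi>. deriv_mult v \<xi> ^ j) L) x / fact j) = d q t / fact q"
    using t by (simp add: d_def)
  also have "\<bar>\<dots>\<bar> \<le> C / fact q"
    using C[of "x + t *\<^sub>R v"] by (simp add: d_def divide_right_mono)
  finally show ?thesis .
qed

text \<open>
  The Taylor polynomials of degree below \<open>q\<close> have equal integrals against \<open>\<mu>\<close> and \<open>\<nu>\<close>, and the remainders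
  are estimated separately for the two laws.
\<close>

lemma lindeberg_step:
  fixes \<mu> \<nu> :: "'a::euclidean_space measure"
  assumes \<mu>: "prob_space \<mu>" "sets \<mu> = sets borel" "integrable \<mu> (\<lambda>y. norm y ^ q)"
    and \<nu>: "prob_space \<nu>" "sets \<nu> = sets borel" "integrable \<nu> (\<lambda>y. norm y ^ q)"
    and moments: "\<And>\<xi> j. j < q \<Longrightarrow> (\<integral>y. (\<xi> \<bullet> y) ^ j \<partial>\<mu>) = (\<integral>y. (\<xi> \<bullet> y) ^ j \<partial>\<nu>)"
    and K: "\<And>v x. \<bar>trig (apply_mult (\<lambda>\<xi>. deriv_mult v \<xi> ^ q) L) x\<bar> \<le> K * norm v ^ q"
  shows "\<bar>trig (apply_mult (\<lambda>\<xi>. cf \<mu> \<xi> - cf \<nu> \<xi>) L) x\<bar>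
           \<le> K * ((\<integral>y. norm y ^ q \<partial>\<mu>) + (\<integral>y. norm y ^ q \<partial>\<nu>)) / fact q"
proof -
  define T where "T v = (\<Sum>j<q. trig (apply_mult (\<lambda>\<xi>. deriv_mult v \<xi> ^ j) L) x / fact j)" for v
  have fin: "finite_measure \<mu>" "finite_measure \<nu>"
    using \<mu>(1) \<nu>(1) by (auto simp: prob_space_def)
  have iT: "integrable \<mu> T" "integrable \<nu> T"
    unfolding T_def using \<mu> \<nu> fin
    by (auto intro!: Bochner_Integration.integrable_sum integrable_divide integral_trig_deriv_power(1))
  have "(\<integral>v. T v \<partial>\<mu>) = (\<integral>v. T v \<partial>\<nu>)"
  proof -
    have "(\<integral>v. T v \<partial>\<mu>) = (\<Sum>j<q. trig (apply_mult (\<lambda>\<xi>. \<i> ^ j * complex_of_real (\<integral>v. (\<xi> \<bullet> v) ^ j \<partial>\<mu>)) L) x / fact j)"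
      unfolding T_def using \<mu> fin
      by (subst Bochner_Integration.integral_sum)
        (auto intro!: integrable_divide integral_trig_deriv_power(1) sum.cong simp: integral_trig_deriv_power(2))
    also have "\<dots> = (\<Sum>j<q. trig (apply_mult (\<lambda>\<xi>. \<i> ^ j * complex_of_real (\<integral>v. (\<xi> \<bullet> v) ^ j \<partial>\<nu>)) L) x / fact j)"
      by (intro sum.cong refl) (simp add: moments)
    also have "\<dots> = (\<integral>v. T v \<partial>\<nu>)"
      unfolding T_def using \<nu> fin
      by (subst Bochner_Integration.integral_sum)
        (auto intro!: integrable_divide integral_trig_deriv_power(1) sum.cong simp: integral_trig_deriv_power(2))
    finally show ?thesis .
  qed
  moreover have err: "\<bar>(\<integral>v. trig L (x + v) \<partial>\<kappa>) - (\<integral>v. T v \<partial>\<kappa>)\<bar> \<le> K * (\<integral>v. norm v ^ q \<partial>\<kappa>) / fact q"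
    if \<kappa>: "finite_measure \<kappa>" "sets \<kappa> = sets borel" "integrable \<kappa> (\<lambda>y. norm y ^ q)" "integrable \<kappa> T"
    for \<kappa> :: "'a measure"
  proof -
    note itr = integrable_trig[OF \<kappa>(1,2), of L x]
    have "\<bar>(\<integral>v. trig L (x + v) \<partial>\<kappa>) - (\<integral>v. T v \<partial>\<kappa>)\<bar> = \<bar>\<integral>v. trig L (x + v) - T v \<partial>\<kappa>\<bar>"
      using itr \<kappa>(4) by simp
    also have "\<dots> \<le> (\<integral>v. \<bar>trig L (x + v) - T v\<bar> \<partial>\<kappa>)" by (rule integral_abs_bound)
    also have "\<dots> \<le> (\<integral>v. K * norm v ^ q / fact q \<partial>\<kappa>)"
    proof (rule integral_mono)
      show "\<bar>trig L (x + v) - T v\<bar> \<le> K * norm v ^ q / fact q" for v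
        unfolding T_def by (rule trig_Taylor[OF K])
    qed (use itr \<kappa>(3,4) in auto)
    finally show ?thesis by simp
  qed
  moreover note err[OF fin(1) \<mu>(2,3) iT(1)] err[OF fin(2) \<nu>(2,3) iT(2)]
  moreover have "K * ((\<integral>y. norm y ^ q \<partial>\<mu>) + (\<integral>y. norm y ^ q \<partial>\<nu>)) / fact q
     = K * (\<integral>y. norm y ^ q \<partial>\<mu>) / fact q + K * (\<integral>y. norm y ^ q \<partial>\<nu>) / fact q"
    by (simp add: field_simps)
  ultimately show ?thesis
    unfolding trig_apply_mult_diff trig_apply_mult_cf[OF fin(1) \<mu>(2)] trig_apply_mult_cf[OF fin(2) \<nu>(2)]
    by linarith
qed

text \<open>
  The rough part of \<open>\<phi>\<^sup>m\<close> is estimated by the total mass 2 of \<open>\<mu> - \<nu>\<close>, the smooth part by Taylor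
  expansion.
\<close>

lemma lindeberg_smoothed_step:
  fixes \<mu> \<nu> :: "'a::euclidean_space measure"
  assumes \<mu>: "prob_space \<mu>" "sets \<mu> = sets borel" "integrable \<mu> (\<lambda>y. norm y ^ q)"
    and \<nu>: "prob_space \<nu>" "sets \<nu> = sets borel" "integrable \<nu> (\<lambda>y. norm y ^ q)"
    and moments: "\<And>\<xi> j. j < q \<Longrightarrow> (\<integral>y. (\<xi> \<bullet> y) ^ j \<partial>\<mu>) = (\<integral>y. (\<xi> \<bullet> y) ^ j \<partial>\<nu>)"
    and \<phi>: "smooth_powers \<phi> q K" and "1 \<le> m" and \<psi>: "mult_bound \<psi> 1"
  shows "mult_bound (\<lambda>\<xi>. (cf \<mu> \<xi> - cf \<nu> \<xi>) * (\<phi> \<xi> ^ m * \<psi> \<xi>))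
           ((2 + ((\<integral>y. norm y ^ q \<partial>\<mu>) + (\<integral>y. norm y ^ q \<partial>\<nu>)) / fact q) * (K / sqrt (real m) ^ q))"
proof -
  define M where "M = (\<integral>y. norm y ^ q \<partial>\<mu>) + (\<integral>y. norm y ^ q \<partial>\<nu>)"
  define c where "c = K / sqrt (real m) ^ q"
  obtain a b where ab: "\<And>\<xi>. \<phi> \<xi> ^ m = a \<xi> + b \<xi>" "mult_bound b c"
    "\<And>v. mult_bound (\<lambda>\<xi>. deriv_mult v \<xi> ^ q * a \<xi>) (K * norm v ^ q / sqrt (real m) ^ q)"
    using \<phi>[unfolded smooth_powers_def, rule_format, OF \<open>1 \<le> m\<close>] unfolding c_def by blast
  have "mult_bound (\<lambda>\<xi>. cf \<mu> \<xi> - cf \<nu> \<xi>) 2"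
    using mult_bound_add[OF mult_bound_cf[OF \<mu>(1,2)] mult_bound_scale[OF mult_bound_cf[OF \<nu>(1,2)], of "-1"]]
    by simp
  then have rough: "mult_bound (\<lambda>\<xi>. (cf \<mu> \<xi> - cf \<nu> \<xi>) * (b \<xi> * \<psi> \<xi>)) (2 * (c * 1))"
    by (intro mult_bound_mult ab(2) \<psi>)
  have smooth: "mult_bound (\<lambda>\<xi>. (cf \<mu> \<xi> - cf \<nu> \<xi>) * (a \<xi> * \<psi> \<xi>)) (M / fact q * c)"
  proof (rule mult_boundI)
    fix L :: "(complex \<times> 'a) list" and B and x :: 'a
    assume B: "\<And>x. \<bar>trig L x\<bar> \<le> B"
    have "\<bar>trig (apply_mult (\<lambda>\<xi>. deriv_mult v \<xi> ^ q) (apply_mult (\<lambda>\<xi>. a \<xi> * \<psi> \<xi>) L)) z\<bar> \<le> c * B * norm v ^ q" for v z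
      using mult_boundD[OF ab(3)[of v] mult_boundD[OF \<psi> B], of z]
      by (simp add: apply_mult_mult c_def ac_simps)
    from lindeberg_step[OF \<mu> \<nu> moments this, of x]
    show "\<bar>trig (apply_mult (\<lambda>\<xi>. (cf \<mu> \<xi> - cf \<nu> \<xi>) * (a \<xi> * \<psi> \<xi>)) L) x\<bar> \<le> M / fact q * c * B"
      by (simp add: apply_mult_mult M_def ac_simps)
  qed
  show ?thesis
    using mult_bound_add[OF rough smooth]
    by (simp add: ab(1) M_def[symmetric] c_def[symmetric] algebra_simps)
qed

text \<open>
  In each term of the telescoping sum the law that occurs more often does the smoothing. For
  \<open>n \<ge> 2\<close> it occurs at least \<open>(n - 1) / 2 \<ge> n / 4\<close> times, whence the denominator \<open>sqrt n / 2\<close>.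
\<close>

lemma lindeberg_bound:
  fixes \<mu> \<nu> :: "'a::euclidean_space measure"
  assumes \<mu>: "prob_space \<mu>" "sets \<mu> = sets borel" "integrable \<mu> (\<lambda>y. norm y ^ q)"
    and \<nu>: "prob_space \<nu>" "sets \<nu> = sets borel" "integrable \<nu> (\<lambda>y. norm y ^ q)"
    and moments: "\<And>\<xi> j. j < q \<Longrightarrow> (\<integral>y. (\<xi> \<bullet> y) ^ j \<partial>\<mu>) = (\<integral>y. (\<xi> \<bullet> y) ^ j \<partial>\<nu>)"
    and smooth: "smooth_powers (cf \<mu>) q K" "smooth_powers (cf \<nu>) q K" and "0 \<le> K" "2 \<le> n"
  shows "mult_bound (\<lambda>\<xi>. cf \<mu> \<xi> ^ n - cf \<nu> \<xi> ^ n)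
           (real n * ((2 + ((\<integral>y. norm y ^ q \<partial>\<mu>) + (\<integral>y. norm y ^ q \<partial>\<nu>)) / fact q) * K / (sqrt (real n) / 2) ^ q))"
proof -
  define M where "M = 2 + ((\<integral>y. norm y ^ q \<partial>\<mu>) + (\<integral>y. norm y ^ q \<partial>\<nu>)) / fact q"
  have "0 \<le> M" unfolding M_def by (intro add_nonneg_nonneg divide_nonneg_nonneg integral_nonneg_AE) auto
  have pw: "mult_bound (\<lambda>\<xi>. cf \<kappa> \<xi> ^ j) 1" if "prob_space \<kappa>" "sets \<kappa> = sets borel" for \<kappa> :: "'a measure" and j
    using mult_bound_power[OF mult_bound_cf[OF that], of j] by simp
  have summand: "mult_bound (\<lambda>\<xi>. (cf \<mu> \<xi> - cf \<nu> \<xi>) * (cf \<nu> \<xi> ^ (n - Suc i) * cf \<mu> \<xi> ^ i)) (M * K / (sqrt (real n) / 2) ^ q)"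
    if "i < n" for i
  proof -
    have le: "M * (K / sqrt (real m) ^ q) \<le> M * K / (sqrt (real n) / 2) ^ q" if "n \<le> 4 * m" for m
    proof -
      have "sqrt (real n) \<le> sqrt (4 * real m)" using that by simp
      then have "sqrt (real n) / 2 \<le> sqrt (real m)" by (simp add: real_sqrt_mult)
      then have "(sqrt (real n) / 2) ^ q \<le> sqrt (real m) ^ q" by (intro power_mono) auto
      moreover have "0 < m" using that \<open>2 \<le> n\<close> by simp
      ultimately have "M * K / sqrt (real m) ^ q \<le> M * K / (sqrt (real n) / 2) ^ q"
        using \<open>0 \<le> M\<close> \<open>0 \<le> K\<close> \<open>2 \<le> n\<close> by (intro divide_left_mono) auto
      then show ?thesis by simp
    qed
    have step: "mult_bound (\<lambda>\<xi>. (cf \<mu> \<xi> - cf \<nu> \<xi>) * (\<phi> \<xi> ^ m * \<psi> \<xi>)) (M * (K / sqrt (real m) ^ q))"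
      if "smooth_powers \<phi> q K" "1 \<le> m" "mult_bound \<psi> 1" for \<phi> \<psi> :: "'a \<Rightarrow> complex" and m
      unfolding M_def by (rule lindeberg_smoothed_step[OF \<mu> \<nu> moments that])
    show ?thesis
    proof (cases "n - Suc i \<le> i")
      case True
      then have "1 \<le> i" "n \<le> 4 * i" using \<open>2 \<le> n\<close> by auto
      then show ?thesis
        using mult_bound_mono[OF step[OF smooth(1) _ pw[OF \<nu>(1,2), of "n - Suc i"]] le]
        by (simp add: mult.commute)
    next
      case False
      then have "1 \<le> n - Suc i" "n \<le> 4 * (n - Suc i)" using \<open>2 \<le> n\<close> by auto
      then show ?thesis
        using mult_bound_mono[OF step[OF smooth(2) _ pw[OF \<mu>(1,2), of i]] le] by simp
    qed
  qed
  have "mult_bound (\<lambda>\<xi>. \<Sum>i<n. (cf \<mu> \<xi> - cf \<nu> \<xi>) * (cf \<nu> \<xi> ^ (n - Suc i) * cf \<mu> \<xi> ^ i))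
      (\<Sum>i<n. M * K / (sqrt (real n) / 2) ^ q)"
    by (intro mult_bound_sum summand) simp
  moreover have "cf \<mu> \<xi> ^ n - cf \<nu> \<xi> ^ n = (\<Sum>i<n. (cf \<mu> \<xi> - cf \<nu> \<xi>) * (cf \<nu> \<xi> ^ (n - Suc i) * cf \<mu> \<xi> ^ i))" for \<xi>
    by (simp add: power_diff_sumr2 sum_distrib_left)
  ultimately show ?thesis by (simp add: M_def)
qed

section \<open>Trigonometric polynomials detect the total variation distance\<close>

text \<open>
  Wraps space around a torus, whose coordinate functions are trigonometric. Polynomials on the
  torus then are trigonometric polynomials in space.
\<close>

definition torus_map :: "real \<Rightarrow> real^'n \<Rightarrow> (real^'n) \<times> (real^'n)" where
  "torus_map R x = ((\<chi> i. cos (x $ i / R)), (\<chi> i. sin (x $ i / R)))"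

lemma trig_const_ex: "\<exists>L. \<forall>x. c = trig L x"
  by (rule exI[of _ "[(complex_of_real c, 0)]"]) (simp add: trig_Cons)

lemma trig_add_ex: "\<exists>L''. \<forall>x. trig L x + trig L' x = trig L'' x"
  by (metis trig_append)

lemma trig_sum_ex:
  assumes "\<And>i. i \<in> S \<Longrightarrow> \<exists>L. \<forall>x. f i x = trig L x"
  shows "\<exists>L. \<forall>x. (\<Sum>i\<in>S. f i x) = trig L x"
  using assms
proof (induction S rule: infinite_finite_induct)
  case (insert i S)
  then obtain L L' where "\<And>x. f i x = trig L x" "\<And>x. (\<Sum>i\<in>S. f i x) = trig L' x" by (metis insertI1 insertI2)
  with insert trig_add_ex[of L L'] show ?case by simp
qed (auto intro: exI[of _ "[]"])

lemma trig_linear_torus_map: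
  fixes f :: "(real^'n) \<times> (real^'n) \<Rightarrow> real"
  assumes "bounded_linear f"
  shows "\<exists>L. \<forall>x. f (torus_map R x) = trig L x"
proof -
  interpret bounded_linear f by fact
  have eq: "torus_map R x = (\<Sum>i\<in>UNIV. cos (x $ i / R) *\<^sub>R (axis i 1, 0) + sin (x $ i / R) *\<^sub>R (0, axis i 1))" for x :: "real^'n"
  proof -
    have "u = (\<Sum>i\<in>UNIV. u $ i *\<^sub>R axis i 1)" for u :: "real^'n"
      using basis_expansion[of u] by (simp add: scalar_mult_eq_scaleR)
    from this[of "\<chi> i. cos (x $ i / R)"] this[of "\<chi> i. sin (x $ i / R)"]
    show ?thesis by (simp add: torus_map_def prod_eq_iff fst_sum snd_sum)
  qed
  have "\<exists>L. \<forall>x. cos (x $ i / R) * a + sin (x $ i / R) * b = trig L x" for i :: 'n and a b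
    by (rule exI[of _ "[(complex_of_real a, axis i (1 / R)), (- \<i> * complex_of_real b, axis i (1 / R))]"])
      (simp add: trig_Cons inner_axis' mult.commute)
  then show ?thesis
    unfolding eq sum add scaleR real_scaleR_def by (rule trig_sum_ex)
qed

lemma trig_polynomial_torus_map:
  fixes p :: "(real^'n) \<times> (real^'n) \<Rightarrow> real"
  assumes "real_polynomial_function p"
  shows "\<exists>L. \<forall>x. p (torus_map R x) = trig L x"
  using assms
proof induction
  case (linear f)
  then show ?case by (rule trig_linear_torus_map)
next
  case (const c)
  show ?case by (rule trig_const_ex)
next
  case (add f g)
  then show ?case using trig_add_ex by metis
next
  case (mult f g)
  then show ?case using trig_mult_ex by metis
qed

lemma torus_map_inj_on_ball:
  assumes "0 < R"
  shows "inj_on (torus_map R) (ball (0 :: real^'n) R)"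
proof (rule inj_onI)
  fix x y :: "real^'n"
  assume xy: "x \<in> ball 0 R" "y \<in> ball 0 R" "torus_map R x = torus_map R y"
  have small: "- (pi / 2) \<le> z $ i / R \<and> z $ i / R \<le> pi / 2" if "z \<in> ball 0 R" for z :: "real^'n" and i
  proof -
    have "\<bar>z $ i\<bar> < R" using component_le_norm_cart[of z i] that by simp
    then have "- 1 < z $ i / R" "z $ i / R < 1" using assms by (auto simp: abs_less_iff field_simps)
    with pi_gt3 show ?thesis by linarith
  qed
  show "x = y"
  proof (rule vec_eq_iff[THEN iffD2], rule allI)
    fix i
    have "sin (x $ i / R) = sin (y $ i / R)"
      using xy(3) by (simp add: torus_map_def vec_eq_iff)
    then have "x $ i / R = y $ i / R"
      using small[OF xy(1), of i] small[OF xy(2), of i] by (metis arcsin_sin)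
    then show "x $ i = y $ i" using assms by simp
  qed
qed

text \<open>
  For large \<open>R\<close> the two sets have disjoint images on the torus. An Urysohn function for the images
  is approximated uniformly on the whole torus by a polynomial (Stone-Weierstrass); uniformity there
  bounds the trigonometric polynomial on all of space, also far from the two sets.
\<close>

lemma trig_separates_compacts:
  fixes K1 K2 :: "(real^'n) set"
  assumes "compact K1" "compact K2" "K1 \<inter> K2 = {}" "0 < \<eta>"
  shows "\<exists>L. (\<forall>x. \<bar>trig L x\<bar> \<le> 1 + \<eta>) \<and> (\<forall>x\<in>K1. 1 - \<eta> \<le> trig L x) \<and> (\<forall>x\<in>K2. trig L x \<le> - 1 + \<eta>)"
proof -
  have "bounded (K1 \<union> K2)" using assms by (simp add: compact_imp_bounded)
  then obtain R where R: "0 < R" "K1 \<union> K2 \<subseteq> ball 0 R" using bounded_subset_ballD by blast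
  define e where "e = (torus_map R :: real^'n \<Rightarrow> _)"
  have cont: "continuous_on S e" for S
    unfolding e_def torus_map_def using R(1) by (intro continuous_intros) auto
  have disj: "e ` K1 \<inter> e ` K2 = {}"
    using inj_on_image_Int[OF torus_map_inj_on_ball[OF R(1)], of K1 K2] R(2) assms(3) by (simp add: e_def)
  have clo: "closed (e ` K1)" "closed (e ` K2)"
    by (auto intro!: compact_imp_closed compact_continuous_image cont assms)
  have ne: "(1::real) \<noteq> - 1" by simp
  obtain h :: "(real^'n) \<times> (real^'n) \<Rightarrow> real" where h: "continuous_on UNIV h"
      "\<And>z. h z \<in> closed_segment 1 (-1)" "\<And>z. h z = 1 \<longleftrightarrow> z \<in> e ` K1" "\<And>z. h z = -1 \<longleftrightarrow> z \<in> e ` K2"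
    using Urysohn_strong[OF clo disj ne] by blast
  define S where "S = cball (0 :: (real^'n) \<times> (real^'n)) (2 * CARD('n))"
  have e: "e x \<in> S" for x
  proof -
    have "norm (\<chi> i. f (x $ i / R)) \<le> CARD('n)" if "\<And>t. \<bar>f t\<bar> \<le> 1" for f :: "real \<Rightarrow> real"
    proof -
      have "norm (\<chi> i. f (x $ i / R)) \<le> (\<Sum>i\<in>UNIV. \<bar>f (x $ i / R)\<bar>)"
        using norm_le_l1_cart[of "\<chi> i. f (x $ i / R)"] by simp
      also have "\<dots> \<le> (\<Sum>i\<in>(UNIV :: 'n set). 1)" by (intro sum_mono that)
      finally show ?thesis by simp
    qed
    from this[of cos] this[of sin] norm_Pair_le[of "\<chi> i. cos (x $ i / R)" "\<chi> i. sin (x $ i / R)"]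
    show ?thesis by (simp add: S_def e_def torus_map_def)
  qed
  obtain p where p: "real_polynomial_function p" "\<And>z. z \<in> S \<Longrightarrow> \<bar>h z - p z\<bar> < \<eta>"
    using Stone_Weierstrass_real_polynomial_function[of S h \<eta>] assms(4) h(1)
      continuous_on_subset[of UNIV h S] by (auto simp: S_def)
  obtain L where L: "\<And>x. p (e x) = trig L x"
    using trig_polynomial_torus_map[OF p(1), of R] by (auto simp: e_def)
  have close: "\<bar>h (e x) - trig L x\<bar> < \<eta>" for x using p(2)[OF e, of x] by (simp add: L)
  have h1: "\<bar>h z\<bar> \<le> 1" for z using h(2)[of z] by (auto simp: closed_segment_eq_real_ivl)
  have "\<bar>trig L x\<bar> \<le> 1 + \<eta>" for x using close[of x] h1[of "e x"] by linarith
  moreover have "1 - \<eta> \<le> trig L x" if "x \<in> K1" for x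
    using close[of x] h(3)[of "e x"] that by auto
  moreover have "trig L x \<le> - 1 + \<eta>" if "x \<in> K2" for x
    using close[of x] h(4)[of "e x"] that by auto
  ultimately show ?thesis by blast
qed

lemma inner_regular_two_measures:
  fixes P Q :: "'a::euclidean_space measure"
  assumes "finite_measure P" "finite_measure Q" and sets: "sets P = sets borel" "sets Q = sets borel"
    and Y: "Y \<in> sets borel" and "0 < \<eta>"
  shows "\<exists>K. compact K \<and> K \<subseteq> Y \<and> measure P Y - \<eta> \<le> measure P K \<and> measure Q Y - \<eta> \<le> measure Q K"
proof -
  have one: "\<exists>K. compact K \<and> K \<subseteq> Y \<and> measure M Y - \<eta> \<le> measure M K"
    if "finite_measure M" "sets M = sets borel" for M :: "'a measure"
  proof -
    interpret finite_measure M by fact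
    show ?thesis
    proof (cases "measure M Y \<le> \<eta>")
      case True
      then show ?thesis by (intro exI[of _ "{}"]) auto
    next
      case False
      have "ennreal (measure M Y - \<eta>) < emeasure M Y"
        using \<open>0 < \<eta>\<close> False by (simp add: emeasure_eq_measure ennreal_less_iff)
      also have "emeasure M Y = (SUP K\<in>{K. K \<subseteq> Y \<and> compact K}. emeasure M K)"
        by (rule inner_regular) (use that Y in auto)
      finally obtain K where K: "K \<subseteq> Y" "compact K" "ennreal (measure M Y - \<eta>) < emeasure M K"
        by (auto simp: less_SUP_iff)
      then have "measure M Y - \<eta> < measure M K"
        using False by (simp add: emeasure_eq_measure ennreal_less_iff)
      with K show ?thesis by (intro exI[of _ K]) auto
    qed
  qed
  interpret P: finite_measure P by fact
  interpret Q: finite_measure Q by fact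
  obtain K K' where K: "compact K" "K \<subseteq> Y" "measure P Y - \<eta> \<le> measure P K"
    and K': "compact K'" "K' \<subseteq> Y" "measure Q Y - \<eta> \<le> measure Q K'"
    using one[OF assms(1) sets(1)] one[OF assms(2) sets(2)] by blast
  have [simp]: "K \<union> K' \<in> sets borel" using K K' by (auto intro: borel_compact)
  have "measure P K \<le> measure P (K \<union> K')" "measure Q K' \<le> measure Q (K \<union> K')"
    by (auto intro!: P.finite_measure_mono Q.finite_measure_mono simp: sets)
  with K K' show ?thesis by (intro exI[of _ "K \<union> K'"]) auto
qed

text \<open>
  The inequality \<open>Q \<le> P\<close> on subsets of \<open>Y\<close> says that \<open>P\<close> dominates the restriction of \<open>Q\<close> to \<open>Y\<close>.
\<close>

lemma integral_le_on_hahn_set: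
  fixes P Q :: "'a::euclidean_space measure" and h :: "'a \<Rightarrow> real"
  assumes "finite_measure P" "finite_measure Q" and sets: "sets P = sets borel" "sets Q = sets borel"
    and Y: "Y \<in> sets borel" and le: "\<And>X. X \<in> sets borel \<Longrightarrow> X \<subseteq> Y \<Longrightarrow> emeasure Q X \<le> emeasure P X"
    and h: "h \<in> borel_measurable borel" "\<And>x. 0 \<le> h x" "\<And>x. h x \<le> B"
  shows "(\<integral>x. indicator Y x * h x \<partial>Q) \<le> (\<integral>x. indicator Y x * h x \<partial>P)"
proof -
  interpret P: finite_measure P by fact
  interpret Q: finite_measure Q by fact
  note Y[measurable] h(1)[measurable] sets[measurable_cong]
  define \<kappa> where "\<kappa> = density Q (\<lambda>x. ennreal (indicator Y x))"
  have \<kappa>A: "emeasure \<kappa> A = emeasure Q (A \<inter> Y)" if "A \<in> sets borel" for A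
  proof -
    have "emeasure \<kappa> A = (\<integral>\<^sup>+x. ennreal (indicator Y x) * indicator A x \<partial>Q)"
      using that unfolding \<kappa>_def by (subst emeasure_density) (auto simp: sets)
    also have "\<dots> = (\<integral>\<^sup>+x. indicator (A \<inter> Y) x \<partial>Q)"
      by (intro nn_integral_cong) (simp split: split_indicator)
    also have "\<dots> = emeasure Q (A \<inter> Y)" using that Y by (simp add: sets)
    finally show ?thesis .
  qed
  have spc: "space \<kappa> = UNIV" "sets \<kappa> = sets borel"
    using sets_eq_imp_space_eq[OF sets(2)] by (auto simp: \<kappa>_def sets)
  have fin: "finite_measure \<kappa>"
    by (rule finite_measureI) (simp add: spc \<kappa>A)
  have "1 * (\<integral>x. indicator Y x * h x \<partial>\<kappa>) \<le> (\<integral>x. indicator Y x * h x \<partial>P)"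
  proof (rule integral_le_dominating[OF fin assms(1) spc(2) sets(1), where p=1 and B=B])
    show "ennreal 1 * emeasure \<kappa> A \<le> emeasure P A" if A: "A \<in> sets borel" for A
    proof -
      have "emeasure Q (A \<inter> Y) \<le> emeasure P (A \<inter> Y)" using A Y by (intro le) auto
      also have "\<dots> \<le> emeasure P A" using A by (intro emeasure_mono) (auto simp: sets)
      finally show ?thesis using A by (simp add: \<kappa>A)
    qed
    show "indicator Y x * h x \<le> B" for x using h(2,3)[of x] by (auto simp: indicator_def)
  qed (auto simp: h)
  also have "(\<integral>x. indicator Y x * h x \<partial>\<kappa>) = (\<integral>x. indicator Y x * (indicator Y x * h x) \<partial>Q)"
    unfolding \<kappa>_def by (subst integral_density) auto
  also have "\<dots> = (\<integral>x. indicator Y x * h x \<partial>Q)"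
    by (intro Bochner_Integration.integral_cong) (auto simp: indicator_def)
  finally show ?thesis by simp
qed

text \<open>
  Among functions bounded by 1, the difference of the integrals is largest for the function equal
  to 1 on the Hahn set and to \<open>-1\<close> off it, whose value is the right-hand side.
\<close>

lemma integral_diff_le_hahn:
  fixes P Q :: "'a::euclidean_space measure" and f :: "'a \<Rightarrow> real"
  assumes P: "prob_space P" and Q: "prob_space Q" and sets: "sets P = sets borel" "sets Q = sets borel"
    and Y: "Y \<in> sets borel"
    and pos: "\<And>X. X \<in> sets borel \<Longrightarrow> X \<subseteq> Y \<Longrightarrow> emeasure Q X \<le> emeasure P X"
    and neg: "\<And>X. X \<in> sets borel \<Longrightarrow> X \<inter> Y = {} \<Longrightarrow> emeasure P X \<le> emeasure Q X"
    and f: "f \<in> borel_measurable borel" "\<And>x. \<bar>f x\<bar> \<le> 1"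
  shows "(\<integral>x. f x \<partial>P) - (\<integral>x. f x \<partial>Q) \<le> 2 * (measure P Y - measure Q Y)"
proof -
  interpret P: prob_space P by fact
  interpret Q: prob_space Q by fact
  have fin: "finite_measure P" "finite_measure Q" by unfold_locales
  note Y[measurable] f(1)[measurable] sets[measurable_cong]
  have fb: "f x \<le> 1" "- f x \<le> 1" for x using f(2)[of x] by linarith+
  have 1: "(\<integral>x. indicator Y x * (1 - f x) \<partial>Q) \<le> (\<integral>x. indicator Y x * (1 - f x) \<partial>P)"
  proof (rule integral_le_on_hahn_set[OF fin sets Y pos, where B=2])
    show "0 \<le> 1 - f x" "1 - f x \<le> 2" for x using fb[of x] by linarith+
  qed auto
  have 2: "(\<integral>x. indicator (- Y) x * (1 + f x) \<partial>P) \<le> (\<integral>x. indicator (- Y) x * (1 + f x) \<partial>Q)"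
  proof (rule integral_le_on_hahn_set[OF fin(2,1) sets(2,1), where B=2])
    show "emeasure P X \<le> emeasure Q X" if "X \<in> sets borel" "X \<subseteq> - Y" for X
      using that by (intro neg) auto
    show "0 \<le> 1 + f x" "1 + f x \<le> 2" for x using fb[of x] by linarith+
  qed auto
  have split: "(\<integral>x. indicator Y x * (1 - f x) \<partial>M) = measure M Y - (\<integral>x. indicator Y x * f x \<partial>M)"
    "(\<integral>x. indicator (- Y) x * (1 + f x) \<partial>M) = 1 - measure M Y + (\<integral>x. indicator (- Y) x * f x \<partial>M)"
    "(\<integral>x. f x \<partial>M) = (\<integral>x. indicator Y x * f x \<partial>M) + (\<integral>x. indicator (- Y) x * f x \<partial>M)"
    if M: "prob_space M" "sets M = sets borel" for M
  proof -
    interpret prob_space M by fact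
    note M(2)[measurable_cong]
    have spM: "space M = UNIV" using sets_eq_imp_space_eq[OF M(2)] by simp
    have YM: "Y \<in> sets M" "- Y \<in> sets M" using Y by (auto simp: M(2))
    have i: "integrable M (\<lambda>x. indicator A x * f x)" if [measurable]: "A \<in> sets borel" for A
      by (rule integrable_const_bound[of _ 1]) (auto simp: indicator_def f(2))
    have iY: "integrable M (indicator Y :: _ \<Rightarrow> real)" "integrable M (indicator (- Y) :: _ \<Rightarrow> real)"
      using YM by (auto intro!: integrable_real_indicator simp: less_top[symmetric])
    show "(\<integral>x. indicator Y x * (1 - f x) \<partial>M) = measure M Y - (\<integral>x. indicator Y x * f x \<partial>M)"
      using i[OF Y] iY YM by (simp add: right_diff_distrib)
    have "measure M (- Y) = 1 - measure M Y"
      using prob_compl[OF YM(1)] by (simp add: spM Compl_eq_Diff_UNIV)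
    then show "(\<integral>x. indicator (- Y) x * (1 + f x) \<partial>M) = 1 - measure M Y + (\<integral>x. indicator (- Y) x * f x \<partial>M)"
      using i[of "- Y"] iY YM Y by (simp add: distrib_left)
    have "(\<integral>x. f x \<partial>M) = (\<integral>x. indicator Y x * f x + indicator (- Y) x * f x \<partial>M)"
      by (intro Bochner_Integration.integral_cong) (auto simp: indicator_def)
    then show "(\<integral>x. f x \<partial>M) = (\<integral>x. indicator Y x * f x \<partial>M) + (\<integral>x. indicator (- Y) x * f x \<partial>M)"
      using i[OF Y] i[of "- Y"] Y by simp
  qed
  have arith: "a + c - (b + d) \<le> 2 * (p - q)" if "q - b \<le> p - a" "1 - p + c \<le> 1 - q + d"
    for a b c d p q :: real
    using that by argo
  show ?thesis
    using 1 2 unfolding split[OF P sets(1)] split[OF Q sets(2)] by (rule arith)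
qed

lemma trig_test_scaled:
  fixes P Q :: "'a::euclidean_space measure"
  assumes test: "\<And>L. (\<And>x. \<bar>trig L x\<bar> \<le> 1) \<Longrightarrow> \<bar>(\<integral>x. trig L x \<partial>P) - (\<integral>x. trig L x \<partial>Q)\<bar> \<le> \<delta>"
    and L: "\<And>x. \<bar>trig L x\<bar> \<le> B" and "0 < B"
  shows "(\<integral>x. trig L x \<partial>P) - (\<integral>x. trig L x \<partial>Q) \<le> B * \<delta>"
proof -
  define L' where "L' = apply_mult (\<lambda>\<xi>. complex_of_real (1 / B) * 1) L"
  have L': "trig L' x = (1 / B) * trig L x" for x
    unfolding L'_def trig_apply_mult_scale apply_mult_1 ..
  have "\<bar>(\<integral>x. trig L' x \<partial>P) - (\<integral>x. trig L' x \<partial>Q)\<bar> \<le> \<delta>"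
    using L \<open>0 < B\<close> by (intro test) (simp add: L' abs_mult)
  then have "((\<integral>x. trig L x \<partial>P) - (\<integral>x. trig L x \<partial>Q)) / B \<le> \<delta>"
    unfolding L' by (simp add: diff_divide_distrib)
  then show ?thesis using \<open>0 < B\<close> by (simp add: field_simps)
qed

text \<open>
  The function equal to 1 on \<open>Y\<close> and \<open>-1\<close> off it is replaced by a trigonometric polynomial that
  nearly separates compact subsets of \<open>Y\<close> and of its complement with almost full measure. The choice
  of \<open>\<eta>\<close> collects the error \<open>6 \<eta>\<close> of this replacement and the excess \<open>\<eta> \<delta>\<close> from the bound \<open>1 + \<eta>\<close>.
\<close>

lemma measure_diff_le_trig_test:
  fixes P Q :: "(real^'n) measure"
  assumes P: "prob_space P" and Q: "prob_space Q" and sets: "sets P = sets borel" "sets Q = sets borel"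
    and test: "\<And>L. (\<And>x. \<bar>trig L x\<bar> \<le> 1) \<Longrightarrow> \<bar>(\<integral>x. trig L x \<partial>P) - (\<integral>x. trig L x \<partial>Q)\<bar> \<le> \<delta>"
    and Y: "Y \<in> sets borel"
  shows "2 * (measure P Y - measure Q Y) \<le> \<delta>"
proof (rule field_le_epsilon)
  fix e :: real assume "0 < e"
  interpret P: prob_space P by fact
  interpret Q: prob_space Q by fact
  have fin: "finite_measure P" "finite_measure Q" by unfold_locales
  have spc: "space P = UNIV" "space Q = UNIV"
    using sets_eq_imp_space_eq[OF sets(1)] sets_eq_imp_space_eq[OF sets(2)] by auto
  have "0 \<le> \<delta>" using test[of "[]"] by simp
  define \<eta> where "\<eta> = e / (\<delta> + 6)"
  have \<eta>: "0 < \<eta>" "\<eta> * (\<delta> + 6) = e" using \<open>0 < e\<close> \<open>0 \<le> \<delta>\<close> by (auto simp: \<eta>_def)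
  obtain K1 where K1: "compact K1" "K1 \<subseteq> Y" "measure P Y - \<eta> \<le> measure P K1"
    using inner_regular_two_measures[OF fin sets Y \<eta>(1)] by blast
  have "- Y \<in> sets borel" using Y by simp
  then obtain K2 where K2: "compact K2" "K2 \<subseteq> - Y" "measure Q (- Y) - \<eta> \<le> measure Q K2"
    using inner_regular_two_measures[OF fin sets _ \<eta>(1)] by blast
  have Ks: "K1 \<in> sets P" "K2 \<in> sets Q" using K1 K2 by (auto simp: sets intro: borel_compact)
  obtain L where L: "\<And>x. \<bar>trig L x\<bar> \<le> 1 + \<eta>" "\<And>x. x \<in> K1 \<Longrightarrow> 1 - \<eta> \<le> trig L x"
      "\<And>x. x \<in> K2 \<Longrightarrow> trig L x \<le> - 1 + \<eta>"
    using trig_separates_compacts[OF K1(1) K2(1) _ \<eta>(1)] K1(2) K2(2) by blast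
  note iP = integrable_trig[OF fin(1) sets(1), of L 0, simplified]
  note iQ = integrable_trig[OF fin(2) sets(2), of L 0, simplified]
  have Lb: "trig L x \<le> 1 + \<eta>" "- (1 + \<eta>) \<le> trig L x" for x
    using L(1)[of x] by (auto simp: abs_le_iff)
  have iK: "integrable P (indicator K1 :: _ \<Rightarrow> real)" "integrable Q (indicator K2 :: _ \<Rightarrow> real)"
    using Ks by (auto simp: less_top[symmetric])
  have "2 * measure P K1 - (1 + \<eta>) = (\<integral>x. 2 * indicator K1 x - (1 + \<eta>) \<partial>P)"
    using Ks iK by (simp add: P.prob_space[unfolded spc] spc)
  also have "\<dots> \<le> (\<integral>x. trig L x \<partial>P)"
  proof (rule integral_mono)
    show "2 * indicator K1 x - (1 + \<eta>) \<le> trig L x" for x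
      using L(2)[of x] Lb(2)[of x] by (cases "x \<in> K1") auto
  qed (use iP iK in auto)
  finally have 1: "2 * measure P K1 - (1 + \<eta>) \<le> (\<integral>x. trig L x \<partial>P)" .
  have "(\<integral>x. trig L x \<partial>Q) \<le> (\<integral>x. (1 + \<eta>) - 2 * indicator K2 x \<partial>Q)"
  proof (rule integral_mono)
    show "trig L x \<le> (1 + \<eta>) - 2 * indicator K2 x" for x
      using L(3)[of x] Lb(1)[of x] by (cases "x \<in> K2") auto
  qed (use iQ iK in auto)
  also have "\<dots> = (1 + \<eta>) - 2 * measure Q K2"
    using Ks iK by (simp add: Q.prob_space[unfolded spc] spc)
  finally have 2: "(\<integral>x. trig L x \<partial>Q) \<le> (1 + \<eta>) - 2 * measure Q K2" .
  have 3: "(\<integral>x. trig L x \<partial>P) - (\<integral>x. trig L x \<partial>Q) \<le> (1 + \<eta>) * \<delta>"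
    by (rule trig_test_scaled[OF test L(1)]) (use \<eta> in auto)
  have "measure Q (- Y) = 1 - measure Q Y"
    using Q.prob_compl[of Y] Y by (simp add: spc sets Compl_eq_Diff_UNIV)
  then have "2 * (measure P Y - measure Q Y) \<le> (1 + \<eta>) * \<delta> + 6 * \<eta>"
    using 1 2 3 K1(3) K2(3) by argo
  also have "\<dots> = \<delta> + e" using \<eta>(2) by (simp add: algebra_simps)
  finally show "2 * (measure P Y - measure Q Y) \<le> \<delta> + e" .
qed

lemma tv_dist_le_trig_test:
  fixes P Q :: "(real^'n) measure"
  assumes P: "prob_space P" and Q: "prob_space Q" and sets: "sets P = sets borel" "sets Q = sets borel"
    and test: "\<And>L. (\<And>x. \<bar>trig L x\<bar> \<le> 1) \<Longrightarrow> \<bar>(\<integral>x. trig L x \<partial>P) - (\<integral>x. trig L x \<partial>Q)\<bar> \<le> \<delta>"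
  shows "tv_dist P Q \<le> \<delta>"
  unfolding tv_dist_def
proof (rule cSUP_least)
  show "{f \<in> borel_measurable borel. \<forall>x::real^'n. \<bar>f x\<bar> \<le> (1::real)} \<noteq> {}"
    by (auto intro!: exI[of _ "\<lambda>_. 0"])
  have fin: "finite_measure P" "finite_measure Q" using P Q by (auto simp: prob_space_def)
  have "\<exists>Y\<in>sets P. (\<forall>X\<in>sets P. X \<subseteq> Y \<longrightarrow> emeasure Q X \<le> emeasure P X) \<and>
      (\<forall>X\<in>sets P. X \<inter> Y = {} \<longrightarrow> emeasure P X \<le> emeasure Q X)"
    by (rule finite_unsigned_Hahn_decomposition) (auto simp: fin sets)
  then obtain Y where Y0: "Y \<in> sets borel"
      "\<forall>X\<in>sets borel. X \<subseteq> Y \<longrightarrow> emeasure Q X \<le> emeasure P X"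
      "\<forall>X\<in>sets borel. X \<inter> Y = {} \<longrightarrow> emeasure P X \<le> emeasure Q X"
    unfolding sets by (elim bexE conjE)
  note Y = Y0(1) Y0(2)[rule_format] Y0(3)[rule_format]
  fix f :: "real^'n \<Rightarrow> real" assume "f \<in> {f \<in> borel_measurable borel. \<forall>x. \<bar>f x\<bar> \<le> 1}"
  then have f: "f \<in> borel_measurable borel" "\<And>x. \<bar>f x\<bar> \<le> 1" by auto
  note bound = integral_diff_le_hahn[OF P Q sets Y]
  have "2 * (measure P Y - measure Q Y) \<le> \<delta>"
    by (rule measure_diff_le_trig_test[OF P Q sets test Y(1)])
  moreover have "(\<integral>x. f x \<partial>P) - (\<integral>x. f x \<partial>Q) \<le> 2 * (measure P Y - measure Q Y)"
    by (rule bound) (use f in auto)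
  moreover have "(\<integral>x. - f x \<partial>P) - (\<integral>x. - f x \<partial>Q) \<le> 2 * (measure P Y - measure Q Y)"
    by (rule bound) (use f in auto)
  then have "(\<integral>x. f x \<partial>Q) - (\<integral>x. f x \<partial>P) \<le> 2 * (measure P Y - measure Q Y)"
    by (simp only: integral_minus)
  ultimately show "\<bar>(\<integral>x. f x \<partial>P) - (\<integral>x. f x \<partial>Q)\<bar> \<le> \<delta>"
    by linarith
qed

lemma tv_dist_le_2:
  fixes P Q :: "(real^'n) measure"
  assumes P: "prob_space P" and Q: "prob_space Q" and sets: "sets P = sets borel" "sets Q = sets borel"
  shows "tv_dist P Q \<le> 2"
proof (rule tv_dist_le_trig_test[OF P Q sets])
  interpret P: prob_space P by fact
  interpret Q: prob_space Q by fact
  have fin: "finite_measure P" "finite_measure Q" by unfold_locales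
  fix L :: "(complex \<times> (real^'n)) list" assume L: "\<And>x. \<bar>trig L x\<bar> \<le> 1"
  have "\<bar>\<integral>x. trig L x \<partial>P\<bar> \<le> 1" "\<bar>\<integral>x. trig L x \<partial>Q\<bar> \<le> 1"
    using mult_boundD[OF mult_bound_cf[OF P sets(1)] L, of 0] mult_boundD[OF mult_bound_cf[OF Q sets(2)] L, of 0]
    by (simp_all add: trig_apply_mult_cf fin sets)
  then show "\<bar>(\<integral>x. trig L x \<partial>P) - (\<integral>x. trig L x \<partial>Q)\<bar> \<le> 2" by linarith
qed

section \<open>The standard Gaussian law\<close>

text \<open>
  Fubini for product functions, transported from the product measure indexed by the basis vectors.
\<close>

lemma lborel_product_integral:
  fixes h :: "'n::finite \<Rightarrow> real \<Rightarrow> 'b::{real_normed_field, banach, second_countable_topology}"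
  assumes int: "\<And>i. integrable lborel (h i)"
  shows "integrable lborel (\<lambda>x::real^'n. \<Prod>i\<in>UNIV. h i (x $ i))" (is ?I)
    and "(\<integral>x. (\<Prod>i\<in>UNIV. h i (x $ i)) \<partial>lborel) = (\<Prod>i\<in>UNIV. \<integral>t. h i t \<partial>lborel)" (is ?E)
proof -
  interpret product_sigma_finite "\<lambda>_::real^'n. lborel :: real measure"
    by standard
  have [measurable]: "h i \<in> borel_measurable borel" for i
    using borel_measurable_integrable[OF int[of i]] by simp
  define ax :: "'n \<Rightarrow> real^'n" where "ax i = axis i 1" for i
  have inj: "inj ax" by (auto simp: inj_on_def ax_def axis_eq_axis)
  have B: "Basis = range ax" by (auto simp: Basis_vec_def ax_def)
  define h' where "h' b = h (inv ax b)" for b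
  have h': "h' (ax i) = h i" for i by (simp add: h'_def inj)
  have reindex: "(\<Prod>b\<in>Basis. g b) = (\<Prod>i\<in>UNIV. g (ax i))" for g :: "_ \<Rightarrow> 'b"
    unfolding B using inj by (rule prod.reindex_cong) auto
  have comp: "(\<Sum>b\<in>Basis. f b *\<^sub>R b) $ i = f (ax i)" for f i
  proof -
    have "(\<Sum>b\<in>Basis. f b *\<^sub>R b) $ i = (\<Sum>b\<in>Basis. f b *\<^sub>R b) \<bullet> ax i"
      by (simp add: ax_def inner_axis)
    also have "\<dots> = f (ax i)"
      by (rule inner_sum_left_Basis) (simp add: B)
    finally show ?thesis .
  qed
  have int': "integrable lborel (h' b)" for b by (simp add: h'_def int)
  have eq: "(\<Prod>i\<in>UNIV. h i ((\<Sum>b\<in>Basis. f b *\<^sub>R b) $ i)) = (\<Prod>b\<in>Basis. h' b (f b))" for f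
    by (simp only: comp reindex h')
  have meas: "(\<lambda>x::real^'n. \<Prod>i\<in>UNIV. h i (x $ i)) \<in> borel_measurable borel" by measurable
  have sum_meas: "(\<lambda>f. \<Sum>b\<in>Basis. f b *\<^sub>R b) \<in> measurable (\<Pi>\<^sub>M b\<in>(Basis :: (real^'n) set). lborel) borel"
    by measurable
  have "integrable (\<Pi>\<^sub>M b\<in>(Basis :: (real^'n) set). lborel) (\<lambda>f. \<Prod>i\<in>UNIV. h i ((\<Sum>b\<in>Basis. f b *\<^sub>R b) $ i))"
    unfolding eq by (intro product_integrable_prod int') auto
  then show ?I
    by (subst lborel_eq, subst integrable_distr_eq[OF sum_meas meas])
  have "(\<integral>x. (\<Prod>i\<in>UNIV. h i (x $ i)) \<partial>lborel)
      = (\<integral>f. (\<Prod>i\<in>UNIV. h i ((\<Sum>b\<in>Basis. f b *\<^sub>R b) $ i)) \<partial>(\<Pi>\<^sub>M b\<in>(Basis :: (real^'n) set). lborel))"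
    by (subst lborel_eq, subst integral_distr[OF sum_meas meas]) (rule refl)
  also have "\<dots> = (\<Prod>b\<in>Basis. \<integral>t. h' b t \<partial>lborel)"
    unfolding eq by (intro product_integral_prod int') auto
  also have "\<dots> = (\<Prod>i\<in>UNIV. \<integral>t. h i t \<partial>lborel)"
    by (simp only: reindex h')
  finally show ?E .
qed

lemma std_gaussian_product_integral:
  fixes f :: "'n::finite \<Rightarrow> real \<Rightarrow> 'b::{real_normed_field, banach, second_countable_topology}"
  assumes int: "\<And>i. integrable std_normal_distribution (f i)"
  shows "integrable (std_gaussian :: (real^'n) measure) (\<lambda>x. \<Prod>i\<in>UNIV. f i (x $ i))" (is ?I)
    and "(\<integral>x. (\<Prod>i\<in>UNIV. f i (x $ i)) \<partial>(std_gaussian :: (real^'n) measure))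
           = (\<Prod>i\<in>UNIV. \<integral>t. f i t \<partial>std_normal_distribution)" (is ?E)
proof -
  have [measurable]: "f i \<in> borel_measurable borel" for i
    using borel_measurable_integrable[OF int[of i]] by simp
  have nn: "0 \<le> (\<Prod>i\<in>UNIV. std_normal_density (x $ i))" for x :: "real^'n"
    by (intro prod_nonneg) (simp add: normal_density_nonneg)
  define h where "h i t = std_normal_density t *\<^sub>R f i t" for i t
  have h: "integrable lborel (h i)" "(\<integral>t. h i t \<partial>lborel) = (\<integral>t. f i t \<partial>std_normal_distribution)" for i
    using int[of i] unfolding h_def
    by (auto simp: integrable_density integral_density normal_density_nonneg)
  have eq: "(\<Prod>i\<in>UNIV. std_normal_density (x $ i)) *\<^sub>R (\<Prod>i\<in>UNIV. f i (x $ i)) = (\<Prod>i\<in>UNIV. h i (x $ i))"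
    for x :: "real^'n"
    by (simp add: h_def scaleR_conv_of_real prod.distrib)
  show ?I unfolding std_gaussian_def
    by (subst integrable_density) (auto simp: nn eq intro!: lborel_product_integral(1) h)
  show ?E unfolding std_gaussian_def
    by (subst integral_density) (auto simp: nn eq lborel_product_integral(2) h)
qed

lemma sets_std_gaussian [simp]: "sets std_gaussian = sets borel"
  by (simp add: std_gaussian_def)

lemma space_std_gaussian [simp]: "space std_gaussian = UNIV"
  by (simp add: std_gaussian_def)

lemma prob_space_std_gaussian: "prob_space (std_gaussian :: (real^'n) measure)"
proof -
  interpret N: real_distribution std_normal_distribution by (rule real_dist_normal_dist)
  have 1: "integrable (std_gaussian :: (real^'n) measure) (\<lambda>x. 1 :: real)"
    "(\<integral>x. 1 \<partial>(std_gaussian :: (real^'n) measure)) = (1 :: real)"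
    using std_gaussian_product_integral[of "\<lambda>(i::'n) t. 1 :: real"] N.prob_space by auto
  then have fin: "finite_measure (std_gaussian :: (real^'n) measure)"
    by (auto intro!: finite_measureI simp: integrable_iff_bounded)
  interpret finite_measure "std_gaussian :: (real^'n) measure" by fact
  show ?thesis
    using 1(2) by (intro prob_spaceI) (simp add: emeasure_eq_measure)
qed

lemma cf_std_gaussian: "cf std_gaussian \<xi> = complex_of_real (exp (- (norm \<xi>)\<^sup>2 / 2))"
proof -
  interpret N: real_distribution std_normal_distribution by (rule real_dist_normal_dist)
  have cis: "cis (\<xi> \<bullet> x) = (\<Prod>i\<in>UNIV. cis (\<xi> $ i * x $ i))" for x
    by (simp add: cis_conv_exp inner_vec_def exp_sum[symmetric] sum_distrib_left)
  have int: "integrable std_normal_distribution (\<lambda>t. cis (s * t))" for s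
    by (rule N.integrable_const_bound[of _ 1]) (auto intro!: borel_measurable_continuous_onI continuous_intros)
  have "(\<integral>t. cis (s * t) \<partial>std_normal_distribution) = complex_of_real (exp (- s\<^sup>2 / 2))" for s
    using fun_cong[OF char_std_normal_distribution, of s] by (simp add: char_def cis_conv_exp)
  then have "cf std_gaussian \<xi> = (\<Prod>i\<in>UNIV. complex_of_real (exp (- (\<xi> $ i)\<^sup>2 / 2)))"
    unfolding cf_def cis by (subst std_gaussian_product_integral(2)) (auto simp: int)
  also have "\<dots> = complex_of_real (exp (\<Sum>i\<in>UNIV. - (\<xi> $ i)\<^sup>2 / 2))"
    by (simp add: exp_sum)
  also have "(\<Sum>i\<in>UNIV. - (\<xi> $ i)\<^sup>2 / 2) = - (norm \<xi>)\<^sup>2 / 2"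
  proof -
    have "(norm \<xi>)\<^sup>2 = (\<Sum>i\<in>UNIV. (\<xi> $ i)\<^sup>2)"
      unfolding power2_norm_eq_inner inner_vec_def by (simp add: power2_eq_square)
    then show ?thesis by (simp add: sum_divide_distrib[symmetric] sum_negf)
  qed
  finally show ?thesis .
qed

lemma cf_std_gaussian_stable:
  assumes "1 \<le> n"
  shows "cf std_gaussian ((1 / sqrt (real n)) *\<^sub>R \<xi>) ^ n = cf std_gaussian \<xi>"
proof -
  have "real n * ((norm ((1 / sqrt (real n)) *\<^sub>R \<xi>))\<^sup>2 / 2) = (norm \<xi>)\<^sup>2 / 2"
    using assms by (simp add: power_divide power_mult_distrib)
  then show ?thesis
    unfolding cf_std_gaussian of_real_power[symmetric] exp_of_nat_mult[symmetric] by simp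
qed

lemma integrable_norm_power_std_gaussian:
  "integrable (std_gaussian :: (real^'n) measure) (\<lambda>x. norm x ^ q)"
proof -
  interpret N: real_distribution std_normal_distribution by (rule real_dist_normal_dist)
  let ?G = "std_gaussian :: (real^'n) measure"
  have i: "integrable ?G (\<lambda>x. \<bar>x $ i\<bar> ^ q)" for i
  proof -
    have "integrable ?G (\<lambda>x. \<Prod>k\<in>UNIV. if k = i then \<bar>x $ k\<bar> ^ q else 1)"
    proof (rule std_gaussian_product_integral(1)[of "\<lambda>k t. if k = i then \<bar>t\<bar> ^ q else 1"])
      show "integrable std_normal_distribution (\<lambda>t. if k = i then \<bar>t\<bar> ^ q else 1)" for k
        by (cases "k = i")
          (simp_all add: power_abs[symmetric] integrable_std_normal_distribution_moment)
    qed
    then show ?thesis by (simp add: prod.delta)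
  qed
  show ?thesis
  proof (rule Bochner_Integration.integrable_bound)
    show "integrable ?G (\<lambda>x. real CARD('n) ^ q * (\<Sum>i\<in>UNIV. \<bar>x $ i\<bar> ^ q))"
      by (intro integrable_mult_right Bochner_Integration.integrable_sum i)
    have "norm x ^ q \<le> real CARD('n) ^ q * (\<Sum>i\<in>UNIV. \<bar>x $ i\<bar> ^ q)" for x :: "real^'n"
    proof -
      define m where "m = Max (range (\<lambda>i. \<bar>x $ i\<bar>))"
      have m: "\<bar>x $ i\<bar> \<le> m" for i unfolding m_def by (rule Max_ge) auto
      have "m \<in> range (\<lambda>i. \<bar>x $ i\<bar>)" unfolding m_def by (rule Max_in) auto
      then obtain k where k: "m = \<bar>x $ k\<bar>" by blast
      have "norm x \<le> (\<Sum>i\<in>UNIV. \<bar>x $ i\<bar>)" by (rule norm_le_l1_cart)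
      also have "\<dots> \<le> (\<Sum>i\<in>(UNIV :: 'n set). m)" by (intro sum_mono m)
      finally have "norm x ^ q \<le> (real CARD('n) * m) ^ q" by (intro power_mono) auto
      also have "\<dots> = real CARD('n) ^ q * \<bar>x $ k\<bar> ^ q" by (simp add: power_mult_distrib k)
      also have "\<dots> \<le> real CARD('n) ^ q * (\<Sum>i\<in>UNIV. \<bar>x $ i\<bar> ^ q)"
        by (intro mult_left_mono member_le_sum) auto
      finally show ?thesis .
    qed
    then show "AE x in ?G. norm (norm x ^ q) \<le> norm (real CARD('n) ^ q * (\<Sum>i\<in>UNIV. \<bar>x $ i\<bar> ^ q))"
      by (auto intro: order_trans[OF _ abs_ge_self])
  qed (simp add: std_gaussian_def)
qed

text \<open>
  A product integral whose factors are 1 except at the coordinates \<open>i\<close> and \<open>j\<close>.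
\<close>

lemma std_gaussian_covariance:
  "(\<integral>x. x $ i * x $ j \<partial>(std_gaussian :: (real^'n) measure)) = (if i = j then 1 else 0)"
proof -
  interpret N: real_distribution std_normal_distribution by (rule real_dist_normal_dist)
  have m1: "(\<integral>t. t \<partial>std_normal_distribution) = 0"
    using integral_std_normal_distribution_moment_odd[of 1] by simp
  have m2: "(\<integral>t. t * t \<partial>std_normal_distribution) = 1"
    using std_normal_distribution_even_moments(1)[of 1] by (simp add: power2_eq_square fact_numeral)
  have i1: "integrable std_normal_distribution (\<lambda>t. t)"
    using integrable_std_normal_distribution_moment[of 1] by simp
  have i2: "integrable std_normal_distribution (\<lambda>t. t * t)"
    using integrable_std_normal_distribution_moment[of 2] by (simp add: power2_eq_square)
  define f where "f k t = (if k = i then t else 1) * (if k = j then t else 1 :: real)" for k t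
  have int: "integrable std_normal_distribution (f k)" for k
    by (cases "k = i"; cases "k = j") (auto simp: f_def[abs_def] i1 i2)
  have "x $ i * x $ j = (\<Prod>k\<in>UNIV. f k (x $ k))" for x :: "real^'n"
    by (simp add: f_def prod.distrib prod.delta)
  then have "(\<integral>x. x $ i * x $ j \<partial>(std_gaussian :: (real^'n) measure)) = (\<Prod>k\<in>UNIV. \<integral>t. f k t \<partial>std_normal_distribution)"
    by (simp add: std_gaussian_product_integral(2)[OF int])
  also have "\<dots> = (if i = j then 1 else 0)"
  proof (cases "i = j")
    case True
    have "(\<integral>t. f k t \<partial>std_normal_distribution) = 1" for k
      using m2 N.prob_space True by (cases "k = j") (simp_all add: f_def)
    with True show ?thesis by simp
  next
    case False
    then have "(\<integral>t. f i t \<partial>std_normal_distribution) = 0" using m1 by (simp add: f_def)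
    with False show ?thesis by (auto intro: prod_zero)
  qed
  finally show ?thesis .
qed

text \<open>
  In the unit ball every coordinate is at most 1 in absolute value, and the density decreases in
  the absolute values of the coordinates.
\<close>

lemma dominates_leb_std_gaussian:
  "dominates_leb (std_gaussian :: (real^'n) measure) (std_normal_density 1 ^ CARD('n)) (ball 0 1)"
  unfolding dominates_leb_def
proof (intro conjI ballI)
  fix A :: "(real^'n) set" assume [measurable]: "A \<in> sets borel"
  have le: "std_normal_density 1 ^ CARD('n) \<le> (\<Prod>i\<in>UNIV. std_normal_density (x $ i))" if "x \<in> ball 0 1" for x :: "real^'n"
  proof -
    have "std_normal_density 1 \<le> std_normal_density (x $ i)" for i
    proof -
      have "\<bar>x $ i\<bar> \<le> 1" using component_le_norm_cart[of x i] that by simp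
      then have "(x $ i)\<^sup>2 \<le> 1" by (simp add: abs_square_le_1)
      then show ?thesis by (simp add: normal_density_def divide_right_mono)
    qed
    then have "(\<Prod>i\<in>(UNIV :: 'n set). std_normal_density 1) \<le> (\<Prod>i\<in>UNIV. std_normal_density (x $ i))"
      by (intro prod_mono) (auto simp: normal_density_nonneg)
    then show ?thesis by simp
  qed
  have "ennreal (std_normal_density 1 ^ CARD('n)) * emeasure lborel (A \<inter> ball 0 1)
      = (\<integral>\<^sup>+x. ennreal (std_normal_density 1 ^ CARD('n)) * indicator (A \<inter> ball 0 1) x \<partial>lborel)"
    by (subst nn_integral_cmult_indicator) auto
  also have "\<dots> \<le> (\<integral>\<^sup>+x. ennreal (\<Prod>i\<in>UNIV. std_normal_density (x $ i)) * indicator A x \<partial>lborel)"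
    using le by (intro nn_integral_mono) (auto simp: ennreal_leI split: split_indicator)
  also have "\<dots> = emeasure std_gaussian A"
    unfolding std_gaussian_def by (rule emeasure_density[symmetric]) auto
  finally show "ennreal (std_normal_density 1 ^ CARD('n)) * emeasure lborel (A \<inter> ball 0 1) \<le> emeasure std_gaussian A" .
qed (auto simp: normal_density_pos)

section \<open>Eigenvalues and whitening\<close>

lemma adjoint_matrix_vector: "\<xi> \<bullet> (A *v y) = (transpose A *v \<xi>) \<bullet> y" for A :: "real^'n^'n"
  by (metis dot_lmul_matrix transpose_matrix_vector)

text \<open>
  A nonnegative quadratic form is minimal at its null vectors, hence has vanishing gradient there.
  A nonzero \<open>u = Q v\<close> would make the form negative at \<open>v - t u\<close> for small positive \<open>t\<close>.
\<close>

lemma psd_form_null: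
  fixes Q :: "'a::real_inner \<Rightarrow> 'a"
  assumes lin: "linear Q" and sym: "\<And>x y. x \<bullet> Q y = Q x \<bullet> y" and psd: "\<And>x. 0 \<le> x \<bullet> Q x"
    and null: "v \<bullet> Q v = 0"
  shows "Q v = 0"
proof (rule ccontr)
  assume "Q v \<noteq> 0"
  define u where "u = Q v"
  define a where "a = u \<bullet> u"
  define b where "b = u \<bullet> Q u"
  have a: "0 < a" using \<open>Q v \<noteq> 0\<close> by (simp add: a_def u_def)
  have b: "0 \<le> b" unfolding b_def by (rule psd)
  have vQu: "v \<bullet> Q u = a" unfolding a_def using sym[of v u] by (simp add: u_def)
  have "0 \<le> (v - t *\<^sub>R u) \<bullet> Q (v - t *\<^sub>R u)" for t by (rule psd)
  also have "(v - t *\<^sub>R u) \<bullet> Q (v - t *\<^sub>R u) = t * (t * b - 2 * a)" for t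
    using null vQu
    by (simp add: linear_diff[OF lin] linear_cmul[OF lin] inner_diff_left inner_diff_right u_def[symmetric]
        a_def[symmetric] b_def[symmetric] algebra_simps)
  finally have pos: "0 \<le> t * (t * b - 2 * a)" for t .
  define t where "t = a / (b + 1)"
  have "0 < t" using a b by (simp add: t_def)
  moreover have "t * b - 2 * a < 0"
  proof -
    have "t * b \<le> a" using a b by (simp add: t_def field_simps)
    with a show ?thesis by linarith
  qed
  ultimately have "t * (t * b - 2 * a) < 0" by (rule mult_pos_neg)
  with pos[of t] show False by simp
qed

text \<open>
  The maximum \<open>l\<close> of the quadratic form on the unit sphere is an eigenvalue: its maximizer is a null
  vector of the nonnegative form of \<open>l - S\<close>.
\<close>

lemma symmetric_matrix_max_eigval:
  fixes S :: "real^'n^'n"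
  assumes sym: "transpose S = S"
  shows "\<exists>l\<in>eigvals S. \<forall>x. x \<bullet> (S *v x) \<le> l * (norm x)\<^sup>2"
proof -
  define q where "q x = x \<bullet> (S *v x)" for x
  have "continuous_on (sphere 0 1) q"
    unfolding q_def by (intro continuous_intros linear_continuous_on_compose matrix_vector_mul_linear)
  moreover have "sphere (0 :: real^'n) 1 \<noteq> {}" by simp
  ultimately obtain v where v: "v \<in> sphere 0 1" "\<And>x. x \<in> sphere 0 1 \<Longrightarrow> q x \<le> q v"
    using continuous_attains_sup[of "sphere 0 1" q] by auto
  define l where "l = q v"
  have le: "q x \<le> l * (norm x)\<^sup>2" for x
  proof (cases "x = 0")
    case False
    have "q x = (norm x)\<^sup>2 * q (x /\<^sub>R norm x)"
      using False by (simp add: q_def matrix_vector_mult_scaleR power2_eq_square field_simps)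
    also have "\<dots> \<le> (norm x)\<^sup>2 * l"
      unfolding l_def using False by (intro mult_left_mono v(2)) auto
    finally show ?thesis by (simp add: mult.commute)
  qed (simp add: q_def)
  define Q where "Q x = l *\<^sub>R x - S *v x" for x
  have "Q v = 0"
  proof (rule psd_form_null[where Q = Q])
    show "linear Q"
      unfolding Q_def[abs_def] by (intro linear_compose_sub linear_scale_self matrix_vector_mul_linear)
    show "x \<bullet> Q y = Q x \<bullet> y" for x y
      using adjoint_matrix_vector[of x S y] sym by (simp add: Q_def inner_diff_left inner_diff_right)
    show "0 \<le> x \<bullet> Q x" for x
      using le[of x] by (simp add: Q_def q_def inner_diff_right power2_norm_eq_inner)
    show "v \<bullet> Q v = 0"
      using v(1) by (simp add: Q_def inner_diff_right l_def q_def norm_eq_1)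
  qed
  then have "l \<in> eigvals S" using v(1) by (auto simp: eigvals_def Q_def intro!: exI[of _ v])
  with le show ?thesis by (auto simp: q_def)
qed

lemma symmetric_matrix_min_eigval:
  fixes S :: "real^'n^'n"
  assumes sym: "transpose S = S"
  shows "\<exists>l\<in>eigvals S. \<forall>x. l * (norm x)\<^sup>2 \<le> x \<bullet> (S *v x)"
proof -
  have neg: "(- S) *v x = - (S *v x)" for x
    by (simp add: matrix_vector_mult_def vec_eq_iff sum_negf)
  have "transpose (- S) = - S" using sym by (simp add: transpose_def vec_eq_iff)
  from symmetric_matrix_max_eigval[OF this] obtain l where l: "l \<in> eigvals (- S)" "\<And>x. x \<bullet> ((- S) *v x) \<le> l * (norm x)\<^sup>2"
    by blast
  have "- l \<in> eigvals S" using l(1) by (auto simp: eigvals_def neg) (metis neg_equal_iff_equal minus_minus scaleR_minus_left)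
  moreover have "- l * (norm x)\<^sup>2 \<le> x \<bullet> (S *v x)" for x using l(2)[of x] by (simp add: neg)
  ultimately show ?thesis by blast
qed

text \<open>
  Eigenvectors for different eigenvalues are orthogonal. Finiteness makes the minimum and maximum
  of the set of eigenvalues meaningful.
\<close>

lemma finite_eigvals_symmetric:
  fixes S :: "real^'n^'n"
  assumes sym: "transpose S = S"
  shows "finite (eigvals S)"
proof -
  define w where "w l = (SOME v. v \<noteq> 0 \<and> S *v v = l *\<^sub>R v)" for l
  have w: "w l \<noteq> 0" "S *v w l = l *\<^sub>R w l" if "l \<in> eigvals S" for l
    using someI_ex[of "\<lambda>v. v \<noteq> 0 \<and> S *v v = l *\<^sub>R v"] that by (auto simp: eigvals_def w_def)
  have orth: "w l \<bullet> w m = 0" if "l \<in> eigvals S" "m \<in> eigvals S" "l \<noteq> m" for l m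
    using adjoint_matrix_vector[of "w l" S "w m"] sym w[OF that(1)] w[OF that(2)] that(3) by simp
  have "inj_on w (eigvals S)"
  proof (rule inj_onI)
    fix l m assume *: "l \<in> eigvals S" "m \<in> eigvals S" "w l = w m"
    show "l = m" using orth[OF *(1,2)] w(1)[OF *(1)] *(3) by auto
  qed
  moreover have "finite (w ` eigvals S)"
  proof -
    have "pairwise orthogonal (w ` eigvals S)"
      using orth by (auto simp: pairwise_def orthogonal_def)
    then have "independent (w ` eigvals S)"
      by (rule pairwise_orthogonal_independent) (use w in auto)
    then show ?thesis by (rule independent_imp_finite)
  qed
  ultimately show ?thesis by (rule finite_imageD[rotated])
qed

lemma matrix_inv_eq:
  fixes C B :: "real^'n^'n"
  assumes "C ** B = mat 1"
  shows "matrix_inv C = B"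
proof -
  have BC: "B ** C = mat 1" using assms matrix_left_right_inverse by blast
  have inv: "C ** matrix_inv C = mat 1"
    using someI[of "\<lambda>A'. C ** A' = mat 1 \<and> A' ** C = mat 1" B] assms BC
    unfolding matrix_inv_def by blast
  have "matrix_inv C = (B ** C) ** matrix_inv C" by (simp add: BC)
  also have "\<dots> = B" by (simp add: inv flip: matrix_mul_assoc)
  finally show ?thesis .
qed

text \<open>
  From \<open>A C A\<^sup>T = 1\<close> follows \<open>C\<^sup>-\<^sup>1 = A\<^sup>T A\<close>, so that \<open>x \<bullet> C\<^sup>-\<^sup>1 x = |A x|\<^sup>2\<close>, and the inverse of \<open>A\<close> is \<open>C A\<^sup>T\<close>.
\<close>

lemma whitening_matrix_bounds:
  fixes A C :: "real^'n^'n"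
  assumes white: "A ** C ** transpose A = mat 1"
  defines "lo \<equiv> Min (eigvals (matrix_inv C))" and "hi \<equiv> Max (eigvals (matrix_inv C))"
  shows "0 < lo" and "lo * (norm x)\<^sup>2 \<le> (norm (A *v x))\<^sup>2" and "(norm (A *v x))\<^sup>2 \<le> hi * (norm x)\<^sup>2"
    and "A *v (C ** transpose A *v y) = y"
proof -
  have r: "A ** (C ** transpose A) = mat 1" using white by (simp add: matrix_mul_assoc)
  then have l: "C ** transpose A ** A = mat 1" using matrix_left_right_inverse by blast
  show "A *v (C ** transpose A *v y) = y" by (simp add: matrix_vector_mul_assoc r)
  define S where "S = transpose A ** A"
  have S: "matrix_inv C = S"
    unfolding S_def using l by (intro matrix_inv_eq) (simp add: matrix_mul_assoc)
  have sym: "transpose S = S" by (simp add: S_def matrix_transpose_mul)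
  have quad: "x \<bullet> (S *v x) = (norm (A *v x))\<^sup>2" for x
    by (simp add: S_def power2_norm_eq_inner adjoint_matrix_vector inner_commute transpose_transpose flip: matrix_vector_mul_assoc)
  note fin = finite_eigvals_symmetric[OF sym]
  obtain l1 where l1: "l1 \<in> eigvals S" "\<And>x. l1 * (norm x)\<^sup>2 \<le> x \<bullet> (S *v x)"
    using symmetric_matrix_min_eigval[OF sym] by blast
  obtain l2 where l2: "l2 \<in> eigvals S" "\<And>x. x \<bullet> (S *v x) \<le> l2 * (norm x)\<^sup>2"
    using symmetric_matrix_max_eigval[OF sym] by blast
  have "lo \<le> l1" unfolding lo_def S using fin l1(1) by (rule Min_le)
  then have "lo * (norm x)\<^sup>2 \<le> l1 * (norm x)\<^sup>2" by (rule mult_right_mono) simp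
  with l1(2)[of x] show "lo * (norm x)\<^sup>2 \<le> (norm (A *v x))\<^sup>2" by (simp add: quad)
  have "l2 \<le> hi" unfolding hi_def S using fin l2(1) by (rule Max_ge)
  then have "l2 * (norm x)\<^sup>2 \<le> hi * (norm x)\<^sup>2" by (rule mult_right_mono) simp
  with l2(2)[of x] show "(norm (A *v x))\<^sup>2 \<le> hi * (norm x)\<^sup>2" by (simp add: quad)
  have "lo \<in> eigvals S" unfolding lo_def S using fin l1(1) by (intro Min_in) auto
  then obtain v where v: "v \<noteq> 0" "S *v v = lo *\<^sub>R v" by (auto simp: eigvals_def)
  have "A *v v \<noteq> 0"
  proof
    assume "A *v v = 0"
    then have "(C ** transpose A ** A) *v v = 0" by (simp flip: matrix_vector_mul_assoc)
    with v(1) show False by (simp add: l)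
  qed
  then have "0 < (norm (A *v v))\<^sup>2" by simp
  also have "\<dots> = lo * (norm v)\<^sup>2" using quad[of v] v(2) by (simp add: power2_norm_eq_inner)
  finally show "0 < lo" using v(1) by (simp add: zero_less_mult_iff)
qed

section \<open>Moments and characteristic functions of the normalized sum\<close>

lemma (in finite_measure) integrable_component_product:
  fixes Y :: "'a \<Rightarrow> real^'n"
  assumes [measurable]: "Y \<in> borel_measurable M"
    and int: "integrable M (\<lambda>y. norm (Y y) ^ q)" and "m \<le> q"
  shows "integrable M (\<lambda>y. \<Prod>l=1..m. Y y $ \<alpha> l)"
proof (rule Bochner_Integration.integrable_bound)
  show "integrable M (\<lambda>y. 1 + norm (Y y) ^ q)"
    using int by (intro Bochner_Integration.integrable_add) auto
  have "\<bar>\<Prod>l=1..m. z $ \<alpha> l\<bar> \<le> 1 + norm z ^ q" for z :: "real^'n"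
  proof -
    have "\<bar>\<Prod>l=1..m. z $ \<alpha> l\<bar> = (\<Prod>l=1..m. \<bar>z $ \<alpha> l\<bar>)" by (rule abs_prod)
    also have "\<dots> \<le> (\<Prod>l=1..m. norm z)" by (intro prod_mono) (simp add: component_le_norm_cart)
    also have "\<dots> = norm z ^ m" by simp
    also have "\<dots> \<le> 1 + norm z ^ q" using \<open>m \<le> q\<close> by (intro power_le_one_plus_power) auto
    finally show ?thesis .
  qed
  then show "AE y in M. norm (\<Prod>l=1..m. Y y $ \<alpha> l) \<le> norm (1 + norm (Y y) ^ q)"
    by (auto intro: order_trans[OF _ abs_ge_self])
  show "(\<lambda>y. \<Prod>l=1..m. Y y $ \<alpha> l) \<in> borel_measurable M"
    by (intro borel_measurable_prod measurable_compose[OF assms(1)] borel_measurable_continuous_onI continuous_intros)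
qed

lemma inner_power_expand:
  fixes \<xi> z :: "real^'n"
  shows "(\<xi> \<bullet> z) ^ m = (\<Sum>\<alpha>\<in>PiE {1..m} (\<lambda>_. UNIV). (\<Prod>l=1..m. \<xi> $ \<alpha> l) * (\<Prod>l=1..m. z $ \<alpha> l))"
proof -
  have "(\<xi> \<bullet> z) ^ m = (\<Prod>l=1..m. \<Sum>i\<in>UNIV. \<xi> $ i * z $ i)"
    by (simp add: inner_vec_def)
  also have "\<dots> = (\<Sum>\<alpha>\<in>PiE {1..m} (\<lambda>_. UNIV). \<Prod>l=1..m. \<xi> $ \<alpha> l * z $ \<alpha> l)"
    by (rule prod_sum_PiE) auto
  finally show ?thesis by (simp add: prod.distrib)
qed

text \<open>
  Expanding the power of the inner product writes it as a combination of the monomials whose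
  moments are assumed to agree.
\<close>

lemma gaussian_moments_inner_power:
  fixes X :: "'a \<Rightarrow> real^'n"
  assumes "finite_measure M" "X \<in> borel_measurable M" "integrable M (\<lambda>\<omega>. norm (X \<omega>) ^ q)"
    and moments: "gaussian_moments_upto r M X" and j: "j \<le> r" "j \<le> q"
  shows "(\<integral>\<omega>. (\<xi> \<bullet> X \<omega>) ^ j \<partial>M) = (\<integral>x. (\<xi> \<bullet> x) ^ j \<partial>std_gaussian)"
proof -
  interpret finite_measure M by fact
  interpret G: prob_space "std_gaussian :: (real^'n) measure" by (rule prob_space_std_gaussian)
  have "(\<integral>\<omega>. (\<xi> \<bullet> X \<omega>) ^ j \<partial>M)
      = (\<Sum>\<alpha>\<in>PiE {1..j} (\<lambda>_. UNIV). (\<Prod>l=1..j. \<xi> $ \<alpha> l) * (\<integral>\<omega>. (\<Prod>l=1..j. X \<omega> $ \<alpha> l) \<partial>M))"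
    unfolding inner_power_expand
    by (subst Bochner_Integration.integral_sum)
      (rule integrable_mult_right, rule integrable_component_product[OF assms(2,3) j(2)], simp)
  also have "\<dots> = (\<Sum>\<alpha>\<in>PiE {1..j} (\<lambda>_. UNIV). (\<Prod>l=1..j. \<xi> $ \<alpha> l) * (\<integral>x. (\<Prod>l=1..j. x $ \<alpha> l) \<partial>std_gaussian))"
    using moments j(1) by (simp add: gaussian_moments_upto_def)
  also have "\<dots> = (\<integral>x. (\<xi> \<bullet> x) ^ j \<partial>std_gaussian)"
    unfolding inner_power_expand
    by (subst Bochner_Integration.integral_sum)
      (rule integrable_mult_right,
        rule G.integrable_component_product[OF _ integrable_norm_power_std_gaussian j(2)],
        simp_all add: measurable_cong_sets[OF sets_std_gaussian refl])
  finally show ?thesis .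
qed

text \<open>
  The second moments of \<open>A F\<close> are the entries of \<open>A C A\<^sup>T\<close>, those of the Gaussian law the entries of
  the identity matrix.
\<close>

lemma cov_matrix_whitened:
  fixes F :: "'a \<Rightarrow> real^'n" and A :: "real^'n^'n"
  assumes "prob_space M" and F: "F \<in> borel_measurable M" "integrable M (\<lambda>\<omega>. norm (F \<omega>) ^ q)" "2 \<le> q"
    and mean: "(\<integral>\<omega>. F \<omega> \<partial>M) = 0"
    and moments: "gaussian_moments_upto r M (\<lambda>\<omega>. A *v F \<omega>)" and "2 \<le> r"
  shows "A ** cov_matrix M F ** transpose A = mat 1"
proof -
  interpret prob_space M by fact
  note F(1)[measurable]
  \<comment> \<open>The word \<open>\<alpha>\<close> of length 2 in the definition of the moments is \<open>(i, j)\<close>.\<close>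
  have two: "(\<Prod>l=1..2::nat. u $ (if l = 1 then i else j)) = u $ i * u $ j" for u :: "real^'n" and i j
    by (simp add: numeral_2_eq_2)
  have int2: "integrable M (\<lambda>\<omega>. F \<omega> $ k * F \<omega> $ l)" for k l
    using integrable_component_product[OF F, of "\<lambda>m. if m = 1 then k else l"] unfolding two .
  have int1: "integrable M F"
  proof (rule Bochner_Integration.integrable_bound)
    show "integrable M (\<lambda>\<omega>. 1 + norm (F \<omega>) ^ q)"
      using F(2) by (intro Bochner_Integration.integrable_add) auto
    have "norm (F \<omega>) \<le> 1 + norm (F \<omega>) ^ q" for \<omega>
      using power_le_one_plus_power[of "norm (F \<omega>)" 1 q] F(3) by simp
    then show "AE \<omega> in M. norm (F \<omega>) \<le> norm (1 + norm (F \<omega>) ^ q)"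
      by (auto intro: order_trans[OF _ abs_ge_self])
  qed simp
  have "(\<integral>\<omega>. F \<omega> $ k \<partial>M) = 0" for k
    using integral_bounded_linear[OF bounded_linear_vec_nth int1, of k] mean by simp
  then have cov: "cov_matrix M F $ k $ l = (\<integral>\<omega>. F \<omega> $ k * F \<omega> $ l \<partial>M)" for k l
    by (simp add: cov_matrix_def)
  have "(A ** cov_matrix M F ** transpose A) $ i $ j = mat 1 $ i $ j" for i j
  proof -
    have "(A ** cov_matrix M F ** transpose A) $ i $ j
        = (\<Sum>l\<in>UNIV. \<Sum>k\<in>UNIV. A $ i $ k * A $ j $ l * (\<integral>\<omega>. F \<omega> $ k * F \<omega> $ l \<partial>M))"
      by (simp add: matrix_matrix_mult_def transpose_def cov sum_distrib_left sum_distrib_right ac_simps)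
    also have "\<dots> = (\<integral>\<omega>. (\<Sum>l\<in>UNIV. \<Sum>k\<in>UNIV. A $ i $ k * A $ j $ l * (F \<omega> $ k * F \<omega> $ l)) \<partial>M)"
      using int2 by (simp add: Bochner_Integration.integral_sum integrable_mult_right)
    also have "\<dots> = (\<integral>\<omega>. (A *v F \<omega>) $ i * (A *v F \<omega>) $ j \<partial>M)"
      by (simp add: matrix_vector_mult_def sum_product ac_simps) (subst sum.swap, simp add: ac_simps)
    also have "\<dots> = (\<integral>x. x $ i * x $ j \<partial>(std_gaussian :: (real^'n) measure))"
      using moments[unfolded gaussian_moments_upto_def, rule_format, OF \<open>2 \<le> r\<close>, of "\<lambda>m. if m = 1 then i else j"]
      unfolding two .
    also have "\<dots> = mat 1 $ i $ j"
      by (simp add: std_gaussian_covariance mat_def)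
    finally show ?thesis .
  qed
  then show ?thesis by (simp add: vec_eq_iff)
qed

lemma measurable_matrix_vector_mult: "(\<lambda>y. A *v y) \<in> borel_measurable borel" for A :: "real^'n^'n"
  by (intro borel_measurable_continuous_onI linear_continuous_on matrix_vector_mul_bounded_linear)

lemma cf_distr_matrix:
  fixes F :: "'a \<Rightarrow> real^'n" and A :: "real^'n^'n"
  assumes [measurable]: "F \<in> borel_measurable M"
  shows "cf (distr M borel (\<lambda>\<omega>. A *v F \<omega>)) \<xi> = cf (distr M borel F) (transpose A *v \<xi>)"
proof -
  have [measurable]: "(\<lambda>\<omega>. A *v F \<omega>) \<in> borel_measurable M"
    by (rule measurable_compose[OF assms measurable_matrix_vector_mult])
  show ?thesis
    unfolding cf_def by (subst (1 2) integral_distr) (auto simp: adjoint_matrix_vector)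
qed

lemma cf_clt_law:
  fixes F :: "'a \<Rightarrow> real^'n"
  assumes "prob_space M" and F: "F \<in> borel_measurable M" and iid: "iid_copies M F Fs" and n: "1 \<le> n"
  shows "prob_space (clt_law M F Fs n)"
    and "cf (clt_law M F Fs n) \<xi>
           = cf (distr M borel (\<lambda>\<omega>. normalizer M F *v F \<omega>)) ((1 / sqrt (real n)) *\<^sub>R \<xi>) ^ n"
proof -
  interpret prob_space M by fact
  define A where "A = normalizer M F"
  define s where "s = 1 / sqrt (real n)"
  have ind: "indep_vars (\<lambda>_. borel) Fs {1..}" and same: "\<And>k. 1 \<le> k \<Longrightarrow> distr M borel (Fs k) = distr M borel F"
    using iid by (auto simp: iid_copies_def)
  have Fs: "Fs k \<in> borel_measurable M" if "1 \<le> k" for k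
    using ind that by (auto simp: indep_vars_def)
  have Am: "(\<lambda>y. A *v y) \<in> borel_measurable borel"
    by (rule measurable_matrix_vector_mult)
  have S: "(\<lambda>\<omega>. s *\<^sub>R (\<Sum>k=1..n. A *v Fs k \<omega>)) \<in> borel_measurable M"
    by (intro borel_measurable_scaleR borel_measurable_const borel_measurable_sum measurable_compose[OF Fs Am]) auto
  show "prob_space (clt_law M F Fs n)"
    unfolding clt_law_def using S unfolding A_def s_def by (rule prob_space_distr)
  define \<eta> where "\<eta> = transpose A *v (s *\<^sub>R \<xi>)"
  have cis: "cis (\<xi> \<bullet> (s *\<^sub>R (\<Sum>k=1..n. A *v Fs k \<omega>))) = (\<Prod>k=1..n. cis (\<eta> \<bullet> Fs k \<omega>))" for \<omega>
  proof -
    have "\<xi> \<bullet> (s *\<^sub>R (\<Sum>k=1..n. A *v Fs k \<omega>)) = (\<Sum>k=1..n. \<eta> \<bullet> Fs k \<omega>)"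
      unfolding \<eta>_def adjoint_matrix_vector[symmetric] by (simp add: inner_sum_right sum_distrib_left)
    then show ?thesis by (simp add: cis_conv_exp exp_sum sum_distrib_left)
  qed
  have "cf (clt_law M F Fs n) \<xi> = (\<integral>\<omega>. (\<Prod>k=1..n. cis (\<eta> \<bullet> Fs k \<omega>)) \<partial>M)"
    unfolding cf_def clt_law_def A_def[symmetric] s_def[symmetric]
    by (subst integral_distr[OF S measurable_cis_inner]) (simp only: cis)
  also have "\<dots> = (\<Prod>k=1..n. \<integral>\<omega>. cis (\<eta> \<bullet> Fs k \<omega>) \<partial>M)"
  proof (rule indep_vars_lebesgue_integral)
    have "indep_vars (\<lambda>_. borel) Fs {1..n}" using ind by (rule indep_vars_subset) auto
    then show "indep_vars (\<lambda>_. borel) (\<lambda>k \<omega>. cis (\<eta> \<bullet> Fs k \<omega>)) {1..n}"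
      by (rule indep_vars_compose2) simp
    show "integrable M (\<lambda>\<omega>. cis (\<eta> \<bullet> Fs k \<omega>))" if "k \<in> {1..n}" for k
      using that measurable_compose[OF Fs measurable_cis_inner]
      by (intro integrable_const_bound[of _ 1]) auto
  qed simp
  also have "\<dots> = (\<Prod>k=1..n. cf (distr M borel F) \<eta>)"
  proof (rule prod.cong)
    fix k assume k: "k \<in> {1..n}"
    then have "(\<integral>\<omega>. cis (\<eta> \<bullet> Fs k \<omega>) \<partial>M) = cf (distr M borel (Fs k)) \<eta>"
      unfolding cf_def using Fs by (subst integral_distr) auto
    with k same show "(\<integral>\<omega>. cis (\<eta> \<bullet> Fs k \<omega>) \<partial>M) = cf (distr M borel F) \<eta>" by simp
  qed simp
  also have "\<dots> = cf (distr M borel (\<lambda>\<omega>. A *v F \<omega>)) (s *\<^sub>R \<xi>) ^ n"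
    by (simp add: cf_distr_matrix[OF F] \<eta>_def)
  finally show "cf (clt_law M F Fs n) \<xi> = cf (distr M borel (\<lambda>\<omega>. normalizer M F *v F \<omega>)) ((1 / sqrt (real n)) *\<^sub>R \<xi>) ^ n"
    by (simp add: A_def s_def)
qed

lemma tv_dist_le_mult_bound:
  fixes P Q :: "(real^'n) measure"
  assumes P: "prob_space P" "sets P = sets borel" and Q: "prob_space Q" "sets Q = sets borel"
    and bound: "mult_bound (\<lambda>\<xi>. cf P \<xi> - cf Q \<xi>) \<delta>"
  shows "tv_dist P Q \<le> \<delta>"
proof (rule tv_dist_le_trig_test[OF P(1) Q(1) P(2) Q(2)])
  have fin: "finite_measure P" "finite_measure Q" using P(1) Q(1) by (auto simp: prob_space_def)
  fix L :: "(complex \<times> (real^'n)) list" assume L: "\<And>x. \<bar>trig L x\<bar> \<le> 1"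
  show "\<bar>(\<integral>x. trig L x \<partial>P) - (\<integral>x. trig L x \<partial>Q)\<bar> \<le> \<delta>"
    using mult_boundD[OF bound L, of 0]
    by (simp add: trig_apply_mult_diff trig_apply_mult_cf fin P Q)
qed

lemma mult_bound_scale_argument:
  fixes \<phi> :: "'a::euclidean_space \<Rightarrow> complex"
  assumes "mult_bound \<phi> K" "s \<noteq> 0"
  shows "mult_bound (\<lambda>\<xi>. \<phi> (s *\<^sub>R \<xi>)) K"
proof (rule mult_bound_comp_linear[OF assms(1)])
  show "surj (\<lambda>y::'a. s *\<^sub>R y)" using assms(2) by (intro surjI[of _ "\<lambda>y. y /\<^sub>R s"]) simp
qed simp

lemma real_div_sqrt_power:
  assumes "1 \<le> n" "1 \<le> r"
  shows "real n / sqrt (real n) ^ (r + 1) = 1 / real n powr ((real r - 1) / 2)"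
proof -
  have n: "0 < real n" using assms by simp
  have "sqrt (real n) ^ (r + 1) = real n powr ((real r + 1) / 2)"
  proof -
    have "sqrt (real n) ^ (r + 1) = (real n powr (1 / 2)) powr real (r + 1)"
      using n by (simp only: powr_half_sqrt powr_realpow real_sqrt_gt_zero less_imp_le)
    then show ?thesis by (simp only: powr_powr) (simp add: add.commute)
  qed
  also have "\<dots> = real n powr (1 + (real r - 1) / 2)" by (simp add: field_simps)
  also have "\<dots> = real n * real n powr ((real r - 1) / 2)" using n by (simp add: powr_add)
  finally show ?thesis using n by simp
qed

section \<open>The rate of convergence\<close>

theorem theorem2p6:
  fixes r :: nat and lo hi \<epsilon> :: real and D :: "(real^'n) set"
  assumes "r \<ge> 2"
  shows "\<exists>C>0. \<forall>(M :: 'a measure) (F :: 'a \<Rightarrow> real^'n) (Fs :: nat \<Rightarrow> 'a \<Rightarrow> real^'n).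
    prob_space M \<longrightarrow>
    F \<in> borel_measurable M \<longrightarrow>
    dominates_leb (distr M borel F) \<epsilon> D \<longrightarrow>
    integrable M (\<lambda>\<omega>. norm (F \<omega>) ^ (r + 1)) \<longrightarrow>
    (\<integral>\<omega>. F \<omega> \<partial>M) = 0 \<longrightarrow>
    lambda_min M F = lo \<longrightarrow>
    lambda_max M F = hi \<longrightarrow>
    iid_copies M F Fs \<longrightarrow>
    gaussian_moments_upto r M (\<lambda>\<omega>. normalizer M F *v F \<omega>) \<longrightarrow>
    (\<forall>n\<ge>1. tv_dist (clt_law M F Fs n) std_gaussian
        \<le> C * (1 + (\<integral>\<omega>. norm (F \<omega>) ^ (r + 1) \<partial>M)) ^ (max (r div 3) 1)
            * (1 / real n powr ((real r - 1) / 2)))"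
proof (cases "0 < \<epsilon> \<and> open D \<and> D \<noteq> {}")
  case False
  then have "\<not> dominates_leb \<mu> \<epsilon> D" for \<mu> by (auto simp: dominates_leb_def)
  then show ?thesis by (intro exI[of _ 1]) simp
next
  case True
  define q where "q = r + 1"
  have q: "1 \<le> q" "2 \<le> q" using assms by (auto simp: q_def)
  let ?\<gamma> = "std_gaussian :: (real^'n) measure"
  obtain K1 where K1: "0 < K1" "\<And>\<mu> :: (real^'n) measure. prob_space \<mu> \<Longrightarrow> sets \<mu> = sets borel \<Longrightarrow>
      dominates_leb \<mu> \<epsilon> D \<Longrightarrow> smooth_powers (cf \<mu>) q K1"
    using smooth_powers_dominates_leb[of \<epsilon> D q] True q by blast
  have "0 < std_normal_density 1 ^ CARD('n)" by (simp add: normal_density_pos)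
  then obtain K2 where K2: "0 < K2" "smooth_powers (cf ?\<gamma>) q K2"
    using smooth_powers_dominates_leb[of "std_normal_density 1 ^ CARD('n)" "ball 0 1 :: (real^'n) set" q]
      q prob_space_std_gaussian dominates_leb_std_gaussian sets_std_gaussian by fastforce
  define c where "c = 1 / sqrt lo"
  define K where "K = max (K1 * max 1 (c ^ q)) K2"
  \<comment> \<open>The constant is fixed before any law is given, for every value of \<open>hi\<close>; the absolute value keeps it
    nonnegative.\<close>
  define h where "h = sqrt \<bar>hi\<bar> ^ q"
  define g where "g = (\<integral>x. norm x ^ q \<partial>?\<gamma>)"
  have g: "0 \<le> g" unfolding g_def by (rule integral_nonneg_AE) simp
  have h: "0 \<le> h" by (simp add: h_def)
  have K: "0 \<le> K" using K2(1) by (simp add: K_def)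
  \<comment> \<open>The 2 is for the trivial bound on the distance, needed at \<open>n = 1\<close>; the other term is what remains of
    the Lindeberg bound after separating the moment of \<open>F\<close> and the power of \<open>n\<close>.\<close>
  define C where "C = max 2 ((2 + h + g) * K * 2 ^ q)"
  have C: "2 \<le> C" by (simp add: C_def)
  show ?thesis
  proof (intro exI[of _ C] conjI allI impI)
    show "0 < C" using C by simp
  next
    fix M :: "'a measure" and F :: "'a \<Rightarrow> real^'n" and Fs :: "nat \<Rightarrow> 'a \<Rightarrow> real^'n" and n :: nat
    assume M: "prob_space M" and F [measurable]: "F \<in> borel_measurable M"
      and dom: "dominates_leb (distr M borel F) \<epsilon> D"
      and int: "integrable M (\<lambda>\<omega>. norm (F \<omega>) ^ (r + 1))" and mean: "(\<integral>\<omega>. F \<omega> \<partial>M) = 0"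
      and lo: "lambda_min M F = lo" and hi: "lambda_max M F = hi"
      and iid: "iid_copies M F Fs"
      and moments: "gaussian_moments_upto r M (\<lambda>\<omega>. normalizer M F *v F \<omega>)"
      and n: "1 \<le> n"
    interpret prob_space M by fact
    note int = int[folded q_def]
    define A where "A = normalizer M F"
    define B where "B = cov_matrix M F ** transpose A"
    define m where "m = (\<integral>\<omega>. norm (F \<omega>) ^ q \<partial>M)"
    have m: "0 \<le> m" unfolding m_def by (rule integral_nonneg_AE) simp
    note moments = moments[folded A_def]
    have white: "A ** cov_matrix M F ** transpose A = mat 1"
      by (rule cov_matrix_whitened[OF M F int q(2) mean moments assms])
    note bounds = whitening_matrix_bounds[OF white, folded lambda_min_def lambda_max_def B_def, unfolded lo hi]
    have AF: "norm (A *v x) \<le> sqrt \<bar>hi\<bar> * norm x" for x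
    proof -
      have "hi * (norm x)\<^sup>2 \<le> \<bar>hi\<bar> * (norm x)\<^sup>2" by (intro mult_right_mono) auto
      with bounds(3)[of x] have "(norm (A *v x))\<^sup>2 \<le> \<bar>hi\<bar> * (norm x)\<^sup>2" by linarith
      then have "sqrt ((norm (A *v x))\<^sup>2) \<le> sqrt (\<bar>hi\<bar> * (norm x)\<^sup>2)" by (rule real_sqrt_le_mono)
      then show ?thesis by (simp add: real_sqrt_mult)
    qed
    have Bv: "norm (B *v v) \<le> c * norm v" for v
    proof -
      have "(norm (B *v v))\<^sup>2 \<le> (norm v)\<^sup>2 / lo"
        using bounds(2)[of "B *v v"] bounds(1) by (simp add: bounds(4) field_simps)
      then have "sqrt ((norm (B *v v))\<^sup>2) \<le> sqrt ((norm v)\<^sup>2 / lo)" by (rule real_sqrt_le_mono)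
      then show ?thesis by (simp add: c_def real_sqrt_divide)
    qed
    define X where "X \<omega> = A *v F \<omega>" for \<omega>
    have X [measurable]: "X \<in> borel_measurable M"
      unfolding X_def[abs_def] by (rule measurable_compose[OF F measurable_matrix_vector_mult])
    have Xle: "norm (X \<omega>) ^ q \<le> h * norm (F \<omega>) ^ q" for \<omega>
      using power_mono[OF AF, of "F \<omega>" q] by (simp add: X_def h_def power_mult_distrib)
    have iX: "integrable M (\<lambda>\<omega>. norm (X \<omega>) ^ q)"
      by (rule Bochner_Integration.integrable_bound[OF integrable_mult_right[OF int, of h]])
        (auto intro: order_trans[OF Xle abs_ge_self])
    have EX: "(\<integral>\<omega>. norm (X \<omega>) ^ q \<partial>M) \<le> h * m"
    proof -
      have "(\<integral>\<omega>. norm (X \<omega>) ^ q \<partial>M) \<le> (\<integral>\<omega>. h * norm (F \<omega>) ^ q \<partial>M)"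
        by (intro integral_mono iX integrable_mult_right int Xle)
      then show ?thesis by (simp add: m_def)
    qed
    define \<mu> where "\<mu> = distr M borel X"
    have \<mu>: "prob_space \<mu>" "sets \<mu> = sets borel" "integrable \<mu> (\<lambda>y. norm y ^ q)"
      using iX by (auto simp: \<mu>_def prob_space_distr integrable_distr_eq)
    have \<mu>int: "(\<integral>y. f y \<partial>\<mu>) = (\<integral>\<omega>. f (X \<omega>) \<partial>M)" if "f \<in> borel_measurable borel" for f :: "real^'n \<Rightarrow> real"
      unfolding \<mu>_def using that by (intro integral_distr X)
    have cf\<mu>: "cf \<mu> = (\<lambda>\<xi>. cf (distr M borel F) (transpose A *v \<xi>))"
      unfolding \<mu>_def X_def[abs_def] using cf_distr_matrix[OF F] by blast
    have "smooth_powers (cf (distr M borel F)) q K1"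
      using dom by (intro K1(2) prob_space_distr F) auto
    then have "smooth_powers (cf \<mu>) q (K1 * max 1 (c ^ q))"
      unfolding cf\<mu>
      by (rule smooth_powers_comp_linear[where T = "\<lambda>y. A *v y" and T' = "\<lambda>y. B *v y"])
        (use K1(1) bounds(1) in \<open>simp_all only: adjoint_matrix_vector bounds(4) Bv, simp_all add: c_def\<close>)
    then have sm\<mu>: "smooth_powers (cf \<mu>) q K" by (rule smooth_powers_mono) (simp add: K_def)
    have sm\<gamma>: "smooth_powers (cf ?\<gamma>) q K" using K2(2) by (rule smooth_powers_mono) (simp add: K_def)
    have mom: "(\<integral>y. (\<xi> \<bullet> y) ^ j \<partial>\<mu>) = (\<integral>y. (\<xi> \<bullet> y) ^ j \<partial>?\<gamma>)" if "j < q" for \<xi> j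
      using gaussian_moments_inner_power[OF finite_measure_axioms X iX moments[folded X_def], of j \<xi>] that
      by (subst \<mu>int) (auto simp: q_def)
    have P: "prob_space (clt_law M F Fs n)" "sets (clt_law M F Fs n) = sets borel"
      using cf_clt_law(1)[OF M F iid n] by (auto simp: clt_law_def)
    define s where "s = 1 / sqrt (real n)"
    define R where "R = 1 / real n powr ((real r - 1) / 2)"
    have main: "tv_dist (clt_law M F Fs n) ?\<gamma> \<le> C * (1 + m) * R"
    proof (cases "n = 1")
      case True
      have "tv_dist (clt_law M F Fs n) ?\<gamma> \<le> 2"
        by (rule tv_dist_le_2[OF P(1) prob_space_std_gaussian P(2) sets_std_gaussian])
      also have "\<dots> \<le> C * (1 + m)" using C m mult_mono[of 2 C 1 "1 + m"] by simp
      finally show ?thesis by (simp add: R_def True)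
    next
      case False
      then have n2: "2 \<le> n" using n by simp
      define b where "b = real n * ((2 + ((\<integral>y. norm y ^ q \<partial>\<mu>) + g) / fact q) * K / (sqrt (real n) / 2) ^ q)"
      have "mult_bound (\<lambda>\<xi>. cf \<mu> \<xi> ^ n - cf ?\<gamma> \<xi> ^ n) b"
        unfolding b_def g_def
        by (rule lindeberg_bound[OF \<mu> prob_space_std_gaussian sets_std_gaussian
              integrable_norm_power_std_gaussian mom sm\<mu> sm\<gamma> K n2])
      then have "mult_bound (\<lambda>\<xi>. cf \<mu> (s *\<^sub>R \<xi>) ^ n - cf ?\<gamma> (s *\<^sub>R \<xi>) ^ n) b"
        by (rule mult_bound_scale_argument) (use n in \<open>simp add: s_def\<close>)
      then have "mult_bound (\<lambda>\<xi>. cf (clt_law M F Fs n) \<xi> - cf ?\<gamma> \<xi>) b"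
        by (simp only: s_def \<mu>_def X_def[abs_def] A_def cf_clt_law(2)[OF M F iid n] cf_std_gaussian_stable[OF n])
      then have "tv_dist (clt_law M F Fs n) ?\<gamma> \<le> b"
        by (rule tv_dist_le_mult_bound[OF P prob_space_std_gaussian sets_std_gaussian])
      also have "b = (2 + ((\<integral>\<omega>. norm (X \<omega>) ^ q \<partial>M) + g) / fact q) * K * 2 ^ q * R"
      proof -
        have "b = (2 + ((\<integral>\<omega>. norm (X \<omega>) ^ q \<partial>M) + g) / fact q) * K * 2 ^ q * (real n / sqrt (real n) ^ q)"
          by (simp add: b_def \<mu>int power_divide)
        also have "real n / sqrt (real n) ^ q = R"
          using real_div_sqrt_power[OF n, of r] assms by (simp only: R_def q_def)
        finally show ?thesis .
      qed
      also have "\<dots> \<le> ((2 + h + g) * (1 + m)) * K * 2 ^ q * R"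
      proof (intro mult_right_mono)
        have "((\<integral>\<omega>. norm (X \<omega>) ^ q \<partial>M) + g) / fact q \<le> (h * m + g) / 1"
          using EX g h m by (intro frac_le) (auto simp: fact_ge_1)
        moreover have "0 \<le> 2 * m + g * m" using g m by simp
        ultimately show "2 + ((\<integral>\<omega>. norm (X \<omega>) ^ q \<partial>M) + g) / fact q \<le> (2 + h + g) * (1 + m)"
          using h by (simp add: algebra_simps)
      qed (use K in \<open>auto simp: R_def\<close>)
      also have "\<dots> = ((2 + h + g) * K * 2 ^ q) * ((1 + m) * R)" by (simp only: ac_simps)
      also have "\<dots> \<le> C * ((1 + m) * R)"
        using m by (intro mult_right_mono) (auto simp: C_def R_def)
      finally show ?thesis by (simp add: mult.assoc)
    qed
    \<comment> \<open>The bound holds with the first power of \<open>1 + m\<close>, which is at most the stated one since \<open>1 + m \<ge> 1\<close>.\<close>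
    also have "C * (1 + m) * R \<le> C * (1 + m) ^ (max (r div 3) 1) * R"
    proof (intro mult_right_mono mult_left_mono)
      show "1 + m \<le> (1 + m) ^ max (r div 3) 1"
        using m power_increasing[of 1 "max (r div 3) 1" "1 + m"] by simp
    qed (use C in \<open>auto simp: R_def\<close>)
    finally show "tv_dist (clt_law M F Fs n) std_gaussian
        \<le> C * (1 + (\<integral>\<omega>. norm (F \<omega>) ^ (r + 1) \<partial>M)) ^ (max (r div 3) 1)
            * (1 / real n powr ((real r - 1) / 2))"
      by (simp add: m_def R_def q_def)
  qed
qed

end
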